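(* Let $(T_t)_{t\in\mathbb R}$ be a mixing rank-one flow on a Lebesgue probability space $(X,\mu)$. Then for every real $\alpha>1$ the flow $(T_t)_{t\in\mathbb R}$ is disjoint from the flow $(T_{\alpha t})_{t\in\mathbb R}$.
   Context: A flow is a measurable one-parameter group $(T_t)_{t\in\mathbb R}$ of invertible measure-preserving transformations of a (non-atomic) Lebesgue probability space $(X,\mu)$. The flow is of rank one if there is a sequence $\xi_j$ of continuous rectangular towers such that every measurable set $A$ can be approximated by $\xi_j$-measurable sets $A_j$, i.e. $\mu(A\,\triangle\,A_j)\to0$. Here a rectangular tower is a subset of $X$ identified measurably (with measure proportional to the product measure) with a rectangle $B_j\times[0,H_j)$ on which the flow acts by unit-speed vertical translation, $T_t(b,s)=(b,s+t)$ as long as $0\le s,\ s+t<H_j$. The floors are the sets $B_j\times\{s\}$, and a $\xi_j$-measurable set is a measurable union of floors. In particular, for a rank-one flow there are sequences $t_j\to0$ (with $1/t_j\in\mathbb N$), $h_j\to\infty$ and measurable sets $E_j$ such that $E_j,T_{t_j}E_j,T_{2t_j}E_j,\dots,T_{h_jt_j}E_j$ are pairwise disjoint and, together with the complement $E'_j$ of their union, form partitions converging to the partition into points. The flow is mixing if $\mu(A\cap T_tB)\to\mu(A)\mu(B)$ as $t\to\infty$ for all measurable $A,B$. A joining of two flows $(\tilde T_t)$ and $(T_t)$ on $(X,\mu)$ is a measure $\nu$ on $X\times X$ that is invariant under $\tilde T_t\times T_t$ for all $t\in\mathbb R$ and satisfies $\nu(A\times X)=\nu(X\times A)=\mu(A)$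 for all measurable $A$. Two flows are disjoint if $\mu\times\mu$ is their only joining. *)

theory Defs
  imports "HOL-Probability.Probability"
begin

definition measure_iso :: "'a measure \<Rightarrow> 'b measure \<Rightarrow> ('a \<Rightarrow> 'b) \<Rightarrow> bool" where
  "measure_iso M N f \<longleftrightarrow>
     bij_betw f (space M) (space N) \<and>
     f \<in> M \<rightarrow>\<^sub>M N \<and>
     the_inv_into (space M) f \<in> N \<rightarrow>\<^sub>M M \<and>
     distr M N f = N"

text \<open>
  Non-atomic Lebesgue (Rokhlin) probability space: complete, and isomorphic mod 0
  to the unit interval with Lebesgue measure.
\<close>

definition lebesgue_prob_space :: "'a measure \<Rightarrow> bool" where
  "lebesgue_prob_space M \<longleftrightarrow>
     prob_space M \<and> complete_measure M \<and>
     (\<exists>X Y f. X \<in> sets M \<and> emeasure M X = 1 \<and>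
        Y \<in> sets (lebesgue_on {0..1::real}) \<and> emeasure lebesgue Y = 1 \<and>
        measure_iso (restrict_space M X) (lebesgue_on Y) f)"

text \<open>
  Since the space is complete, joint measurability has to refer to the completed
  product: preimages of null sets under \<open>(t, x) \<mapsto> T t x\<close> need not lie in the
  uncompleted product sigma-algebra, even for a rotation flow on the circle.
  Invertibility of each \<open>T t\<close> follows from the group law.
\<close>

definition mp_flow :: "'a measure \<Rightarrow> (real \<Rightarrow> 'a \<Rightarrow> 'a) \<Rightarrow> bool" where
  "mp_flow M T \<longleftrightarrow>
     (\<forall>t. T t \<in> M \<rightarrow>\<^sub>M M \<and> distr M M (T t) = M) \<and>
     (\<forall>x\<in>space M. T 0 x = x) \<and>
     (\<forall>s t. \<forall>x\<in>space M. T (s + t) x = T s (T t x)) \<and>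
     (\<lambda>(t, x). T t x) \<in> completion (lborel \<Otimes>\<^sub>M M) \<rightarrow>\<^sub>M M"

definition mixing_flow :: "'a measure \<Rightarrow> (real \<Rightarrow> 'a \<Rightarrow> 'a) \<Rightarrow> bool" where
  "mixing_flow M T \<longleftrightarrow>
     (\<forall>A\<in>sets M. \<forall>B\<in>sets M.
        ((\<lambda>t. measure M (A \<inter> T t ` B)) \<longlongrightarrow> measure M A * measure M B) at_top)"

text \<open>
  A rectangular tower is given by a base \<open>\<beta>\<close> (a set carrying its own finite measure),
  a height \<open>H\<close>, and an identification \<open>\<phi>\<close> of the rectangle \<open>space \<beta> \<times> [0, H)\<close> with a
  measurable subset \<open>Y\<close> of the space, under which the measure on \<open>Y\<close> is \<open>c\<close> times
  the (completed) product measure.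
\<close>

definition rectangular_tower ::
    "'a measure \<Rightarrow> (real \<Rightarrow> 'a \<Rightarrow> 'a) \<Rightarrow> 'b measure \<Rightarrow> real \<Rightarrow> ('b \<times> real \<Rightarrow> 'a) \<Rightarrow> bool" where
  "rectangular_tower M T \<beta> H \<phi> \<longleftrightarrow>
     finite_measure \<beta> \<and> 0 < H \<and>
     (\<exists>Y c. Y \<in> sets M \<and> 0 < c \<and>
        measure_iso
          (scale_measure (ennreal c) (completion (\<beta> \<Otimes>\<^sub>M lebesgue_on {0..<H})))
          (restrict_space M Y) \<phi>) \<and>
     (\<forall>b\<in>space \<beta>. \<forall>s t. s \<in> {0..<H} \<longrightarrow> s + t \<in> {0..<H} \<longrightarrow>
        T t (\<phi> (b, s)) = \<phi> (b, s + t))"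

definition tower_sets ::
    "'a measure \<Rightarrow> 'b measure \<Rightarrow> real \<Rightarrow> ('b \<times> real \<Rightarrow> 'a) \<Rightarrow> 'a set set" where
  "tower_sets M \<beta> H \<phi> =
     {A \<in> sets M. \<exists>S. S \<subseteq> {0..<H} \<and> A = (\<Union>s\<in>S. \<phi> ` (space \<beta> \<times> {s}))}"

text \<open>
  Taking the base measures on the type \<open>'a\<close> of the space itself is no restriction:
  \<open>b \<mapsto> \<phi> (b, 0)\<close> embeds the base of a tower into the space.
\<close>

definition rank_one_flow :: "'a measure \<Rightarrow> (real \<Rightarrow> 'a \<Rightarrow> 'a) \<Rightarrow> bool" where
  "rank_one_flow M T \<longleftrightarrow>
     (\<exists>(\<beta> :: nat \<Rightarrow> 'a measure) (H :: nat \<Rightarrow> real) (\<phi> :: nat \<Rightarrow> 'a \<times> real \<Rightarrow> 'a).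
        (\<forall>j. rectangular_tower M T (\<beta> j) (H j) (\<phi> j)) \<and>
        (\<forall>A\<in>sets M. \<exists>A'. (\<forall>j. A' j \<in> tower_sets M (\<beta> j) (H j) (\<phi> j)) \<and>
           (\<lambda>j. measure M ((A - A' j) \<union> (A' j - A))) \<longlonglongrightarrow> 0))"

definition joining ::
    "'a measure \<Rightarrow> (real \<Rightarrow> 'a \<Rightarrow> 'a) \<Rightarrow> (real \<Rightarrow> 'a \<Rightarrow> 'a) \<Rightarrow> ('a \<times> 'a) measure \<Rightarrow> bool" where
  "joining M S T \<nu> \<longleftrightarrow>
     sets \<nu> = sets (M \<Otimes>\<^sub>M M) \<and>
     (\<forall>t. distr \<nu> (M \<Otimes>\<^sub>M M) (map_prod (S t) (T t)) = \<nu>) \<and>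
     (\<forall>A\<in>sets M. emeasure \<nu> (A \<times> space M) = emeasure M A \<and>
                  emeasure \<nu> (space M \<times> A) = emeasure M A)"

definition disjoint_flows ::
    "'a measure \<Rightarrow> (real \<Rightarrow> 'a \<Rightarrow> 'a) \<Rightarrow> (real \<Rightarrow> 'a \<Rightarrow> 'a) \<Rightarrow> bool" where
  "disjoint_flows M S T \<longleftrightarrow> (\<forall>\<nu>. joining M S T \<nu> \<longleftrightarrow> \<nu> = M \<Otimes>\<^sub>M M)"

end

theory Submission
  imports Defs
begin

text \<open>
  Write \<open>\<mu>\<close> for the measure \<open>M\<close>, and fix a joining \<open>\<nu>\<close> of \<open>T t\<close> and \<open>T (\<alpha> * t)\<close>. In a tower of height \<open>H j\<close> each point has a height
  \<open>p j\<close>, so a pair \<open>(x, y)\<close> of points of the tower sits at \<open>(p j x, p j y)\<close> in the square of side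
  \<open>H j\<close>. As long as it stays in the square, the product flow moves it along a line of slope
  \<open>\<alpha>\<close>, whose offset is \<open>p j y - \<alpha> * p j x\<close>, and by invariance \<open>\<nu>\<close> is uniform along these lines.

  The first half of the proof says that a part of \<open>\<nu>\<close> that is a union of long lines and gives little
  mass to every strip of bounded width is almost a product. The integral of
  \<open>1\<^sub>A(x) (1\<^sub>B(y) - \<mu>(B))\<close> over it is an average of integrals along lines, and the Cauchy-Schwarz
  inequality (\<open>line_average_bound\<close>) bounds it by the correlations of \<open>1\<^sub>B - \<mu>(B)\<close> with its translate
  by the difference of two offsets. For most pairs of lines this difference is large. Mixing then
  makes the correlation small, even if it is only taken over an arbitrary interval of heights
  (\<open>interval_correlations_small\<close>); this localisation is an application of van der Corput's trick.

  The second half says that such a part exists, and this is where \<open>1 < \<alpha>\<close> enters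
  (\<open>light_mass\<close>). At most \<open>1 / \<epsilon>\<close> strips have mass at least \<open>\<epsilon>\<close>. During the time \<open>H j / \<alpha>\<close> the
  first coordinate stays in the tower with probability about \<open>1 - 1 / \<alpha>\<close>, whereas the second
  coordinate moves for time \<open>H j\<close> and thus has to leave the tower. By mixing its
  height after the return, compared with the height before, has no preferred value
  (\<open>return_offsets_spread\<close>), so a pair in a heavy strip rarely arrives in a heavy strip. Hence the light
  strips carry at least about half of \<open>1 - 1 / \<alpha>\<close>, and the first half yields
  \<open>\<nu> \<ge> c (\<mu> \<times> \<mu>)\<close> with \<open>c = (1 - 1 / \<alpha>) / 4\<close> for every joining \<open>\<nu>\<close> (\<open>joining_ge_product\<close>).

  This bound improves itself. If \<open>\<nu> \<ge> b (\<mu> \<times> \<mu>)\<close> with \<open>b < 1\<close>, then the normalised difference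
  is again a joining, to which the bound applies; iterating gives \<open>\<nu> \<ge> \<mu> \<times> \<mu>\<close>, and
  both are probability measures.

  All of this needs towers of growing height. That the heights tend to infinity follows from
  mixing (\<open>heights_tend_to_infinity\<close>): if they were bounded along a subsequence, then
  \<open>T (H j)\<close> would be close to the identity there. Both this and \<open>return_offsets_spread\<close> rest on one
  observation (\<open>equal_heights_coherent\<close>): two points of equal height in a late tower \<open>j\<close> lie, for most
  times, in the same sets of a given finite family, since these are nearly unions of floors of that tower; so
  they have almost the same height in a fixed early tower.
\<close>

section \<open>Measure-preserving flows\<close>

lemmas integral_cong_space = Bochner_Integration.integral_cong[OF refl]

locale measure_flow = prob_space M for M :: "'a measure" +
  fixes T :: "real \<Rightarrow> 'a \<Rightarrow> 'a"
  assumes flow: "mp_flow M T"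
begin

lemma T_measurable [measurable]: "T t \<in> M \<rightarrow>\<^sub>M M"
  and T_distr: "distr M M (T t) = M"
  and T_zero: "x \<in> space M \<Longrightarrow> T 0 x = x"
  and T_add: "x \<in> space M \<Longrightarrow> T (s + t) x = T s (T t x)"
  and T_joint: "(\<lambda>(t, x). T t x) \<in> completion (lborel \<Otimes>\<^sub>M M) \<rightarrow>\<^sub>M M"
  using flow unfolding mp_flow_def by auto

lemma T_space [simp]: "x \<in> space M \<Longrightarrow> T t x \<in> space M"
  using T_measurable[of t] by (rule measurable_space)

lemma T_minus [simp]: "x \<in> space M \<Longrightarrow> T (- t) (T t x) = x"
  and T_minus' [simp]: "x \<in> space M \<Longrightarrow> T t (T (- t) x) = x"
  using T_add[of x "- t" t] T_add[of x t "- t"] T_zero[of x] by simp_all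

abbreviation pre :: "real \<Rightarrow> 'a set \<Rightarrow> 'a set" where
  "pre t B \<equiv> {x \<in> space M. T t x \<in> B}"

abbreviation moves :: "'a set \<Rightarrow> real \<Rightarrow> 'a set \<Rightarrow> 'a set" where
  "moves A t B \<equiv> {x \<in> space M. x \<in> A \<and> T t x \<in> B}"

abbreviation leaves :: "'a set \<Rightarrow> real \<Rightarrow> 'a set" where
  "leaves A t \<equiv> {x \<in> space M. x \<in> A \<and> T t x \<notin> A}"

abbreviation floors :: "('a \<Rightarrow> real) \<Rightarrow> real set \<Rightarrow> 'a set" where
  "floors p S \<equiv> {x \<in> space M. p x \<in> S}"

lemma prob_vimage_T:
  assumes "A \<in> sets M"
  shows "prob (pre t A) = prob A"
proof -
  have "prob A = measure (distr M M (T t)) A" by (simp add: T_distr)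
  also have "\<dots> = prob (T t -` A \<inter> space M)" using assms by (intro measure_distr) auto
  also have "T t -` A \<inter> space M = pre t A" by auto
  finally show ?thesis by simp
qed

lemma integral_T:
  fixes f :: "'a \<Rightarrow> real"
  assumes [measurable]: "f \<in> borel_measurable M"
  shows "(\<integral>x. f (T t x) \<partial>M) = (\<integral>x. f x \<partial>M)"
  using integral_distr[OF T_measurable[of t] assms] by (simp add: T_distr)

lemma image_T:
  assumes "B \<in> sets M"
  shows "T t ` B = pre (- t) B"
proof -
  have "B \<subseteq> space M" using assms by (rule sets.sets_into_space)
  then have "x \<in> T t ` B" if "x \<in> space M" "T (- t) x \<in> B" for x
    using that by (intro image_eqI[of _ _ "T (- t) x"]) simp_all
  with \<open>B \<subseteq> space M\<close> show ?thesis by auto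
qed

text \<open>
  By Fubini's theorem, the average over \<open>x\<close> of the time that the orbit of \<open>x\<close> spends in \<open>D\<close> is
  governed by the measure of \<open>D\<close>, so by Markov's inequality most points spend little time there.
  The sojourn times are enclosed in Borel sets because joint measurability with respect to the
  completed product makes them measurable only for almost every \<open>x\<close>.
\<close>

lemma few_points_sojourn_long:
  assumes D: "D \<in> sets M" and "0 \<le> L" "0 < \<theta>"
  obtains B where "B \<in> sets M" "prob B \<le> 2 * L * prob D / \<theta>"
    "\<And>x. x \<in> space M - B \<Longrightarrow> \<exists>Z. Z \<in> sets borel \<and> emeasure lborel Z < ennreal \<theta> \<and>
       (\<forall>s. \<bar>s\<bar> \<le> L \<longrightarrow> T s x \<in> D \<longrightarrow> s \<in> Z)"
proof -
  note emeasure_pair = emeasure_pair_measure_alt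
  interpret pair_sigma_finite lborel M ..
  define E where "E = {z \<in> space (completion (lborel \<Otimes>\<^sub>M M)). (case z of (t, x) \<Rightarrow> T t x) \<in> D}
     \<inter> ({-L..L} \<times> space M)"
  have "{z \<in> space (completion (lborel \<Otimes>\<^sub>M M)). (case z of (t, x) \<Rightarrow> T t x) \<in> D} \<in> sets (completion (lborel \<Otimes>\<^sub>M M))"
    using measurable_sets[OF T_joint D] by (simp add: vimage_def Int_def conj_commute)
  moreover have "{-L..L} \<times> space M \<in> sets (lborel \<Otimes>\<^sub>M M)" by auto
  ultimately have "E \<in> sets (completion (lborel \<Otimes>\<^sub>M M))"
    unfolding E_def by (intro sets.Int) auto
  then obtain S N N' where E: "E = S \<union> N" "N \<subseteq> N'" and N': "N' \<in> null_sets (lborel \<Otimes>\<^sub>M M)"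
    and S: "S \<in> sets (lborel \<Otimes>\<^sub>M M)" by (rule sets_completionE)
  have SE: "S \<subseteq> E" using E by auto
  \<comment> \<open>a superset of \<open>E\<close> of the same measure that is measurable without completion\<close>
  define F where "F = S \<union> N'"
  have F [measurable]: "F \<in> sets (lborel \<Otimes>\<^sub>M M)" using S N' unfolding F_def by auto
  have "emeasure (lborel \<Otimes>\<^sub>M M) F = emeasure (lborel \<Otimes>\<^sub>M M) S"
    unfolding F_def using S N' by (intro emeasure_Un_null_set) auto
  also have "\<dots> = (\<integral>\<^sup>+t. emeasure M (Pair t -` S) \<partial>lborel)"
    using S by (rule emeasure_pair)
  also have "\<dots> \<le> (\<integral>\<^sup>+t. emeasure M D * indicator {-L..L} t \<partial>lborel)"
  proof (rule nn_integral_mono)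
    fix t :: real
    show "emeasure M (Pair t -` S) \<le> emeasure M D * indicator {-L..L} t"
    proof (cases "t \<in> {-L..L}")
      case True
      have "Pair t -` S \<subseteq> pre t D"
        using SE by (auto simp: E_def)
      then have "emeasure M (Pair t -` S) \<le> emeasure M (pre t D)"
        using D by (intro emeasure_mono) auto
      also have "\<dots> = emeasure M D" using prob_vimage_T[OF D] by (simp add: emeasure_eq_measure)
      finally show ?thesis using True by simp
    next
      case False
      then have "Pair t -` S = {}" using SE by (auto simp: E_def)
      then show ?thesis by simp
    qed
  qed
  also have "\<dots> = emeasure M D * ennreal (2 * L)"
    using \<open>0 \<le> L\<close> by (subst nn_integral_cmult) auto
  also have "\<dots> = ennreal (2 * L * prob D)"
    using \<open>0 \<le> L\<close> by (simp add: emeasure_eq_measure ennreal_mult mult.commute)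
  finally have le: "emeasure (lborel \<Otimes>\<^sub>M M) F \<le> ennreal (2 * L * prob D)" .
  define g where "g x = emeasure lborel ((\<lambda>t. (t, x)) -` F)" for x
  have g [measurable]: "g \<in> borel_measurable M"
    unfolding g_def using F by (rule measurable_emeasure_Pair2)
  have int_g: "(\<integral>\<^sup>+x. g x \<partial>M) = emeasure (lborel \<Otimes>\<^sub>M M) F"
    unfolding g_def using F by (rule emeasure_pair_measure_alt2[symmetric])
  define B where "B = {x \<in> space M. 1 \<le> ennreal (1 / \<theta>) * g x}"
  have Bsets: "B \<in> sets M" unfolding B_def by measurable
  have "emeasure M B \<le> ennreal (1 / \<theta>) * (\<integral>\<^sup>+x. g x * indicator (space M) x \<partial>M)"
    using nn_integral_Markov_inequality[of g "space M" M "ennreal (1 / \<theta>)"] g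
    unfolding B_def by simp
  also have "(\<integral>\<^sup>+x. g x * indicator (space M) x \<partial>M) = (\<integral>\<^sup>+x. g x \<partial>M)"
    by (intro nn_integral_cong) auto
  also have "ennreal (1 / \<theta>) * (\<integral>\<^sup>+x. g x \<partial>M) \<le> ennreal (1 / \<theta>) * ennreal (2 * L * prob D)"
    unfolding int_g using le by (intro mult_left_mono) auto
  also have "\<dots> = ennreal (2 * L * prob D / \<theta>)"
    using assms by (simp add: ennreal_mult'[symmetric])
  finally have Bp: "prob B \<le> 2 * L * prob D / \<theta>"
    using assms by (simp add: emeasure_eq_measure)
  show ?thesis
  proof (rule that[OF Bsets Bp])
    fix x assume x: "x \<in> space M - B"
    have "(\<lambda>t. (t, x)) -` F \<in> sets borel" using F x by (metis sets_Pair2 sets_lborel)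
    moreover have "g x < ennreal \<theta>"
    proof (rule ccontr)
      assume "\<not> ?thesis"
      then have "ennreal (1 / \<theta>) * ennreal \<theta> \<le> ennreal (1 / \<theta>) * g x"
        by (intro mult_left_mono) auto
      then show False using x assms by (auto simp: B_def ennreal_mult'[symmetric])
    qed
    moreover have "\<bar>s\<bar> \<le> L \<longrightarrow> T s x \<in> D \<longrightarrow> (s, x) \<in> F" for s
    proof -
      have "\<bar>s\<bar> \<le> L \<Longrightarrow> T s x \<in> D \<Longrightarrow> (s, x) \<in> E"
        using x by (auto simp: E_def space_pair_measure)
      then show ?thesis using E by (auto simp: F_def)
    qed
    ultimately show "\<exists>Z. Z \<in> sets borel \<and> emeasure lborel Z < ennreal \<theta> \<and>
       (\<forall>s. \<bar>s\<bar> \<le> L \<longrightarrow> T s x \<in> D \<longrightarrow> s \<in> Z)"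
      unfolding g_def by (intro exI[of _ "(\<lambda>t. (t, x)) -` F"]) auto
  qed
qed

end

locale mixing_measure_flow = measure_flow +
  assumes mixing: "mixing_flow M T"
begin

text \<open>
  Since \<open>A \<inter> T t ` B\<close> is the image of \<open>B \<inter> T (- t) ` A\<close> under \<open>T t\<close>, mixing for \<open>t \<rightarrow> \<infinity>\<close> is the same as mixing for
  \<open>t \<rightarrow> - \<infinity>\<close>. Later \<open>t\<close> is an offset of unknown sign, hence the two-sided limit.
\<close>

lemma mixing_corr:
  assumes [measurable]: "A \<in> sets M" "B \<in> sets M"
  shows "((\<lambda>t. prob (moves A t B)) \<longlongrightarrow> prob A * prob B) at_infinity"
proof -
  have 1: "((\<lambda>t. prob (moves C (- t) C')) \<longlongrightarrow> prob C * prob C') at_top"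
    if C [measurable]: "C \<in> sets M" "C' \<in> sets M" for C C'
  proof -
    have "C \<inter> T t ` C' = moves C (- t) C'" for t
      using sets.sets_into_space[OF C(1)] by (auto simp: image_T C)
    moreover have "((\<lambda>t. prob (C \<inter> T t ` C')) \<longlongrightarrow> prob C * prob C') at_top"
      using mixing C unfolding mixing_flow_def by blast
    ultimately show ?thesis by (simp only:)
  qed
  have 2: "prob (moves B (- t) A) = prob (moves A t B)" for t
  proof -
    have "moves A t B = pre t (moves B (- t) A)"
      by auto
    also have "prob \<dots> = prob (moves B (- t) A)"
      by (rule prob_vimage_T) measurable
    finally show ?thesis by simp
  qed
  have "((\<lambda>t. prob (moves A t B)) \<longlongrightarrow> prob A * prob B) at_top"
    using 1[of B A] by (simp add: 2 mult.commute)
  moreover have "((\<lambda>t. prob (moves A t B)) \<longlongrightarrow> prob A * prob B) at_bot"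
    using 1[of A B] by (simp add: filterlim_at_bot_mirror)
  ultimately show ?thesis
    unfolding at_infinity_eq_at_top_bot by (intro filterlim_sup)
qed

end

section \<open>Towers as height functions\<close>

lemma lebesgue_set_borel_modulo_null:
  assumes "S \<in> sets lebesgue"
  obtains S' N where "S' \<in> sets borel" "S' \<subseteq> S" "N \<in> null_sets lborel" "S - S' \<subseteq> N"
proof -
  from assms obtain S' N0 N where "S = S' \<union> N0" "N0 \<subseteq> N" "N \<in> null_sets lborel" "S' \<in> sets lborel"
    by (rule sets_completionE)
  then show ?thesis by (intro that[of S' N]) auto
qed

context measure_flow
begin

text \<open>
  A tower of height \<open>H\<close>, reduced to the height of its points: \<open>p\<close> takes values in \<open>{0..<H}\<close> exactly on the
  tower, is distributed uniformly there, and increases at unit speed along orbits. In these terms the unions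
  of floors are the sets \<open>floors p S\<close> with \<open>S \<subseteq> {0..<H}\<close>.
\<close>

definition height_fun :: "real \<Rightarrow> ('a \<Rightarrow> real) \<Rightarrow> bool" where
  "height_fun H p \<longleftrightarrow> 0 < H \<and> p \<in> borel_measurable M \<and>
     (\<forall>S\<in>sets borel. S \<subseteq> {0..<H} \<longrightarrow>
        prob (floors p S) = prob (floors p {0..<H}) / H * measure lborel S) \<and>
     (\<forall>x\<in>space M. \<forall>t. p x \<in> {0..<H} \<longrightarrow> p x + t \<in> {0..<H} \<longrightarrow> p (T t x) = p x + t)"

text \<open>
  The height is the second coordinate under the identification of the tower with a rectangle, and
  \<open>- 1\<close> off the tower. A measurable union of floors corresponds to a set \<open>S\<close> of heights whose
  product with the base is measurable only in the completion; almost every section shows that \<open>S\<close> is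
  Lebesgue measurable, and a Borel set differs from it by a null set.
\<close>

lemma rectangular_tower_height_fun:
  fixes \<beta> :: "'b measure"
  assumes "rectangular_tower M T \<beta> H \<phi>"
  obtains p where "height_fun H p"
    "\<And>A. A \<in> tower_sets M \<beta> H \<phi> \<Longrightarrow> \<exists>S. S \<in> sets borel \<and> S \<subseteq> {0..<H} \<and>
       prob (sym_diff A (floors p S)) = 0"
proof -
  define L where "L = lebesgue_on {0..<H}"
  define N where "N = completion (\<beta> \<Otimes>\<^sub>M L)"
  from assms obtain Y c where fin: "finite_measure \<beta>" and H: "0 < H" and Y [measurable]: "Y \<in> sets M"
    and c: "0 < c" and iso: "measure_iso (scale_measure (ennreal c) N) (restrict_space M Y) \<phi>"
    and move: "\<And>b s t. b \<in> space \<beta> \<Longrightarrow> s \<in> {0..<H} \<Longrightarrow> s + t \<in> {0..<H} \<Longrightarrow> T t (\<phi> (b, s)) = \<phi> (b, s + t)"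
    unfolding rectangular_tower_def N_def L_def by auto
  interpret \<beta>: finite_measure \<beta> by fact
  interpret L: finite_measure L unfolding L_def by (intro finite_measure_lebesgue_on bounded_set_imp_lmeasurable) auto
  have spL [simp]: "space L = {0..<H}" by (simp add: L_def)
  have spN: "space N = space \<beta> \<times> {0..<H}" by (simp add: N_def space_pair_measure)
  have Ysub: "Y \<subseteq> space M" using Y by (rule sets.sets_into_space)
  have spY: "space (restrict_space M Y) = Y" using Ysub by (auto simp: space_restrict_space)
  have bij: "bij_betw \<phi> (space N) Y"
    and \<phi> : "\<phi> \<in> N \<rightarrow>\<^sub>M restrict_space M Y"
    and g: "the_inv_into (space N) \<phi> \<in> restrict_space M Y \<rightarrow>\<^sub>M N"
    and dist: "distr (scale_measure (ennreal c) N) (restrict_space M Y) \<phi> = restrict_space M Y"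
    using iso unfolding measure_iso_def
    by (auto simp: spY space_scale_measure measurable_def)
  define p where "p x = (if x \<in> Y then snd (the_inv_into (space N) \<phi> x) else - 1)" for x
  have p_\<phi>: "p (\<phi> (b, s)) = s" "\<phi> (b, s) \<in> Y" if "b \<in> space \<beta>" "s \<in> {0..<H}" for b s
  proof -
    have bs: "(b, s) \<in> space N" using that by (auto simp: spN)
    then show "\<phi> (b, s) \<in> Y" using bij by (auto simp: bij_betw_def)
    have "the_inv_into (space N) \<phi> (\<phi> (b, s)) = (b, s)"
      using bij bs by (intro the_inv_into_f_f) (auto simp: bij_betw_def)
    with \<open>\<phi> (b, s) \<in> Y\<close> show "p (\<phi> (b, s)) = s" by (simp add: p_def)
  qed
  have Y_\<phi>: "\<exists>b\<in>space \<beta>. \<exists>s\<in>{0..<H}. x = \<phi> (b, s) \<and> p x = s" if "x \<in> Y" for x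
  proof -
    have "x \<in> \<phi> ` (space \<beta> \<times> {0..<H})" using bij that by (auto simp: bij_betw_def spN)
    then obtain b s where "b \<in> space \<beta>" "s \<in> {0..<H}" "x = \<phi> (b, s)" by auto
    then show ?thesis using p_\<phi>(1) by blast
  qed
  have p_Y: "p x \<in> {0..<H} \<longleftrightarrow> x \<in> Y" for x
    using Y_\<phi>[of x] by (auto simp: p_def)
  have "(\<lambda>x. x) \<in> L \<rightarrow>\<^sub>M borel"
    unfolding L_def by (intro measurable_restrict_space1 measurable_completion) auto
  then have "snd \<in> N \<rightarrow>\<^sub>M borel"
    unfolding N_def by (intro measurable_completion) (use measurable_compose[OF measurable_snd] in auto)
  from measurable_compose[OF g this]
  have "p \<in> borel_measurable M"
    unfolding p_def by (subst measurable_If_restrict_space_iff) auto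
  note [measurable] = this
  define K where "K = c * measure \<beta> (space \<beta>)"
  have meas: "prob (floors p S) = K * measure lborel S"
    if S: "S \<in> sets borel" "S \<subseteq> {0..<H}" for S
  proof -
    let ?A = "floors p S"
    have AY: "?A \<subseteq> Y" using S p_Y by auto
    have SL: "S \<in> sets L" using S by (auto simp: L_def sets_restrict_space_iff)
    have "emeasure M ?A = emeasure (restrict_space M Y) ?A"
      using AY Ysub by (subst emeasure_restrict_space) (auto simp: Int_absorb2 Int_absorb1)
    also have "\<dots> = emeasure (distr (scale_measure (ennreal c) N) (restrict_space M Y) \<phi>) ?A"
      by (simp add: dist)
    also have "\<dots> = emeasure (scale_measure (ennreal c) N) (\<phi> -` ?A \<inter> space N)"
    proof (subst emeasure_distr)
      show "\<phi> \<in> scale_measure (ennreal c) N \<rightarrow>\<^sub>M restrict_space M Y" using \<phi> by simp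
      show "?A \<in> sets (restrict_space M Y)"
        using AY S(1) by (subst sets_restrict_space_iff) (auto simp: Ysub Int_absorb2)
    qed (simp add: space_scale_measure)
    also have "\<phi> -` ?A \<inter> space N = space \<beta> \<times> S"
    proof (rule set_eqI)
      fix z :: "'b \<times> real"
      obtain b s where z: "z = (b, s)" by (cases z)
      show "z \<in> \<phi> -` ?A \<inter> space N \<longleftrightarrow> z \<in> space \<beta> \<times> S"
      proof (cases "b \<in> space \<beta> \<and> s \<in> {0..<H}")
        case True
        then show ?thesis using p_\<phi>[of b s] Ysub by (auto simp: z spN)
      next
        case False
        then show ?thesis using S(2) by (auto simp: z spN)
      qed
    qed
    also have "emeasure (scale_measure (ennreal c) N) (space \<beta> \<times> S) = ennreal c * emeasure (\<beta> \<Otimes>\<^sub>M L) (space \<beta> \<times> S)"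
      using SL by (simp add: N_def)
    also have "\<dots> = ennreal c * (emeasure \<beta> (space \<beta>) * emeasure L S)"
      using SL by (simp add: L.emeasure_pair_measure_Times)
    also have "emeasure L S = emeasure lborel S"
      using S by (simp add: L_def emeasure_restrict_space)
    also have "emeasure lborel S = ennreal (measure lborel S)"
    proof (intro emeasure_eq_ennreal_measure)
      have "emeasure lborel S \<le> emeasure lborel {0..<H}" using S by (intro emeasure_mono) auto
      also have "\<dots> < top" using H by simp
      finally show "emeasure lborel S \<noteq> top" by simp
    qed
    finally show ?thesis
      using c by (simp add: \<beta>.emeasure_eq_measure emeasure_eq_measure K_def ennreal_mult'[symmetric] mult.assoc)
  qed
  have K: "prob (floors p {0..<H}) / H = K"
    using meas[of "{0..<H}"] H by simp
  show ?thesis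
  proof
    show "height_fun H p"
      unfolding height_fun_def
    proof (intro conjI ballI impI allI)
      fix S assume "S \<in> sets borel" "S \<subseteq> {0..<H}"
      then show "prob (floors p S) = prob (floors p {0..<H}) / H * measure lborel S"
        unfolding K by (rule meas)
    next
      fix x t assume "x \<in> space M" and px: "p x \<in> {0..<H}" and t: "p x + t \<in> {0..<H}"
      from px have "x \<in> Y" by (simp only: p_Y)
      from Y_\<phi>[OF this] obtain b s where b: "b \<in> space \<beta>" "s \<in> {0..<H}" and x: "x = \<phi> (b, s)" "p x = s" by blast
      have t': "s + t \<in> {0..<H}" using t x(2) by simp
      have "T t x = \<phi> (b, s + t)" unfolding x(1) using b t' by (rule move)
      then show "p (T t x) = p x + t" using p_\<phi>(1)[OF b(1) t'] x(2) by simp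
    qed (use H in auto)
  next
    fix A assume "A \<in> tower_sets M \<beta> H \<phi>"
    then obtain S where A [measurable]: "A \<in> sets M" and S: "S \<subseteq> {0..<H}"
      and A_eq: "A = (\<Union>s\<in>S. \<phi> ` (space \<beta> \<times> {s}))" by (auto simp: tower_sets_def)
    have A_p: "x \<in> A \<longleftrightarrow> p x \<in> S" for x
    proof
      assume "x \<in> A"
      then obtain s b where sb: "s \<in> S" "b \<in> space \<beta>" "x = \<phi> (b, s)" unfolding A_eq by blast
      then have "p x = s" using p_\<phi>(1)[of b s] S by blast
      with sb show "p x \<in> S" by simp
    next
      assume "p x \<in> S"
      then have "x \<in> Y" using S p_Y by auto
      from Y_\<phi>[OF this] obtain b s where b: "b \<in> space \<beta>" and x: "x = \<phi> (b, s)" "p x = s" by blast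
      have "s \<in> S" using \<open>p x \<in> S\<close> x(2) by simp
      then show "x \<in> A"
        unfolding A_eq x(1) by (intro UN_I[of s] imageI) (use b in auto)
    qed
    show "\<exists>S. S \<in> sets borel \<and> S \<subseteq> {0..<H} \<and>
       prob (sym_diff A (floors p S)) = 0"
    proof (cases "emeasure \<beta> (space \<beta>) = 0")
      case True
      then have "K = 0" by (simp add: K_def measure_def)
      have "prob A \<le> prob (floors p {0..<H})"
        using S A_p sets.sets_into_space[OF A] by (intro finite_measure_mono) auto
      also have "\<dots> = 0" using meas[of "{0..<H}"] \<open>K = 0\<close> by simp
      finally have "prob A = 0" by (simp add: measure_le_0_iff)
      then show ?thesis by (intro exI[of _ "{}"]) simp
    next
      case False
      have A_sub: "A \<subseteq> space M" using sets.sets_into_space[OF A] .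
      have AY: "A \<subseteq> Y" using A_p p_Y S by auto
      have "A \<in> sets (restrict_space M Y)"
        using AY by (subst sets_restrict_space_iff) (auto simp: Ysub Int_absorb2)
      from measurable_sets[OF \<phi> this] have "\<phi> -` A \<inter> space N \<in> sets N" .
      also have "\<phi> -` A \<inter> space N = space \<beta> \<times> S"
      proof (rule set_eqI)
        fix z :: "'b \<times> real"
        obtain b s where z: "z = (b, s)" by (cases z)
        show "z \<in> \<phi> -` A \<inter> space N \<longleftrightarrow> z \<in> space \<beta> \<times> S"
          using p_\<phi>(1)[of b s] S by (auto simp: z spN A_p)
      qed
      finally have "space \<beta> \<times> S \<in> sets (completion (\<beta> \<Otimes>\<^sub>M L))" by (simp add: N_def)
      then obtain C N0 N' where CN: "space \<beta> \<times> S = C \<union> N0" "N0 \<subseteq> N'" and N': "N' \<in> null_sets (\<beta> \<Otimes>\<^sub>M L)"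
        and C: "C \<in> sets (\<beta> \<Otimes>\<^sub>M L)" by (rule sets_completionE)
      have "(\<integral>\<^sup>+b. emeasure L (Pair b -` N') \<partial>\<beta>) = 0"
        using N' by (simp add: L.emeasure_pair_measure_alt[symmetric] null_sets_def)
      then have "AE b in \<beta>. emeasure L (Pair b -` N') = 0"
        using N' by (subst (asm) nn_integral_0_iff_AE) (auto intro: L.measurable_emeasure_Pair)
      moreover have "\<not> (AE b in \<beta>. False)"
        using False by (subst AE_iff_measurable[OF sets.top]) auto
      ultimately obtain b where b: "b \<in> space \<beta>" "emeasure L (Pair b -` N') = 0"
        using AE_mp[of "\<lambda>b. emeasure L (Pair b -` N') = 0" \<beta> "\<lambda>_. False"] by (auto intro: AE_I2)
      have Cb: "Pair b -` C \<in> sets L" using C b by (auto intro: sets_Pair1)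
      have Nb: "Pair b -` N' \<in> null_sets L" using N' b by (auto intro!: null_setsI sets_Pair1)
      have "Pair b -` C \<in> sets lebesgue" "Pair b -` N' \<in> null_sets lebesgue"
        using Cb Nb by (auto simp: L_def sets_restrict_space_iff null_sets_restrict_space)
      moreover have sub: "Pair b -` C \<subseteq> S" "S - Pair b -` C \<subseteq> Pair b -` N'"
        using CN b by auto
      ultimately have "S - Pair b -` C \<in> null_sets lebesgue"
        using null_sets_completion_subset by blast
      then have "S - Pair b -` C \<in> sets lebesgue" by auto
      with \<open>Pair b -` C \<in> sets lebesgue\<close> have "Pair b -` C \<union> (S - Pair b -` C) \<in> sets lebesgue"
        by (rule sets.Un)
      also have "Pair b -` C \<union> (S - Pair b -` C) = S" using sub by auto
      finally obtain S' N1 where S': "S' \<in> sets borel" "S' \<subseteq> S" "N1 \<in> null_sets lborel" "S - S' \<subseteq> N1"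
        by (rule lebesgue_set_borel_modulo_null)
      let ?N = "N1 \<inter> {0..<H}"
      have N1: "N1 \<in> sets borel" using S'(3) by (auto simp: null_sets_def)
      have "?N \<in> null_sets lborel" using S'(3) by (intro null_set_Int2) auto
      then have N0: "prob (floors p (?N)) = 0"
        using meas[of ?N] N1 by (simp add: null_sets_def measure_def)
      have "prob (sym_diff A (floors p S')) \<le> prob (floors p (?N))"
        using S' N1 A_sub S by (intro finite_measure_mono) (auto simp: A_p)
      with N0 have "prob (sym_diff A (floors p S')) = 0"
        by (simp add: measure_le_0_iff)
      then show ?thesis using S' S by blast
    qed
  qed
qed

lemma rank_one_height_funs:
  assumes "rank_one_flow M T"
  obtains H p where "\<And>j::nat. height_fun (H j) (p j)"
    "\<And>A. A \<in> sets M \<Longrightarrow> \<exists>S. (\<forall>j. S j \<in> sets borel \<and> S j \<subseteq> {0..<H j}) \<and>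
       (\<lambda>j. prob (sym_diff A (floors (p j) (S j)))) \<longlonglongrightarrow> 0"
proof -
  from assms obtain \<beta> :: "nat \<Rightarrow> 'a measure" and H \<phi> where
    tower: "\<And>j. rectangular_tower M T (\<beta> j) (H j) (\<phi> j)" and
    approx: "\<And>A. A \<in> sets M \<Longrightarrow> \<exists>A'. (\<forall>j. A' j \<in> tower_sets M (\<beta> j) (H j) (\<phi> j)) \<and>
           (\<lambda>j. prob (sym_diff A (A' j))) \<longlonglongrightarrow> 0"
    unfolding rank_one_flow_def by blast
  have "\<forall>j. \<exists>p. height_fun (H j) p \<and> (\<forall>A. A \<in> tower_sets M (\<beta> j) (H j) (\<phi> j) \<longrightarrow>
      (\<exists>S. S \<in> sets borel \<and> S \<subseteq> {0..<H j} \<and>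
       prob (sym_diff A (floors p S)) = 0))"
  proof
    fix j
    show "\<exists>p. height_fun (H j) p \<and> (\<forall>A. A \<in> tower_sets M (\<beta> j) (H j) (\<phi> j) \<longrightarrow>
      (\<exists>S. S \<in> sets borel \<and> S \<subseteq> {0..<H j} \<and>
       prob (sym_diff A (floors p S)) = 0))"
    proof (rule rectangular_tower_height_fun[OF tower[of j]], rule exI, intro conjI allI impI)
    qed assumption+
  qed
  then obtain p where p_pS: "\<forall>j. height_fun (H j) (p j) \<and> (\<forall>A. A \<in> tower_sets M (\<beta> j) (H j) (\<phi> j) \<longrightarrow>
      (\<exists>S. S \<in> sets borel \<and> S \<subseteq> {0..<H j} \<and>
       prob (sym_diff A (floors (p j) S)) = 0))"
    unfolding choice_iff by (elim exE)
  note p = p_pS[rule_format, THEN conjunct1] and pS = p_pS[rule_format, THEN conjunct2, rule_format]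
  show ?thesis
  proof (rule that[OF p])
    fix A assume A [measurable]: "A \<in> sets M"
    from approx[OF A] obtain A' where A': "\<And>j. A' j \<in> tower_sets M (\<beta> j) (H j) (\<phi> j)"
      and lim: "(\<lambda>j. prob (sym_diff A (A' j))) \<longlonglongrightarrow> 0" by auto
    have A'm [measurable]: "A' j \<in> sets M" for j using A' by (auto simp: tower_sets_def)
    have [measurable]: "p j \<in> borel_measurable M" for j using p by (auto simp: height_fun_def)
    have "\<forall>j. \<exists>S. S \<in> sets borel \<and> S \<subseteq> {0..<H j} \<and>
       prob (sym_diff (A' j) (floors (p j) S)) = 0"
      using pS[OF A'] by blast
    then obtain S where S [measurable]: "\<And>j. S j \<in> sets borel" and Ssub: "\<And>j. S j \<subseteq> {0..<H j}"
      and S0: "\<And>j. prob (sym_diff (A' j) (floors (p j) (S j))) = 0"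
      unfolding choice_iff by blast
    have "prob (sym_diff A (floors (p j) (S j))) \<le> prob (sym_diff A (A' j))" for j
    proof -
      have "prob (sym_diff A (floors (p j) (S j))) \<le>
        prob ((sym_diff A (A' j)) \<union> (sym_diff (A' j) (floors (p j) (S j))))"
        by (intro finite_measure_mono) auto
      also have "\<dots> \<le> prob (sym_diff A (A' j)) + prob (sym_diff (A' j) (floors (p j) (S j)))"
        by (intro measure_Un_le) auto
      finally show ?thesis by (simp add: S0)
    qed
    then have "(\<lambda>j. prob (sym_diff A (floors (p j) (S j)))) \<longlonglongrightarrow> 0"
      by (intro tendsto_sandwich[OF _ _ tendsto_const lim]) auto
    then show "\<exists>S. (\<forall>j. S j \<in> sets borel \<and> S j \<subseteq> {0..<H j}) \<and>
       (\<lambda>j. prob (sym_diff A (floors (p j) (S j)))) \<longlonglongrightarrow> 0"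
      using S Ssub by blast
  qed
qed

end

section \<open>Points of equal height in a tower\<close>

context measure_flow
begin

lemma height_fun_pos: "height_fun H p \<Longrightarrow> 0 < H"
  and height_fun_measurable: "height_fun H p \<Longrightarrow> p \<in> borel_measurable M"
  and height_fun_shift: "height_fun H p \<Longrightarrow> x \<in> space M \<Longrightarrow> 0 \<le> p x \<Longrightarrow> p x < H \<Longrightarrow>
    0 \<le> p x + t \<Longrightarrow> p x + t < H \<Longrightarrow> p (T t x) = p x + t"
  and height_fun_prob: "height_fun H p \<Longrightarrow> S \<in> sets borel \<Longrightarrow> S \<subseteq> {0..<H} \<Longrightarrow>
    prob (floors p S) = prob (floors p {0..<H}) / H * measure lborel S"
  unfolding height_fun_def by auto

lemma height_fun_slab:
  assumes p: "height_fun H p" and "0 \<le> a" "a \<le> b" "b \<le> H"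
  shows "prob {x \<in> space M. a \<le> p x \<and> p x < b} = prob (floors p {0..<H}) * (b - a) / H"
  using height_fun_prob[OF p, of "{a..<b}"] assms(2-) by simp

lemma height_fun_slab_le:
  assumes p: "height_fun H p" and "0 \<le> a" "a \<le> b" "b \<le> H"
  shows "prob {x \<in> space M. a \<le> p x \<and> p x < b} \<le> (b - a) / H"
proof -
  have "prob (floors p {0..<H}) * (b - a) \<le> 1 * (b - a)"
    using assms by (intro mult_right_mono) auto
  then show ?thesis
    unfolding height_fun_slab[OF assms] using height_fun_pos[OF p] by (simp add: divide_right_mono)
qed

lemma height_fun_slab_le':
  assumes p: "height_fun H p" and "a \<le> b"
  shows "prob {x \<in> space M. p x \<in> {0..<H} \<and> a \<le> p x \<and> p x < b} \<le> (b - a) / H"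
proof -
  define a' b' where "a' = max 0 (min a H)" and "b' = max 0 (min b H)"
  have H: "0 < H" using p by (rule height_fun_pos)
  note [measurable] = height_fun_measurable[OF p]
  have "prob {x \<in> space M. p x \<in> {0..<H} \<and> a \<le> p x \<and> p x < b} \<le> prob {x \<in> space M. a' \<le> p x \<and> p x < b'}"
    by (intro finite_measure_mono) (auto simp: a'_def b'_def)
  also have "\<dots> \<le> (b' - a') / H" using assms H by (intro height_fun_slab_le) (auto simp: a'_def b'_def)
  also have "\<dots> \<le> (b - a) / H" using assms H by (intro divide_right_mono) (auto simp: a'_def b'_def)
  finally show ?thesis .
qed

text \<open>
  A passage through the tower takes time exactly \<open>H\<close>. If a point is in the tower at times \<open>0\<close> and \<open>H\<close>,
  then the time between the end of its first passage and the beginning of the passage at time \<open>H\<close> is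
  too short for another passage; it is spent outside the tower, and its length is the loss of height.
\<close>

lemma gap_before_return:
  assumes p: "height_fun H p" and y: "y \<in> space M"
    and q: "0 \<le> p y" "p y < H" and q': "0 \<le> p (T H y)" "p (T H y) < H"
  shows "p (T H y) \<le> p y"
    and "\<lbrakk>H - p y \<le> s; s < H - p (T H y)\<rbrakk> \<Longrightarrow> p (T s y) \<notin> {0..<H}"
proof -
  have H: "0 < H" using p by (rule height_fun_pos)
  note shift = height_fun_shift[OF p]
  have T_T: "T t (T s y) = T (t + s) y" for t s using T_add[OF y, of t s] by simp
  show "p (T H y) \<le> p y"
  proof (rule ccontr)
    assume "\<not> ?thesis"
    then have "p (T (H - p (T H y)) y) = p y + (H - p (T H y))"
      using y q q' H by (intro shift) auto
    moreover have "p (T (- p (T H y)) (T H y)) = 0"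
      using shift[of "T H y" "- p (T H y)"] y q' H by simp
    ultimately show False using q q' by (simp add: T_T)
  qed
  assume s: "H - p y \<le> s" "s < H - p (T H y)"
  show "p (T s y) \<notin> {0..<H}"
  proof
    assume v: "p (T s y) \<in> {0..<H}"
    show False
    proof (cases "s \<le> p (T s y)")
      case True
      then have "p (T (- s) (T s y)) = p (T s y) - s"
        using shift[of "T s y" "- s"] y v s q by simp
      then show False using y s v by simp
    next
      case False
      then have "p (T (H - s) (T s y)) = p (T s y) + (H - s)"
        using shift[of "T s y" "H - s"] y v s q' by simp
      then show False using s v by (simp add: T_T)
    qed
  qed
qed

end

lemma measure_vimage_translate:
  fixes r :: real
  assumes "Z \<in> sets borel"
  shows "emeasure lborel ((\<lambda>s. s + r) -` Z) = emeasure lborel Z"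
proof -
  have "emeasure lborel Z = emeasure (distr lborel borel ((+) r)) Z" by (simp add: lborel_distr_plus)
  also have "\<dots> = emeasure lborel ((+) r -` Z)"
    using assms by (subst emeasure_distr) auto
  also have "(+) r -` Z = (\<lambda>s. s + r) -` Z" by (auto simp: add.commute)
  finally show ?thesis by simp
qed

text \<open>
  The towers are indexed by \<open>j\<close>; the second assumption is the rank-one property.
\<close>

locale rank_one_mixing_flow = mixing_measure_flow +
  fixes H :: "nat \<Rightarrow> real" and p :: "nat \<Rightarrow> 'a \<Rightarrow> real"
  assumes height: "height_fun (H j) (p j)"
    and approx: "A \<in> sets M \<Longrightarrow> \<exists>S. (\<forall>j. S j \<in> sets borel \<and> S j \<subseteq> {0..<H j}) \<and>
       (\<lambda>j. prob (sym_diff A (floors (p j) (S j)))) \<longlonglongrightarrow> 0"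
begin

lemma H_pos [simp]: "0 < H j" using height_fun_pos[OF height] .
lemma p_measurable [measurable]: "p j \<in> borel_measurable M" using height_fun_measurable[OF height] .
lemmas p_shift = height_fun_shift[OF height]
lemmas p_slab_le = height_fun_slab_le'[OF height]

abbreviation band :: "nat \<Rightarrow> real \<Rightarrow> real \<Rightarrow> 'a set" where
  "band j a b \<equiv> {x \<in> space M. p j x \<in> {0..<H j} \<and> a \<le> p j x \<and> p j x < b}"

abbreviation box :: "nat \<Rightarrow> real \<Rightarrow> real" where
  "box j \<equiv> indicator {0..<H j}"

definition tower :: "nat \<Rightarrow> 'a set" where
  "tower j = {x \<in> space M. 0 \<le> p j x \<and> p j x < H j}"

lemma tower_measurable [measurable]: "tower j \<in> sets M" unfolding tower_def by measurable

lemma p_slab: "\<lbrakk>0 \<le> a; a \<le> b; b \<le> H j\<rbrakk> \<Longrightarrow>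
    prob {x \<in> space M. a \<le> p j x \<and> p j x < b} = prob (tower j) * (b - a) / H j"
  using height_fun_slab[OF height, of a b j] by (simp add: tower_def)

lemma prob_tower: "(\<lambda>j. prob (tower j)) \<longlonglongrightarrow> 1"
proof -
  from approx[OF sets.top] obtain S where S: "\<And>j. S j \<in> sets borel" "\<And>j. S j \<subseteq> {0..<H j}"
    and lim: "(\<lambda>j. prob (sym_diff (space M) (floors (p j) (S j)))) \<longlonglongrightarrow> 0"
    by blast
  note [measurable] = S(1)
  have "1 - prob (sym_diff (space M) (floors (p j) (S j))) \<le> prob (tower j)" for j
  proof -
    have "sym_diff (space M) (floors (p j) (S j))
      = space M - floors (p j) (S j)" by auto
    then have "1 - prob (sym_diff (space M) (floors (p j) (S j)))
      = prob (floors (p j) (S j))" by (simp add: prob_compl)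
    also have "\<dots> \<le> prob (tower j)" using S(2)[of j] by (intro finite_measure_mono) (auto simp: tower_def)
    finally show ?thesis .
  qed
  then show ?thesis
    by (intro tendsto_sandwich[OF _ _ tendsto_diff[OF tendsto_const lim, of 1, simplified] tendsto_const]) auto
qed

lemma prob_not_tower: "(\<lambda>j. prob (space M - tower j)) \<longlonglongrightarrow> 0"
  using tendsto_diff[OF tendsto_const prob_tower, of 1] by (simp add: prob_compl)

definition slab :: "nat \<Rightarrow> real \<Rightarrow> nat \<Rightarrow> 'a set" where
  "slab i R k = {x \<in> tower i. real k * R \<le> p i x \<and> p i x < (real k + 1) * R}"

lemma slab_measurable [measurable]: "slab i R k \<in> sets M" unfolding slab_def by measurable

lemma tower_slab:
  assumes "x \<in> tower i" "0 < R"
  shows "\<exists>k<nat \<lceil>H i / R\<rceil>. x \<in> slab i R k"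
proof -
  define k where "k = nat \<lfloor>p i x / R\<rfloor>"
  have px: "0 \<le> p i x" "p i x < H i" "0 \<le> p i x / R" using assms by (auto simp: tower_def)
  have rk: "real k = of_int \<lfloor>p i x / R\<rfloor>" using px by (simp add: k_def)
  have "real k \<le> p i x / R" "p i x / R < real k + 1" unfolding rk by linarith+
  then have k: "real k * R \<le> p i x" "p i x < (real k + 1) * R" using assms by (simp_all add: field_simps)
  have "k * R < H i" using k(1) px(2) by linarith
  then have "real k < H i / R" using assms by (simp add: field_simps)
  then have "k < nat \<lceil>H i / R\<rceil>" by linarith
  moreover have "x \<in> slab i R k" using k assms(1) by (simp add: slab_def)
  ultimately show ?thesis by blast
qed

abbreviation coherent :: "nat \<Rightarrow> nat \<Rightarrow> real \<Rightarrow> real \<Rightarrow> 'a set \<Rightarrow> bool" where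
  "coherent i j R e B \<equiv> (\<forall>y\<in>space M - B. \<forall>r. \<bar>r\<bar> \<le> R \<longrightarrow> y \<in> tower j \<longrightarrow> p j (T (e + r) y) = p j y \<longrightarrow>
     2 * R \<le> p i y \<longrightarrow> p i y < H i - 4 * R \<longrightarrow>
     T e y \<in> tower i \<and> \<bar>p i (T e y) - p i y\<bar> \<le> 2 * R)"

text \<open>
  Let \<open>y\<close> and \<open>y' = T (e + r) y\<close> have the same height in tower \<open>j\<close>. The slabs of thickness \<open>R\<close> of tower
  \<open>i\<close> are almost unions of floors of tower \<open>j\<close>, so as both points move up through tower \<open>j\<close> together, at
  most times they lie in the same slab of tower \<open>i\<close>. The number \<open>r\<close> depends on \<open>y\<close> in an uncontrolled
  way, so \<open>y'\<close> may well be in the exceptional set \<open>D j\<close>. But \<open>T e y\<close> does not depend on \<open>r\<close> and, for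
  most \<open>y\<close>, spends little time in \<open>D j\<close>; then the orbits of \<open>y\<close> and \<open>y'\<close> avoid \<open>D j\<close> at a common time \<open>s \<le> R\<close>.

  The measure of the exceptional set is bounded uniformly in \<open>e\<close>; the summand \<open>R / H j\<close> stands for the
  points that leave tower \<open>j\<close> too early.
\<close>

lemma equal_heights_coherent:
  assumes R: "0 < R"
  obtains a where "a \<longlonglongrightarrow> 0"
    "\<And>j e. \<exists>B. B \<in> sets M \<and> prob B \<le> a j + R / H j \<and>
      coherent i j R e B"
proof -
  define n where "n = nat \<lceil>H i / R\<rceil>"
  define A where "A = slab i R"
  have A [measurable]: "A k \<in> sets M" for k unfolding A_def by measurable
  have "\<forall>k. \<exists>S. (\<forall>j. S j \<in> sets borel \<and> S j \<subseteq> {0..<H j}) \<and>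
       (\<lambda>j. prob (sym_diff (A k) (floors (p j) (S j)))) \<longlonglongrightarrow> 0"
    using approx A by blast
  then obtain S where S: "\<forall>k. (\<forall>j. S k j \<in> sets borel \<and> S k j \<subseteq> {0..<H j}) \<and>
       (\<lambda>j. prob (sym_diff (A k) (floors (p j) (S k j)))) \<longlonglongrightarrow> 0"
    unfolding choice_iff by (elim exE)
  then have [measurable]: "S k j \<in> sets borel" for k j by blast
  define D' where "D' k j = sym_diff (A k) (floors (p j) (S k j))" for k j
  have D' [measurable]: "D' k j \<in> sets M" for k j unfolding D'_def by measurable
  define D where "D j = (\<Union>k<n. D' k j)" for j
  have D [measurable]: "D j \<in> sets M" for j unfolding D_def by measurable
  define a where "a j = 24 * (\<Sum>k<n. prob (D' k j))" for j
  have "a \<longlonglongrightarrow> 24 * (\<Sum>k<n. 0)"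
    unfolding a_def D'_def using S by (intro tendsto_intros) auto
  then have a0: "a \<longlonglongrightarrow> 0" by simp
  have slab: "\<exists>k<n. x \<in> A k" if "x \<in> tower i" for x
    unfolding A_def n_def using that R by (rule tower_slab)
  have main: "\<exists>B. B \<in> sets M \<and> prob B \<le> a j + R / H j \<and>
      coherent i j R e B" for j e
  proof -
    obtain B1 where B1 [measurable]: "B1 \<in> sets M" and pB1: "prob B1 \<le> 2 * (2 * R) * prob (D j) / (R / 3)"
      and Z: "\<And>x. x \<in> space M - B1 \<Longrightarrow> \<exists>Z. Z \<in> sets borel \<and> emeasure lborel Z < ennreal (R / 3) \<and>
       (\<forall>s. \<bar>s\<bar> \<le> 2 * R \<longrightarrow> T s x \<in> D j \<longrightarrow> s \<in> Z)"
      using few_points_sojourn_long[OF D, of "2 * R" "R / 3" j] R by (metis mult_pos_pos zero_less_numeral less_imp_le divide_pos_pos)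
    define B where "B = B1 \<union> pre e B1 \<union> band j (H j - R) (H j)"
    have B [measurable]: "B \<in> sets M" unfolding B_def by measurable
    have "prob (D j) \<le> (\<Sum>k<n. prob (D' k j))"
      unfolding D_def by (intro finite_measure_subadditive_finite) auto
    moreover have "prob B1 \<le> 12 * prob (D j)" using pB1 R by simp
    ultimately have pB1': "prob B1 \<le> 12 * (\<Sum>k<n. prob (D' k j))" by linarith
    have "prob B \<le> prob (B1 \<union> pre e B1) + prob (band j (H j - R) (H j))"
      unfolding B_def by (intro measure_Un_le) auto
    also have "\<dots> \<le> (prob B1 + prob (pre e B1)) + (H j - (H j - R)) / H j"
      using R by (intro add_mono measure_Un_le p_slab_le) auto
    also have "\<dots> \<le> a j + R / H j" using pB1' prob_vimage_T[OF B1, of e] by (simp add: a_def)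
    finally have pB: "prob B \<le> a j + R / H j" .
    show ?thesis
    proof (intro exI[of _ B] conjI B pB ballI allI impI)
      fix y r assume y: "y \<in> space M - B" and r: "\<bar>r\<bar> \<le> R" and yj: "y \<in> tower j"
        and eq: "p j (T (e + r) y) = p j y" and piy: "2 * R \<le> p i y" "p i y < H i - 4 * R"
      have ysp: "y \<in> space M" using y by simp
      define z where "z = T e y"
      have zsp: "z \<in> space M" using ysp by (simp add: z_def)
      have yB: "y \<in> space M - B1" and zB: "z \<in> space M - B1" using y by (auto simp: B_def z_def)
      from Z[OF yB] obtain Z1 where Z1: "Z1 \<in> sets borel" "emeasure lborel Z1 < ennreal (R / 3)"
        "\<And>s. \<bar>s\<bar> \<le> 2 * R \<Longrightarrow> T s y \<in> D j \<Longrightarrow> s \<in> Z1" by blast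
      from Z[OF zB] obtain Z2 where Z2: "Z2 \<in> sets borel" "emeasure lborel Z2 < ennreal (R / 3)"
        "\<And>s. \<bar>s\<bar> \<le> 2 * R \<Longrightarrow> T s z \<in> D j \<Longrightarrow> s \<in> Z2" by blast
      \<comment> \<open>the two sets of bad times have total measure below \<open>2 * R / 3\<close>\<close>
      have "\<exists>s. 0 \<le> s \<and> s \<le> R \<and> s \<notin> Z1 \<and> s + r \<notin> Z2"
      proof (rule ccontr)
        assume "\<not> ?thesis"
        then have sub: "{0..R} \<subseteq> Z1 \<union> (\<lambda>s. s + r) -` Z2" by auto
        have m: "(\<lambda>s. s + r) -` Z2 \<in> sets borel"
          using measurable_sets[of "\<lambda>s. s + r" borel borel Z2] Z2(1) by auto
        have "ennreal R = emeasure lborel {0..R}" using R by simp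
        also have "\<dots> \<le> emeasure lborel (Z1 \<union> (\<lambda>s. s + r) -` Z2)" using sub Z1 m by (intro emeasure_mono) auto
        also have "\<dots> \<le> emeasure lborel Z1 + emeasure lborel ((\<lambda>s. s + r) -` Z2)"
          using Z1 m by (intro emeasure_subadditive) auto
        also have "\<dots> \<le> ennreal (R / 3) + ennreal (R / 3)"
          unfolding measure_vimage_translate[OF Z2(1)] using Z1(2) Z2(2) by (intro add_mono) auto
        also have "\<dots> = ennreal (2 * R / 3)" using R by (simp add: ennreal_plus[symmetric] del: ennreal_plus)
        finally show False using R by (simp add: ennreal_le_iff2)
      qed
      then obtain s where s: "0 \<le> s" "s \<le> R" "s \<notin> Z1" "s + r \<notin> Z2" by blast
      have nD: "T s y \<notin> D j" "T (s + r) z \<notin> D j"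
        using Z1(3)[of s] Z2(3)[of "s + r"] s r by fastforce+
      have pj: "0 \<le> p j y" "p j y < H j - R" using yj y by (auto simp: tower_def B_def)
      have 1: "p j (T s y) = p j y + s" using s pj ysp by (intro p_shift) auto
      have Tw: "T (s + r) z = T s (T (e + r) y)"
        unfolding z_def using T_add[OF ysp, of "s + r" e] T_add[OF ysp, of s "e + r"] by (simp add: algebra_simps)
      have 2: "p j (T (s + r) z) = p j y + s"
        unfolding Tw using p_shift[of "T (e + r) y" j s] s pj ysp eq by simp
      have 3: "p i (T s y) = p i y + s" using s piy ysp R by (intro p_shift) auto
      then have "T s y \<in> tower i" using piy s R ysp by (auto simp: tower_def)
      from slab[OF this] obtain k where k: "k < n" "T s y \<in> A k" by blast
      have "p j (T s y) \<in> S k j" using nD(1) k by (auto simp: D_def D'_def)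
      then have "T (s + r) z \<in> A k" using nD(2) k(1) zsp 1 2 by (auto simp: D_def D'_def)
      then have 4: "k * R \<le> p i (T (s + r) z)" "p i (T (s + r) z) < k * R + R" "T (s + r) z \<in> tower i"
        by (auto simp: A_def slab_def algebra_simps)
      have 5: "k * R \<le> p i (T s y)" "p i (T s y) < k * R + R"
        using k(2) by (auto simp: A_def slab_def algebra_simps)
      have b: "0 \<le> p i (T (s + r) z) - (s + r)" "p i (T (s + r) z) - (s + r) < H i"
        using 3 4 5 piy r s by auto
      have "p i (T (- (s + r)) (T (s + r) z)) = p i (T (s + r) z) + - (s + r)"
        using 4(3) b zsp by (intro p_shift) (auto simp: tower_def)
      then have "p i z = p i (T (s + r) z) - (s + r)" using T_minus[OF zsp, of "s + r"] by simp
      then show "T e y \<in> tower i" "\<bar>p i (T e y) - p i y\<bar> \<le> 2 * R"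
        using b 3 4 5 r zsp by (auto simp: tower_def z_def)
    qed
  qed
  from a0 main show ?thesis by (rule that)
qed

end

section \<open>Tower heights tend to infinity\<close>

text \<open>
  By Fubini, the product of the two measures is the integral over \<open>r\<close> of the measure of the points of \<open>S\<close>
  that are translated into \<open>S'\<close> by \<open>r\<close>.
\<close>

lemma measure_translates_disagree:
  fixes S S' :: "real set"
  assumes [measurable]: "S \<in> sets borel" "S' \<in> sets borel" and "S \<subseteq> {0..<H}" "S' \<subseteq> {0..<H}" and "0 < H"
    and le: "\<And>r. \<bar>r\<bar> < H \<Longrightarrow> measure lborel {s \<in> S. s + r \<in> S'} \<le> c"
  shows "measure lborel S * measure lborel S' \<le> 2 * H * c"
proof -
  have fin: "emeasure lborel X = ennreal (measure lborel X)" if "X \<in> sets borel" "X \<subseteq> {0..<H}" for X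
  proof (intro emeasure_eq_ennreal_measure)
    have "emeasure lborel X \<le> emeasure lborel {0..<H}" using that by (intro emeasure_mono) auto
    also have "\<dots> < top" using \<open>0 < H\<close> by simp
    finally show "emeasure lborel X \<noteq> top" by simp
  qed
  have c: "0 \<le> c" by (rule order_trans[OF measure_nonneg le[of 0]]) (use \<open>0 < H\<close> in simp)
  have "ennreal (measure lborel S * measure lborel S') = emeasure lborel S * emeasure lborel S'"
    using assms by (simp add: fin ennreal_mult)
  also have "\<dots> = (\<integral>\<^sup>+s. indicator S s * emeasure lborel S' \<partial>lborel)"
    by (simp add: nn_integral_multc)
  also have "\<dots> = (\<integral>\<^sup>+s. (\<integral>\<^sup>+r. indicator S s * indicator S' (s + r) \<partial>lborel) \<partial>lborel)"
  proof (rule nn_integral_cong)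
    fix s :: real
    have "emeasure lborel S' = (\<integral>\<^sup>+r. indicator S' r \<partial>distr lborel borel ((+) s))"
      by (simp add: lborel_distr_plus)
    also have "\<dots> = (\<integral>\<^sup>+r. indicator S' (s + r) \<partial>lborel)" by (subst nn_integral_distr) auto
    finally show "indicator S s * emeasure lborel S' = (\<integral>\<^sup>+r. indicator S s * indicator S' (s + r) \<partial>lborel)"
      by (simp add: nn_integral_cmult)
  qed
  also have "\<dots> = (\<integral>\<^sup>+r. (\<integral>\<^sup>+s. indicator S s * indicator S' (s + r) \<partial>lborel) \<partial>lborel)"
    by (rule lborel_pair.Fubini') measurable
  also have "\<dots> \<le> (\<integral>\<^sup>+r. ennreal c * indicator {-H..H} r \<partial>lborel)"
  proof (rule nn_integral_mono)
    fix r :: real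
    have *: "(\<integral>\<^sup>+s. indicator S s * indicator S' (s + r) \<partial>lborel) = emeasure lborel {s \<in> S. s + r \<in> S'}"
    proof -
      have m: "{s \<in> S. s + r \<in> S'} \<in> sets lborel" by measurable
      have "(\<integral>\<^sup>+s. indicator S s * indicator S' (s + r) \<partial>lborel) = (\<integral>\<^sup>+s. indicator {s \<in> S. s + r \<in> S'} s \<partial>lborel)"
        by (intro nn_integral_cong) (auto simp: indicator_def)
      then show ?thesis using m by (simp only: nn_integral_indicator)
    qed
    show "(\<integral>\<^sup>+s. indicator S s * indicator S' (s + r) \<partial>lborel) \<le> ennreal c * indicator {-H..H} r"
    proof (cases "\<bar>r\<bar> < H")
      case True
      have "emeasure lborel {s \<in> S. s + r \<in> S'} = ennreal (measure lborel {s \<in> S. s + r \<in> S'})"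
        using assms by (intro fin) auto
      moreover have "indicator {-H..H} r = (1::ennreal)" using True by (auto simp: indicator_def)
      ultimately show ?thesis using le[OF True] by (simp add: * ennreal_leI)
    next
      case False
      then have "{s \<in> S. s + r \<in> S'} = {}" using assms(3,4) by fastforce
      then show ?thesis unfolding * by (simp only: emeasure_empty zero_le)
    qed
  qed
  also have "\<dots> = ennreal (2 * H * c)"
    using \<open>0 < H\<close> c by (simp add: nn_integral_cmult ennreal_mult[symmetric] mult.commute)
  finally show ?thesis using \<open>0 < H\<close> c by (simp add: ennreal_le_iff)
qed

context rank_one_mixing_flow
begin

lemma tower_half: obtains i where "1 / 2 < prob (tower i)"
  using order_tendstoD(1)[OF prob_tower, of "1 / 2"] by (auto simp: eventually_sequentially)

text \<open>
  The middle third of a tower serves as a set of measure away from \<open>0\<close> and \<open>1\<close> on which the flow acts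
  continuously, by an explicit estimate.
\<close>

definition mid :: "nat \<Rightarrow> 'a set" where
  "mid i = {x \<in> space M. H i / 3 \<le> p i x \<and> p i x < 2 * H i / 3}"

lemma mid_measurable [measurable]: "mid i \<in> sets M" unfolding mid_def by measurable

lemma prob_mid: "prob (mid i) = prob (tower i) / 3"
  using p_slab[of "H i / 3" "2 * H i / 3" i] H_pos[of i] by (simp add: mid_def less_imp_le field_simps)

text \<open>
  A point leaves the set by passing its upper end or the top of the tower, from a distance less than \<open>s\<close>.
\<close>

lemma interval_shift:
  assumes V: "V = {x \<in> tower j. u \<le> p j x \<and> p j x < v}"
    and s: "0 \<le> s"
  shows "prob (leaves V s) \<le> 2 * s / H j"
proof -
  have "prob (leaves V s) \<le> prob (band j (H j - s) (H j)
     \<union> band j (v - s) v)"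
  proof (intro finite_measure_mono subsetI)
    fix x assume x: "x \<in> leaves V s"
    then have 1: "x \<in> space M" "0 \<le> p j x" "p j x < H j" "u \<le> p j x" "p j x < v" by (auto simp: V tower_def)
    show "x \<in> band j (H j - s) (H j)
     \<union> band j (v - s) v"
    proof (rule ccontr)
      assume "\<not> ?thesis"
      then have 2: "p j x + s < H j" "p j x + s < v" using 1 by auto
      then have "p j (T s x) = p j x + s" using 1 s by (intro p_shift) auto
      then have "T s x \<in> V" using 1 2 s by (auto simp: V tower_def)
      then show False using x by simp
    qed
  qed measurable
  also have "\<dots> \<le> (H j - (H j - s)) / H j + (v - (v - s)) / H j"
    using s by (intro order_trans[OF measure_Un_le] add_mono p_slab_le) auto
  finally show ?thesis by simp
qed

lemma prob_leaves_minus: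
  assumes [measurable]: "V \<in> sets M"
  shows "prob (leaves V (- t)) = prob (leaves V t)"
proof -
  have split: "prob (leaves V s) = prob V - prob (moves V s V)" for s
  proof -
    have "leaves V s = V - moves V s V" using sets.sets_into_space[of V M] by auto
    then show ?thesis by (simp add: finite_measure_Diff subset_iff)
  qed
  have "moves V t V = pre t (moves V (- t) V)" by auto
  then have "prob (moves V t V) = prob (moves V (- t) V)" by (simp only: prob_vimage_T) (rule prob_vimage_T, measurable)
  then show ?thesis by (simp add: split)
qed

lemma mid_shift: "prob (leaves (mid i) r) \<le> 2 * \<bar>r\<bar> / H i"
proof -
  have mid: "mid i = {x \<in> tower i. H i / 3 \<le> p i x \<and> p i x < 2 * H i / 3}"
    using H_pos[of i] by (auto simp: mid_def tower_def)
  show ?thesis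
    using interval_shift[OF mid, of "\<bar>r\<bar>"] prob_leaves_minus[OF mid_measurable, of i r] by (cases "0 \<le> r") auto
qed

text \<open>
  A set that hardly changes during the time \<open>H j\<close> of a passage, such as \<open>mid i\<close> if \<open>H j\<close> is small, is not
  approximated by unions of floors of tower \<open>j\<close>: among heights, translates of \<open>S j\<close> by less than \<open>H j\<close> would rarely leave \<open>S j\<close>, hence \<open>S j\<close> or its
  complement would be small by \<open>measure_translates_disagree\<close>, whereas the measure of \<open>mid i\<close> is neither \<open>0\<close> nor \<open>1\<close>.
\<close>

lemma heights_bounded_below: "\<exists>c>0. eventually (\<lambda>j. c \<le> H j) sequentially"
proof -
  obtain i where i: "1 / 2 < prob (tower i)" by (rule tower_half)
  define m where "m = prob (mid i)"
  have m: "0 < m" "m < 1" using i le_less_trans[OF prob_le_1[of "tower i"], of 3] by (simp_all add: m_def prob_mid)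
  from approx[OF mid_measurable[of i]] obtain S where S [measurable]: "\<And>j. S j \<in> sets borel"
    and Ssub: "\<And>j. S j \<subseteq> {0..<H j}"
    and lim: "(\<lambda>j. prob (sym_diff (mid i) (floors (p j) (S j)))) \<longlonglongrightarrow> 0"
    by blast
  define D where "D j = sym_diff (mid i) (floors (p j) (S j))" for j
  have D [measurable]: "D j \<in> sets M" for j unfolding D_def by measurable
  define A where "A j = floors (p j) (S j)" for j
  have A [measurable]: "A j \<in> sets M" for j unfolding A_def by measurable
  have mid_sub: "mid i \<subseteq> space M" by (auto simp: mid_def)
  have Am: "\<bar>prob (A j) - m\<bar> \<le> prob (D j)" for j
  proof -
    have "prob (A j) \<le> prob (mid i \<union> D j)" by (intro finite_measure_mono) (auto simp: A_def D_def)
    also have "\<dots> \<le> m + prob (D j)" unfolding m_def by (intro measure_Un_le) auto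
    finally have 1: "prob (A j) \<le> m + prob (D j)" .
    have "m \<le> prob (A j \<union> D j)" unfolding m_def using mid_sub by (intro finite_measure_mono) (auto simp: A_def D_def)
    also have "\<dots> \<le> prob (A j) + prob (D j)" by (intro measure_Un_le) auto
    finally show ?thesis using 1 by linarith
  qed
  have D0: "(\<lambda>j. prob (D j)) \<longlonglongrightarrow> 0" unfolding D_def by (rule lim)
  have "(\<lambda>j. prob (A j) - m) \<longlonglongrightarrow> 0"
    by (rule Lim_null_comparison[OF _ D0]) (use Am in auto)
  then have A_lim: "(\<lambda>j. prob (A j)) \<longlonglongrightarrow> m" by (simp add: LIM_zero_iff)
  have key: "prob (A j) * (prob (tower j) - prob (A j)) \<le> 4 * prob (D j) + 4 * H j / H i" for j
  proof -
    have sS: "{s \<in> S j. s + r \<in> {0..<H j} - S j} \<subseteq> {0..<H j}" for r using Ssub by auto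
    have tw: "prob (floors (p j) {0..<H j}) = prob (tower j)" by (simp add: tower_def)
    have pS: "prob (A j) = prob (tower j) / H j * measure lborel (S j)"
      unfolding A_def tw[symmetric] using Ssub by (intro height_fun_prob[OF height]) auto
    have pSc: "prob (tower j) - prob (A j) = prob (tower j) / H j * measure lborel ({0..<H j} - S j)"
    proof -
      have "prob (tower j) - prob (A j) = prob (tower j - A j)"
        using Ssub[of j] by (intro finite_measure_Diff[symmetric]) (auto simp: tower_def A_def)
      also have "tower j - A j = floors (p j) ({0..<H j} - S j)" by (auto simp: tower_def A_def)
      also have "prob \<dots> = prob (tower j) / H j * measure lborel ({0..<H j} - S j)"
        unfolding tw[symmetric] by (intro height_fun_prob[OF height]) auto
      finally show ?thesis .
    qed
    define c where "c = 2 * prob (D j) + 2 * H j / H i"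
    have le: "prob (tower j) / H j * measure lborel {s \<in> S j. s + r \<in> {0..<H j} - S j} \<le> c" if r: "\<bar>r\<bar> < H j" for r
    proof -
      have "prob (tower j) / H j * measure lborel {s \<in> S j. s + r \<in> {0..<H j} - S j}
        = prob {x \<in> space M. p j x \<in> {s \<in> S j. s + r \<in> {0..<H j} - S j}}"
        unfolding tw[symmetric] using sS by (intro height_fun_prob[OF height, symmetric]) auto
      also have "\<dots> \<le> prob ((D j \<union> pre r (D j)) \<union> leaves (mid i) r)"
      proof (intro finite_measure_mono subsetI)
        fix x assume "x \<in> {x \<in> space M. p j x \<in> {s \<in> S j. s + r \<in> {0..<H j} - S j}}"
        then have x: "x \<in> space M" "p j x \<in> S j" "p j x + r \<in> {0..<H j}" "p j x + r \<notin> S j" by auto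
        then have "p j (T r x) = p j x + r" using Ssub[of j] by (intro p_shift) auto
        then have "T r x \<notin> A j" "x \<in> A j" using x by (auto simp: A_def)
        then show "x \<in> (D j \<union> pre r (D j)) \<union> leaves (mid i) r"
          using x(1) by (auto simp: A_def D_def)
      qed auto
      also have "\<dots> \<le> (prob (D j) + prob (pre r (D j))) + prob (leaves (mid i) r)"
        by (intro order_trans[OF measure_Un_le] add_right_mono measure_Un_le) auto
      also have "\<dots> \<le> (prob (D j) + prob (D j)) + 2 * H j / H i"
        using mid_shift[of i r] r H_pos[of i] prob_vimage_T[OF D, of r j]
        by (intro add_mono) (auto elim!: order_trans intro!: divide_right_mono simp: less_imp_le)
      finally show ?thesis by (simp add: c_def)
    qed
    show ?thesis
    proof (cases "prob (tower j) = 0")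
      case True
      then show ?thesis using pS H_pos[of j] H_pos[of i] by (simp add: less_imp_le)
    next
      case False
      then have tp: "0 < prob (tower j)" by (simp add: zero_less_measure_iff)
      have "measure lborel (S j) * measure lborel ({0..<H j} - S j) \<le> 2 * H j * (c * H j / prob (tower j))"
      proof (rule measure_translates_disagree)
        fix r assume "\<bar>r\<bar> < H j"
        from le[OF this] show "measure lborel {s \<in> S j. s + r \<in> {0..<H j} - S j} \<le> c * H j / prob (tower j)"
          using tp by (simp add: field_simps)
      qed (use Ssub in auto)
      then have "(prob (tower j) / H j)\<^sup>2 * (measure lborel (S j) * measure lborel ({0..<H j} - S j)) \<le>
         (prob (tower j) / H j)\<^sup>2 * (2 * H j * (c * H j / prob (tower j)))"
        by (intro mult_left_mono) auto
      also have "\<dots> = prob (tower j) * (2 * c)" using tp less_imp_neq[OF H_pos[of j]] by (simp add: power2_eq_square)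
      also have "\<dots> \<le> 1 * (2 * c)"
        using H_pos[of i] H_pos[of j] by (intro mult_right_mono) (auto simp: c_def less_imp_le)
      finally show ?thesis unfolding pS pSc[unfolded pS] by (simp add: power2_eq_square c_def algebra_simps)
    qed
  qed
  have "(\<lambda>j. prob (A j) * (prob (tower j) - prob (A j)) - 4 * prob (D j)) \<longlonglongrightarrow> m * (1 - m) - 4 * 0"
    by (intro tendsto_intros A_lim prob_tower D0)
  then have ev: "eventually (\<lambda>j. m * (1 - m) / 2 < prob (A j) * (prob (tower j) - prob (A j)) - 4 * prob (D j)) sequentially"
    using m by (intro order_tendstoD) auto
  define c where "c = m * (1 - m) / 8 * H i"
  have "0 < c" using m H_pos[of i] by (simp add: c_def)
  moreover have "eventually (\<lambda>j. c \<le> H j) sequentially"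
    using ev
  proof eventually_elim
    case (elim j)
    show ?case
    proof (rule ccontr)
      assume "\<not> c \<le> H j"
      then have "4 * H j < (m * (1 - m) / 2) * H i" by (simp add: c_def)
      then have "4 * H j / H i < m * (1 - m) / 2" using H_pos[of i] by (simp only: pos_divide_less_eq)
      with elim key[of j] show False by linarith
    qed
  qed
  ultimately show ?thesis by blast
qed

lemma prob_leave_iterate:
  assumes [measurable]: "A \<in> sets M"
  shows "prob (leaves A (real k * h)) \<le> k * prob (leaves A h)"
proof (induction k)
  case 0
  have "leaves A (real 0 * h) = {}" using T_zero by auto
  then show ?case by (simp only: measure_empty)
next
  case (Suc k)
  let ?D = "leaves A h"
  have add: "T (real (Suc k) * h) x = T h (T (real k * h) x)" if "x \<in> space M" for x
    using T_add[OF that, of h "real k * h"] by (simp add: algebra_simps)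
  have "prob {x \<in> space M. x \<in> A \<and> T (real (Suc k) * h) x \<notin> A} \<le>
    prob (leaves A (real k * h) \<union> pre (real k * h) (?D))"
    using add by (intro finite_measure_mono) auto
  also have "\<dots> \<le> prob (leaves A (real k * h)) + prob (pre (real k * h) (?D))"
    by (intro measure_Un_le) measurable
  also have "prob (pre (real k * h) (?D)) = prob ?D" by (rule prob_vimage_T) measurable
  finally show ?case using Suc.IH by (simp add: algebra_simps)
qed

text \<open>
  Suppose that \<open>c \<le> H j \<le> C\<close> for infinitely many \<open>j\<close>. Since little time is spent outside tower \<open>j\<close>, most points
  lose little height during the time \<open>H j\<close>, and by coherence \<open>T (H j)\<close> almost preserves \<open>mid i\<close>. The
  same holds for \<open>T (k * H j)\<close> with \<open>k\<close> up to a bound \<open>K\<close> that is fixed beforehand so that \<open>k * H j\<close> reaches times at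
  which \<open>mid i\<close> is nearly independent of itself.
\<close>

theorem heights_tend_to_infinity: "filterlim H at_top sequentially"
proof (rule ccontr)
  assume "\<not> ?thesis"
  then obtain C where C: "\<not> eventually (\<lambda>j. C \<le> H j) sequentially" by (auto simp: filterlim_at_top)
  obtain c where c: "0 < c" "eventually (\<lambda>j. c \<le> H j) sequentially" using heights_bounded_below by blast
  obtain i where i: "1 / 2 < prob (tower i)" by (rule tower_half)
  define m where "m = prob (mid i)"
  have m: "0 < m" "m < 1" using i le_less_trans[OF prob_le_1[of "tower i"], of 3] by (simp_all add: m_def prob_mid)
  define \<eta> where "\<eta> = m * (1 - m) / 2"
  have \<eta>: "0 < \<eta>" using m by (simp add: \<eta>_def)
  have "((\<lambda>t. prob (moves (mid i) t (space M - mid i))) \<longlongrightarrow> prob (mid i) * prob (space M - mid i)) at_infinity"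
    by (intro mixing_corr) auto
  then have "eventually (\<lambda>t. \<eta> < prob (moves (mid i) t (space M - mid i))) at_infinity"
    using m \<eta> by (intro order_tendstoD(1)) (auto simp: m_def[symmetric] prob_compl \<eta>_def)
  then obtain \<tau> where \<tau>: "\<And>t. \<tau> \<le> \<bar>t\<bar> \<Longrightarrow> \<eta> < prob (moves (mid i) t (space M - mid i))"
    by (auto simp: eventually_at_infinity)
  define K where "K = nat \<lceil>\<bar>\<tau>\<bar> / c\<rceil> + 1"
  have K: "0 < K" by (simp add: K_def)
  define b where "b j = prob (leaves (mid i) (H j))" for j
  have b_large: "\<eta> < K * b j" if "c \<le> H j" for j
  proof -
    define k where "k = nat \<lceil>\<bar>\<tau>\<bar> / H j\<rceil>"
    have "\<bar>\<tau>\<bar> / H j \<le> k" unfolding k_def by (rule real_nat_ceiling_ge)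
    then have k1: "\<bar>\<tau>\<bar> \<le> k * H j" by (simp add: field_simps)
    have "\<bar>\<tau>\<bar> / H j \<le> \<bar>\<tau>\<bar> / c" using that c(1) by (intro divide_left_mono) auto
    then have "k \<le> K" unfolding k_def K_def by (intro trans_le_add1 nat_mono ceiling_mono)
    have "0 \<le> real k * H j" by (simp add: less_imp_le)
    have "\<eta> < prob (moves (mid i) (k * H j) (space M - mid i))"
      using k1 \<open>0 \<le> real k * H j\<close> by (intro \<tau>) linarith
    also have "moves (mid i) (k * H j) (space M - mid i) = leaves (mid i) (k * H j)"
      by auto
    also have "prob \<dots> \<le> k * b j" unfolding b_def by (intro prob_leave_iterate) auto
    also have "\<dots> \<le> K * b j" using \<open>k \<le> K\<close> by (intro mult_right_mono) (auto simp: b_def)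
    finally show ?thesis .
  qed
  \<comment> \<open>small enough for the slabs of thickness \<open>R\<close> to cost at most half of \<open>\<eta> / K\<close>\<close>
  define R where "R = min (H i / 12) (\<eta> / (2 * K) / (1 / c + 4 / H i))"
  have "0 < 1 / c + 4 / H i" using c H_pos[of i] by (simp add: add_pos_pos)
  then have R: "0 < R" "R \<le> H i / 12" "R \<le> \<eta> / (2 * K) / (1 / c + 4 / H i)"
    using H_pos[of i] \<eta> K unfolding R_def by (simp, intro min.cobounded1, intro min.cobounded2)
  have R': "R / c + 4 * R / H i \<le> \<eta> / (2 * K)"
  proof -
    have "R / c + 4 * R / H i = R * (1 / c + 4 / H i)" by (simp add: algebra_simps)
    also have "\<dots> \<le> \<eta> / (2 * K)" using R(3) \<open>0 < 1 / c + 4 / H i\<close> by (simp only: pos_le_divide_eq)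
    finally show ?thesis .
  qed
  obtain a where a: "a \<longlonglongrightarrow> 0" and coh: "\<And>j e. \<exists>B. B \<in> sets M \<and> prob B \<le> a j + R / H j \<and>
      coherent i j R e B"
    using equal_heights_coherent[OF R(1), of i] by blast
  have b_small: "b j \<le> (a j + R / H j) + 2 * prob (space M - tower j) + 2 * H j * prob (space M - tower j) / R + 4 * R / H i" for j
  proof -
    obtain B where B [measurable]: "B \<in> sets M" and pB: "prob B \<le> a j + R / H j"
      and coh': "\<And>y r. \<lbrakk>y \<in> space M - B; \<bar>r\<bar> \<le> R; y \<in> tower j; p j (T (H j + r) y) = p j y;
         2 * R \<le> p i y; p i y < H i - 4 * R\<rbrakk> \<Longrightarrow> T (H j) y \<in> tower i \<and> \<bar>p i (T (H j) y) - p i y\<bar> \<le> 2 * R"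
      using coh[of j "H j"] by blast
    obtain G where G [measurable]: "G \<in> sets M" and pG: "prob G \<le> 2 * H j * prob (space M - tower j) / R"
      and Z: "\<And>x. x \<in> space M - G \<Longrightarrow> \<exists>Z. Z \<in> sets borel \<and> emeasure lborel Z < ennreal R \<and>
       (\<forall>s. \<bar>s\<bar> \<le> H j \<longrightarrow> T s x \<in> space M - tower j \<longrightarrow> s \<in> Z)"
      using few_points_sojourn_long[of "space M - tower j" "H j" R] R(1) by (auto simp: less_imp_le)
    define U1 where "U1 = band i (H i / 3) (H i / 3 + 2 * R)"
    define U2 where "U2 = band i (2 * H i / 3 - 2 * R) (2 * H i / 3)"
    have U [measurable]: "U1 \<in> sets M" "U2 \<in> sets M" unfolding U1_def U2_def by measurable
    have pU: "prob U1 \<le> 2 * R / H i" "prob U2 \<le> 2 * R / H i"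
      using p_slab_le[of "H i / 3" "H i / 3 + 2 * R" i] p_slab_le[of "2 * H i / 3 - 2 * R" "2 * H i / 3" i] R(1)
      unfolding U1_def U2_def by simp_all
    have sub: "leaves (mid i) (H j) \<subseteq>
       ((((B \<union> (space M - tower j)) \<union> pre (H j) (space M - tower j)) \<union> G) \<union> U1) \<union> U2"
    proof (rule subsetI, rule ccontr)
      fix y assume y: "y \<in> leaves (mid i) (H j)"
        and n: "y \<notin> ((((B \<union> (space M - tower j)) \<union> pre (H j) (space M - tower j)) \<union> G) \<union> U1) \<union> U2"
      from y have ysp: "y \<in> space M" and ymid: "y \<in> mid i" and nmid: "T (H j) y \<notin> mid i" by auto
      from n ysp have nB: "y \<in> space M - B" and t1: "y \<in> tower j" and t2: "T (H j) y \<in> tower j" and nG: "y \<in> space M - G"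
        and nU: "y \<notin> U1" "y \<notin> U2" by auto
      from ymid have mid: "H i / 3 \<le> p i y" "p i y < 2 * H i / 3" by (auto simp: mid_def)
      have q: "0 \<le> p j y" "p j y < H j" "0 \<le> p j (T (H j) y)" "p j (T (H j) y) < H j"
        using t1 t2 by (auto simp: tower_def)
      note gap = gap_before_return[OF height ysp q]
      define g where "g = p j y - p j (T (H j) y)"
      have "g < R"
      proof (rule ccontr)
        assume "\<not> g < R"
        from Z[OF nG] obtain Z where Z: "Z \<in> sets borel" "emeasure lborel Z < ennreal R"
         "\<And>s. \<bar>s\<bar> \<le> H j \<Longrightarrow> T s y \<in> space M - tower j \<Longrightarrow> s \<in> Z" by blast
        have "{H j - p j y..<H j - p j (T (H j) y)} \<subseteq> Z"
        proof
          fix s assume s: "s \<in> {H j - p j y..<H j - p j (T (H j) y)}"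
          then have "T s y \<in> space M - tower j" using gap(2)[of s] ysp by (auto simp: tower_def)
          then show "s \<in> Z" using s q by (intro Z(3)) auto
        qed
        then have "emeasure lborel {H j - p j y..<H j - p j (T (H j) y)} \<le> emeasure lborel Z"
          using Z by (intro emeasure_mono) auto
        then have "ennreal g \<le> emeasure lborel Z" using gap(1) by (simp add: g_def)
        from this Z(2) have "ennreal g < ennreal R" by (rule le_less_trans)
        then show False using \<open>\<not> g < R\<close> by (simp add: ennreal_less_iff ennreal_leI leD)
      qed
      moreover have "0 \<le> g" using gap(1) by (simp add: g_def)
      ultimately have g: "\<bar>g\<bar> \<le> R" by simp
      have "p j (T g (T (H j) y)) = p j (T (H j) y) + g"
        using q ysp by (intro p_shift) (auto simp: g_def)
      then have "p j (T (H j + g) y) = p j y" using T_add[OF ysp, of g "H j"] by (simp add: g_def add.commute)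
      from coh'[OF nB g t1 this] mid R(1,2) have "T (H j) y \<in> tower i" "\<bar>p i (T (H j) y) - p i y\<bar> \<le> 2 * R"
        by auto
      moreover have "H i / 3 + 2 * R \<le> p i y" "p i y < 2 * H i / 3 - 2 * R"
        using nU mid ysp H_pos[of i] by (auto simp: U1_def U2_def)
      ultimately have "T (H j) y \<in> mid i" using ysp unfolding mid_def by auto
      with nmid show False ..
    qed
    have "b j \<le> prob (((((B \<union> (space M - tower j)) \<union> pre (H j) (space M - tower j)) \<union> G) \<union> U1) \<union> U2)"
      unfolding b_def using sub by (rule finite_measure_mono) measurable
    also have "\<dots> \<le> ((((prob B + prob (space M - tower j)) + prob (pre (H j) (space M - tower j))) + prob G) + prob U1) + prob U2"
      by (intro order_trans[OF measure_Un_le] add_right_mono order_refl) measurable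
    also have "prob (pre (H j) (space M - tower j)) = prob (space M - tower j)"
      by (intro prob_vimage_T) measurable
    finally show ?thesis using pU pB pG by simp
  qed
  define u where "u j = a j + 2 * prob (space M - tower j) + 2 * \<bar>C\<bar> * prob (space M - tower j) / R" for j
  have "u \<longlonglongrightarrow> 0 + 2 * 0 + 2 * \<bar>C\<bar> * 0 / R"
    unfolding u_def using R(1) by (intro tendsto_intros a prob_not_tower) auto
  then have "eventually (\<lambda>j. u j < \<eta> / (2 * K)) sequentially"
    using \<eta> K by (intro order_tendstoD) auto
  with c(2) have "eventually (\<lambda>j. C \<le> H j) sequentially"
  proof eventually_elim
    case (elim j)
    show ?case
    proof (rule ccontr)
      assume "\<not> C \<le> H j"
      then have "2 * H j * prob (space M - tower j) / R \<le> 2 * \<bar>C\<bar> * prob (space M - tower j) / R"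
        using R(1) by (intro divide_right_mono mult_right_mono) auto
      moreover have "R / H j \<le> R / c" using elim R(1) c(1) by (intro divide_left_mono) auto
      ultimately have "b j \<le> u j + (R / c + 4 * R / H i)" using b_small[of j] by (simp add: u_def)
      also have "\<dots> < \<eta> / (2 * K) + \<eta> / (2 * K)" using elim(2) R' by linarith
      also have "\<dots> = \<eta> / K" using K by (simp add: field_simps)
      finally have "K * b j < \<eta>" using K by (simp add: field_simps)
      then show False using b_large[OF elim(1)] by simp
    qed
  qed
  with C show False ..
qed

end

section \<open>Spreading of return heights\<close>

context rank_one_mixing_flow
begin

lemma disjoint_slabs: "0 < R \<Longrightarrow> disjoint_family_on (slab i R) K"
  unfolding disjoint_family_on_def
proof (intro ballI impI)
  fix k l :: nat assume R: "0 < R" and "k \<noteq> l"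
  show "slab i R k \<inter> slab i R l = {}"
  proof (rule equals0I)
    fix x assume "x \<in> slab i R k \<inter> slab i R l"
    then have "real k * R < (real l + 1) * R" "real l * R < (real k + 1) * R" by (auto simp: slab_def)
    then have "real k < real l + 1" "real l < real k + 1" using R by simp_all
    then show False using \<open>k \<noteq> l\<close> by linarith
  qed
qed

definition return_set :: "nat \<Rightarrow> real \<Rightarrow> real \<Rightarrow> 'a set" where
  "return_set j R e = {y \<in> tower j. \<exists>r. \<bar>r\<bar> \<le> R \<and> p j (T (e + r) y) = p j y}"

text \<open>
  If \<open>y\<close> and \<open>T (e + r) y\<close> have equal heights in tower \<open>j\<close>, then by coherence \<open>y\<close> and \<open>T e y\<close> have almost equal
  heights in an early, but long, tower \<open>i\<close>. For large \<open>e\<close> these two heights are nearly independent by mixing, and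
  so this has a probability of the order \<open>R / H i\<close>, up to small errors.

  In terms of heights: a point \<open>y\<close> whose height after time \<open>\<tau>\<close> exceeds its height now by a number within \<open>R\<close> of
  \<open>w\<close> is in \<open>return_set j R (\<tau> - w)\<close>. So a gain of height close to \<open>w\<close> is improbable unless \<open>w\<close> is close
  to \<open>\<tau>\<close>, the gain of the points that do not leave the tower.
\<close>

lemma return_offsets_spread:
  assumes R: "0 < R" and \<epsilon>: "0 < \<epsilon>"
  shows "\<exists>\<rho>. \<forall>\<^sub>F j in sequentially. \<forall>e. \<rho> \<le> \<bar>e\<bar> \<longrightarrow> (\<exists>B. B \<in> sets M \<and> prob B \<le> \<epsilon> \<and>
    return_set j R e \<subseteq> B)"
proof -
  have "eventually (\<lambda>i. prob (space M - tower i) < \<epsilon> / 6 \<and> 36 * R / \<epsilon> \<le> H i) sequentially"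
    using order_tendstoD(2)[OF prob_not_tower, of "\<epsilon> / 6"] \<epsilon> heights_tend_to_infinity
    by (auto simp: filterlim_at_top intro: eventually_conj)
  then obtain i where i: "prob (space M - tower i) < \<epsilon> / 6" and "36 * R / \<epsilon> \<le> H i"
    by (auto simp: eventually_sequentially)
  then have "36 * R \<le> \<epsilon> * H i" using \<epsilon> by (simp add: field_simps)
  then have RH: "6 * R / H i \<le> \<epsilon> / 6" "5 * R / H i \<le> \<epsilon> / 6" using H_pos[of i] R by (simp_all add: field_simps)
  define n where "n = nat \<lceil>H i / R\<rceil>"
  define A where "A = slab i R"
  define A' where "A' k = band i ((real k - 2) * R) ((real k + 3) * R)" for k :: nat
  have A [measurable]: "A k \<in> sets M" "A' k \<in> sets M" for k unfolding A_def A'_def by measurable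
  have pA': "prob (A' k) \<le> \<epsilon> / 6" for k
  proof -
    have "prob (A' k) \<le> ((real k + 3) * R - (real k - 2) * R) / H i"
      unfolding A'_def using R by (intro p_slab_le mult_right_mono) auto
    also have "\<dots> = 5 * R / H i" by (simp add: algebra_simps)
    finally show ?thesis using RH by simp
  qed
  have sumA: "(\<Sum>k<n. prob (A k)) \<le> 1"
  proof -
    have "(\<Sum>k<n. prob (A k)) = prob (\<Union>k<n. A k)"
      unfolding A_def using R by (intro finite_measure_finite_Union[symmetric] disjoint_slabs) auto
    then show ?thesis by simp
  qed
  have "eventually (\<lambda>t. prob (moves (A k) t (A' k)) < prob (A k) * prob (A' k) + \<epsilon> / (6 * (real n + 1))) at_infinity" for k
    using mixing_corr[of "A k" "A' k"] \<epsilon> by (intro order_tendstoD(2)) auto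
  then have "eventually (\<lambda>t. \<forall>k\<in>{..<n}. prob (moves (A k) t (A' k)) < prob (A k) * prob (A' k) + \<epsilon> / (6 * (real n + 1))) at_infinity"
    by (intro eventually_ball_finite) auto
  then obtain \<rho> where \<rho>: "\<And>t k. \<rho> \<le> \<bar>t\<bar> \<Longrightarrow> k < n \<Longrightarrow>
      prob (moves (A k) t (A' k)) < prob (A k) * prob (A' k) + \<epsilon> / (6 * (real n + 1))"
    by (auto simp: eventually_at_infinity)
  have small: "(\<Sum>k<n. prob (moves (A k) t (A' k))) \<le> \<epsilon> / 3" if "\<rho> \<le> \<bar>t\<bar>" for t
  proof -
    have "(\<Sum>k<n. prob (moves (A k) t (A' k))) \<le> (\<Sum>k<n. prob (A k) * (\<epsilon> / 6) + \<epsilon> / (6 * (real n + 1)))"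
    proof (rule sum_mono)
      fix k assume "k \<in> {..<n}"
      then have "prob (moves (A k) t (A' k)) \<le> prob (A k) * prob (A' k) + \<epsilon> / (6 * (real n + 1))"
        using \<rho>[OF that, of k] by simp
      also have "\<dots> \<le> prob (A k) * (\<epsilon> / 6) + \<epsilon> / (6 * (real n + 1))"
        using pA'[of k] by (intro add_right_mono mult_left_mono) auto
      finally show "prob (moves (A k) t (A' k)) \<le> prob (A k) * (\<epsilon> / 6) + \<epsilon> / (6 * (real n + 1))" .
    qed
    also have "\<dots> = (\<Sum>k<n. prob (A k)) * (\<epsilon> / 6) + n * (\<epsilon> / (6 * (real n + 1)))"
      by (simp add: sum.distrib sum_distrib_right)
    also have "\<dots> \<le> 1 * (\<epsilon> / 6) + \<epsilon> / 6"
      using sumA \<epsilon> by (intro add_mono mult_right_mono) (auto simp: field_simps)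
    finally show ?thesis by simp
  qed
  obtain a where a: "a \<longlonglongrightarrow> 0" and coh: "\<And>j e. \<exists>B. B \<in> sets M \<and> prob B \<le> a j + R / H j \<and>
      coherent i j R e B"
    using equal_heights_coherent[OF R, of i] by blast
  have "(\<lambda>j. R / H j) \<longlonglongrightarrow> 0"
    by (intro tendsto_divide_0[OF tendsto_const] filterlim_at_top_imp_at_infinity heights_tend_to_infinity)
  from tendsto_add[OF a this] have "eventually (\<lambda>j. a j + R / H j < \<epsilon> / 6) sequentially"
    using \<epsilon> by (intro order_tendstoD) auto
  then have "\<forall>\<^sub>F j in sequentially. \<forall>e. \<rho> \<le> \<bar>e\<bar> \<longrightarrow> (\<exists>B. B \<in> sets M \<and> prob B \<le> \<epsilon> \<and>
    return_set j R e \<subseteq> B)"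
  proof (eventually_elim, intro allI impI)
    fix j e assume aj: "a j + R / H j < \<epsilon> / 6" and e: "\<rho> \<le> \<bar>e\<bar>"
    obtain B where B [measurable]: "B \<in> sets M" and pB: "prob B \<le> a j + R / H j"
      and coh': "\<And>y r. \<lbrakk>y \<in> space M - B; \<bar>r\<bar> \<le> R; y \<in> tower j; p j (T (e + r) y) = p j y;
         2 * R \<le> p i y; p i y < H i - 4 * R\<rbrakk> \<Longrightarrow> T e y \<in> tower i \<and> \<bar>p i (T e y) - p i y\<bar> \<le> 2 * R"
      using coh[of j e] by blast
    define U where "U = band i 0 (2 * R)"
    define V where "V = band i (H i - 4 * R) (H i)"
    define W where "W = (\<Union>k<n. moves (A k) e (A' k))"
    have [measurable]: "U \<in> sets M" "V \<in> sets M" "W \<in> sets M" unfolding U_def V_def W_def by measurable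
    have pU: "prob U \<le> 2 * R / H i" "prob V \<le> 4 * R / H i"
      using p_slab_le[of 0 "2 * R" i] p_slab_le[of "H i - 4 * R" "H i" i] R
      unfolding U_def V_def by simp_all
    have "prob W \<le> (\<Sum>k<n. prob (moves (A k) e (A' k)))"
      unfolding W_def by (intro finite_measure_subadditive_finite) auto
    also have "\<dots> \<le> \<epsilon> / 3" using e by (rule small)
    finally have pW: "prob W \<le> \<epsilon> / 3" .
    let ?B = "(((B \<union> (space M - tower i)) \<union> U) \<union> V) \<union> W"
    show "\<exists>B. B \<in> sets M \<and> prob B \<le> \<epsilon> \<and>
      return_set j R e \<subseteq> B"
    proof (intro exI[of _ ?B] conjI subsetI)
      show "?B \<in> sets M" by measurable
      have "prob ?B \<le> (((prob B + prob (space M - tower i)) + prob U) + prob V) + prob W"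
        by (intro order_trans[OF measure_Un_le] add_right_mono order_refl) measurable
      also have "\<dots> \<le> \<epsilon> / 6 + \<epsilon> / 6 + (2 * R / H i + 4 * R / H i) + \<epsilon> / 3"
        using pU pW pB aj i by linarith
      also have "2 * R / H i + 4 * R / H i = 6 * R / H i" by (simp add: add_divide_distrib[symmetric])
      finally show "prob ?B \<le> \<epsilon>" using RH(1) \<epsilon> by linarith
    next
      fix y assume "y \<in> return_set j R e"
      then obtain r where yj: "y \<in> tower j" and r: "\<bar>r\<bar> \<le> R" and eq: "p j (T (e + r) y) = p j y"
        by (auto simp: return_set_def)
      then have y: "y \<in> space M" by (simp add: tower_def)
      show "y \<in> ?B"
      proof (rule ccontr)
        assume n: "y \<notin> ?B"
        then have yi: "y \<in> tower i" "y \<in> space M - B" using y by auto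
        moreover have "2 * R \<le> p i y" "p i y < H i - 4 * R"
          using n yi by (auto simp: U_def V_def tower_def)
        ultimately have *: "T e y \<in> tower i" "\<bar>p i (T e y) - p i y\<bar> \<le> 2 * R"
          using coh'[OF _ r yj eq] by auto
        from tower_slab[OF yi(1) R] obtain k where k: "k < n" "y \<in> A k" by (auto simp: n_def A_def)
        then have "real k * R \<le> p i y" "p i y < (real k + 1) * R" by (auto simp: A_def slab_def)
        then have "T e y \<in> A' k" using * by (auto simp: A'_def tower_def algebra_simps)
        with k y have "y \<in> W" by (auto simp: W_def)
        with n show False by simp
      qed
    qed
  qed
  then show ?thesis by blast
qed

end

section \<open>Averages of almost uncorrelated functions\<close>

lemma (in prob_space) square_expectation_le:
  fixes X :: "'a \<Rightarrow> real"
  assumes [measurable]: "X \<in> borel_measurable M" and b: "\<And>x. x \<in> space M \<Longrightarrow> \<bar>X x\<bar> \<le> C"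
  shows "(expectation X)\<^sup>2 \<le> expectation (\<lambda>x. (X x)\<^sup>2)"
proof -
  have 1: "integrable M X" using b by (intro integrable_const_bound[of _ C]) auto
  have 2: "integrable M (\<lambda>x. (X x)\<^sup>2)"
  proof (rule integrable_const_bound[of _ "C\<^sup>2"])
    show "AE x in M. norm ((X x)\<^sup>2) \<le> C\<^sup>2"
    proof (rule AE_I2)
      fix x assume "x \<in> space M"
      then have "\<bar>X x\<bar>\<^sup>2 \<le> C\<^sup>2" by (intro power_mono b) auto
      then show "norm ((X x)\<^sup>2) \<le> C\<^sup>2" by simp
    qed
  qed auto
  show ?thesis using variance_eq[OF 1 2] variance_positive[of X] by simp
qed

text \<open>
  Substituting \<open>S\<close> changes the integral of \<open>X\<close> over \<open>V\<close> into that of \<open>X \<circ> S\<close> over the preimage of \<open>V\<close>,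
  which differs from \<open>V\<close> by as much as \<open>V\<close> loses under \<open>S\<close>.
\<close>

lemma (in prob_space) almost_invariant_integral:
  fixes X :: "'a \<Rightarrow> real"
  assumes S [measurable]: "S \<in> M \<rightarrow>\<^sub>M M" and distr: "distr M M S = M" and V [measurable]: "V \<in> sets M"
    and X [measurable]: "X \<in> borel_measurable M" and X1: "\<And>x. x \<in> space M \<Longrightarrow> \<bar>X x\<bar> \<le> 1"
  shows "\<bar>expectation (\<lambda>x. indicator V x * X x) - expectation (\<lambda>x. indicator V x * X (S x))\<bar>
    \<le> 2 * prob {x \<in> space M. x \<in> V \<and> S x \<notin> V}"
proof -
  have Ssp: "S x \<in> space M" if "x \<in> space M" for x using S that by (rule measurable_space)
  have VX1: "\<bar>indicator V y * X (S x)\<bar> \<le> 1" if "x \<in> space M" for x y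
    using X1[OF Ssp[OF that]] by (auto simp: indicator_def)
  have int: "integrable M (\<lambda>x. indicator V x * X (S x))" "integrable M (\<lambda>x. indicator V (S x) * X (S x))"
    using VX1 by (auto intro!: integrable_const_bound[of _ 1])
  let ?U = "{x \<in> space M. x \<in> V \<and> S x \<notin> V}" and ?W = "{x \<in> space M. x \<notin> V \<and> S x \<in> V}"
  have UW: "?U \<inter> space M = ?U" "?W \<inter> space M = ?W" by auto
  have intUW: "integrable M (indicat_real ?U)" "integrable M (indicat_real ?W)"
    by (auto intro!: integrable_real_indicator simp: emeasure_eq_measure)
  have "expectation (\<lambda>x. indicator V x * X x) = (\<integral>x. indicator V x * X x \<partial>distr M M S)" by (simp add: distr)
  also have "\<dots> = expectation (\<lambda>x. indicator V (S x) * X (S x))" by (rule integral_distr) measurable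
  finally have "expectation (\<lambda>x. indicator V x * X x) - expectation (\<lambda>x. indicator V x * X (S x)) =
    expectation (\<lambda>x. indicator V (S x) * X (S x) - indicator V x * X (S x))" using int by simp
  also have "\<bar>\<dots>\<bar> \<le> expectation (\<lambda>x. \<bar>indicator V (S x) * X (S x) - indicator V x * X (S x)\<bar>)"
    by (rule integral_abs_bound)
  also have "\<dots> \<le> expectation (\<lambda>x. indicator ?U x + indicator ?W x)"
  proof (rule integral_mono)
    show "integrable M (\<lambda>x. \<bar>indicator V (S x) * X (S x) - indicator V x * X (S x)\<bar>)" using int by auto
    show "integrable M (\<lambda>x. indicat_real ?U x + indicator ?W x)" using intUW by simp
    fix x assume "x \<in> space M"
    then show "\<bar>indicator V (S x) * X (S x) - indicator V x * X (S x)\<bar> \<le> indicat_real ?U x + indicator ?W x"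
      using X1[of "S x"] Ssp[of x] by (auto simp: indicator_def)
  qed
  also have "\<dots> = prob ?U + prob ?W" using intUW UW by (simp only: Bochner_Integration.integral_add Bochner_Integration.integral_indicator)
  also have "prob ?W = prob ?U"
  proof -
    have Vsp: "V \<subseteq> space M" by (rule sets.sets_into_space[OF V])
    let ?SV = "{x \<in> space M. S x \<in> V}"
    have "prob ?SV = prob V"
    proof -
      have "prob V = measure (distr M M S) V" by (simp add: distr)
      also have "\<dots> = prob (S -` V \<inter> space M)" by (rule measure_distr) measurable
      also have "S -` V \<inter> space M = ?SV" by auto
      finally show ?thesis by simp
    qed
    moreover have "prob ?W = prob ?SV - prob (V \<inter> ?SV)"
    proof -
      have "?W = ?SV - V \<inter> ?SV" by auto
      then show ?thesis by (simp add: finite_measure_Diff)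
    qed
    moreover have "prob ?U = prob V - prob (V \<inter> ?SV)"
    proof -
      have "?U = V - V \<inter> ?SV" using Vsp by auto
      then show ?thesis by (simp add: finite_measure_Diff)
    qed
    ultimately show ?thesis by simp
  qed
  finally show ?thesis by simp
qed

text \<open>
  Van der Corput's trick: the average of pairwise almost uncorrelated functions is small in \<open>L\<^sup>2\<close>, so it is
  almost orthogonal to every bounded function \<open>h\<close>. It is used for widely spaced translates of one function.
\<close>

lemma (in prob_space) weak_average_of_almost_uncorrelated:
  fixes X :: "nat \<Rightarrow> 'a \<Rightarrow> real" and h :: "'a \<Rightarrow> real"
  assumes X [measurable]: "\<And>r. X r \<in> borel_measurable M" and Xb: "\<And>r x. x \<in> space M \<Longrightarrow> \<bar>X r x\<bar> \<le> 1"
    and h [measurable]: "h \<in> borel_measurable M" and hb: "\<And>x. x \<in> space M \<Longrightarrow> \<bar>h x\<bar> \<le> 1"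
    and unc: "\<And>r s. r < n \<Longrightarrow> s < n \<Longrightarrow> r \<noteq> s \<Longrightarrow> \<bar>expectation (\<lambda>x. X r x * X s x)\<bar> \<le> \<delta>"
    and n: "0 < n" and \<delta>: "0 \<le> \<delta>"
  shows "\<bar>(\<Sum>r<n. expectation (\<lambda>x. h x * X r x)) / n\<bar> \<le> sqrt (1 / n + \<delta>)"
proof -
  define S where "S x = (\<Sum>r<n. X r x)" for x
  have S [measurable]: "S \<in> borel_measurable M" unfolding S_def by measurable
  have Sb: "\<bar>S x\<bar> \<le> n" if "x \<in> space M" for x
  proof -
    have "\<bar>S x\<bar> \<le> (\<Sum>r<n. \<bar>X r x\<bar>)" unfolding S_def by (rule sum_abs)
    also have "\<dots> \<le> (\<Sum>r<n. 1)" using Xb[OF that] by (intro sum_mono) auto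
    finally show ?thesis by simp
  qed
  have prod_le: "\<bar>a * b\<bar> \<le> c * d" if "\<bar>a\<bar> \<le> c" "\<bar>b\<bar> \<le> d" for a b c d :: real
    using that unfolding abs_mult by (intro mult_mono) auto
  have int: "integrable M (\<lambda>x. h x * X r x)" "integrable M (\<lambda>x. X r x * X s x)" for r s
    using prod_le[OF hb Xb] prod_le[OF Xb Xb] by (auto intro!: integrable_const_bound[of _ "1 * 1"] simp del: mult_1)
  have intS: "integrable M (\<lambda>x. (h x * S x)\<^sup>2)" "integrable M (\<lambda>x. (S x)\<^sup>2)"
    using power_mono[OF prod_le[OF hb Sb] abs_ge_zero, where n = 2] power_mono[OF Sb abs_ge_zero, where n = 2]
    by (auto intro!: integrable_const_bound[of _ "(1 * real n)\<^sup>2"])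
  have "(\<Sum>r<n. expectation (\<lambda>x. h x * X r x)) = expectation (\<lambda>x. h x * S x)"
    unfolding S_def sum_distrib_left using int by (subst Bochner_Integration.integral_sum) auto
  also have "(expectation (\<lambda>x. h x * S x))\<^sup>2 \<le> expectation (\<lambda>x. (h x * S x)\<^sup>2)"
    using prod_le[OF hb Sb] by (intro square_expectation_le[of _ "1 * n"]) auto
  also have "\<dots> \<le> expectation (\<lambda>x. (S x)\<^sup>2)"
  proof (rule integral_mono[OF intS])
    fix x assume "x \<in> space M"
    then have "(h x)\<^sup>2 \<le> 1" using hb by (simp add: abs_square_le_1)
    then have "(h x)\<^sup>2 * (S x)\<^sup>2 \<le> 1 * (S x)\<^sup>2" by (intro mult_right_mono) auto
    then show "(h x * S x)\<^sup>2 \<le> (S x)\<^sup>2" by (simp add: power_mult_distrib)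
  qed
  also have "\<dots> = (\<Sum>r<n. \<Sum>s<n. expectation (\<lambda>x. X r x * X s x))"
    unfolding S_def power2_eq_square sum_product using int
    by (subst Bochner_Integration.integral_sum) (auto intro!: sum.cong Bochner_Integration.integral_sum)
  also have "\<dots> \<le> (\<Sum>r<n. \<Sum>s<n. (if s = r then 1 else 0) + \<delta>)"
  proof (intro sum_mono)
    fix r s assume rs: "r \<in> {..<n}" "s \<in> {..<n}"
    show "expectation (\<lambda>x. X r x * X s x) \<le> (if s = r then 1 else 0) + \<delta>"
    proof (cases "s = r")
      case True
      have "expectation (\<lambda>x. X r x * X s x) \<le> expectation (\<lambda>x. 1)"
        using prod_le[OF Xb[of _ r] Xb[of _ s]] int by (intro integral_mono) (auto simp: abs_le_iff)
      then show ?thesis using True \<delta> by (simp add: prob_space)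
    qed (use unc[of r s] rs in auto)
  qed
  also have "\<dots> = n + n * (n * \<delta>)"
    by (simp add: sum.distrib algebra_simps)
  finally have "(\<Sum>r<n. expectation (\<lambda>x. h x * X r x))\<^sup>2 \<le> n + n * (n * \<delta>)" .
  then have "((\<Sum>r<n. expectation (\<lambda>x. h x * X r x)) / n)\<^sup>2 \<le> (n + n * (n * \<delta>)) / (real n)\<^sup>2"
    unfolding power_divide by (intro divide_right_mono) auto
  also have "\<dots> = 1 / n + \<delta>" using n by (simp add: field_simps power2_eq_square)
  finally show ?thesis by (intro real_le_rsqrt) (simp only: power2_abs)
qed

text \<open>
  The integrals of \<open>X\<close> and of its translates over \<open>V\<close> are nearly equal, and their average is small by van der Corput's
  trick.
\<close>

lemma (in prob_space) almost_invariant_average: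
  fixes X :: "'a \<Rightarrow> real" and S :: "nat \<Rightarrow> 'a \<Rightarrow> 'a" and n :: nat
  assumes S [measurable]: "\<And>r. S r \<in> M \<rightarrow>\<^sub>M M" and distr: "\<And>r. distr M M (S r) = M"
    and V [measurable]: "V \<in> sets M" and X [measurable]: "X \<in> borel_measurable M" and X1: "\<And>x. \<bar>X x\<bar> \<le> 1"
    and inv: "\<And>r. r < n \<Longrightarrow> prob {x \<in> space M. x \<in> V \<and> S r x \<notin> V} \<le> \<gamma>"
    and unc: "\<And>r s. r < n \<Longrightarrow> s < n \<Longrightarrow> r \<noteq> s \<Longrightarrow> \<bar>expectation (\<lambda>x. X (S r x) * X (S s x))\<bar> \<le> \<delta>"
    and n: "0 < n" and \<delta>: "0 \<le> \<delta>"
  shows "\<bar>expectation (\<lambda>x. indicator V x * X x)\<bar> \<le> 2 * \<gamma> + sqrt (1 / n + \<delta>)"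
proof -
  define I where "I = expectation (\<lambda>x. indicator V x * X x)"
  define J where "J r = expectation (\<lambda>x. indicator V x * X (S r x))" for r
  have shift: "\<bar>I - J r\<bar> \<le> 2 * \<gamma>" if "r < n" for r
    using almost_invariant_integral[OF S distr V X X1, of r] inv[OF that] by (simp add: I_def J_def)
  have avg: "\<bar>(\<Sum>r<n. J r) / n\<bar> \<le> sqrt (1 / n + \<delta>)"
    unfolding J_def using X1 n \<delta>
    by (intro weak_average_of_almost_uncorrelated unc) (auto simp: indicator_def)
  have "I - (\<Sum>r<n. J r) / n = (\<Sum>r<n. I - J r) / n"
    using n by (simp add: sum_subtractf diff_divide_distrib)
  also have "\<bar>\<dots>\<bar> \<le> (\<Sum>r<n. 2 * \<gamma>) / n"
    unfolding abs_divide abs_of_nat using shift by (intro divide_right_mono order_trans[OF sum_abs] sum_mono) auto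
  also have "\<dots> = 2 * \<gamma>" using n by simp
  finally show ?thesis using avg unfolding I_def by linarith
qed

context mixing_measure_flow
begin

text \<open>
  Stated for simple functions in order to cover the products \<open>F \<cdot> F \<circ> T t\<close> of a centered indicator \<open>F\<close> with
  its translates.
\<close>

lemma mixing_simple:
  fixes f g :: "'a \<Rightarrow> real"
  assumes f: "simple_function M f" and g: "simple_function M g"
  shows "((\<lambda>t. \<integral>x. f x * g (T t x) \<partial>M) \<longlongrightarrow> (\<integral>x. f x \<partial>M) * (\<integral>x. g x \<partial>M)) at_infinity"
proof -
  define I J where "I = f ` space M" and "J = g ` space M"
  define A B where "A y = f -` {y} \<inter> space M" and "B y = g -` {y} \<inter> space M" for y
  have fin: "finite I" "finite J" using f g by (auto simp: I_def J_def simple_function_def)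
  have [measurable]: "A y \<in> sets M" "B y \<in> sets M" for y
    using f g by (auto simp: A_def B_def simple_functionD)
  have sp: "A y \<subseteq> space M" "B y \<subseteq> space M" for y by (auto simp: A_def B_def)
  have int: "integrable M (indicat_real (A y))" "integrable M (indicat_real (B y))" for y
    by (auto intro!: integrable_real_indicator simp: emeasure_eq_measure)
  have fx: "f x = (\<Sum>y\<in>I. y * indicator (A y) x)" if "x \<in> space M" for x
    using that fin by (simp add: I_def A_def indicator_def if_distrib[of "\<lambda>z. _ * z"] sum.delta cong: if_cong)
  have gx: "g x = (\<Sum>y\<in>J. y * indicator (B y) x)" if "x \<in> space M" for x
    using that fin by (simp add: J_def B_def indicator_def if_distrib[of "\<lambda>z. _ * z"] sum.delta cong: if_cong)
  have "(\<integral>x. f x * g (T t x) \<partial>M) = (\<Sum>y\<in>I. \<Sum>z\<in>J. y * z * prob (moves (A y) t (B z)))" for t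
  proof -
    have "(\<integral>x. f x * g (T t x) \<partial>M) =
        (\<integral>x. (\<Sum>y\<in>I. \<Sum>z\<in>J. y * z * indicator (moves (A y) t (B z)) x) \<partial>M)"
    proof (rule integral_cong_space)
      fix x assume x: "x \<in> space M"
      show "f x * g (T t x) = (\<Sum>y\<in>I. \<Sum>z\<in>J. y * z * indicator (moves (A y) t (B z)) x)"
        unfolding fx[OF x] gx[OF T_space[OF x]] sum_product using x
        by (intro sum.cong refl) (auto simp: indicator_def)
    qed
    also have "\<dots> = (\<Sum>y\<in>I. \<Sum>z\<in>J. y * z * prob (moves (A y) t (B z)))"
    proof -
      have 1: "integrable M (\<lambda>x. y * z * indicator (moves (A y) t (B z)) x :: real)" for y z
        by (intro integrable_mult_right integrable_real_indicator) (auto simp: emeasure_eq_measure)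
      have 2: "moves (A y) t (B z) \<inter> space M = moves (A y) t (B z)" for y z
        by auto
      show ?thesis
        by (simp only: Bochner_Integration.integral_sum Bochner_Integration.integrable_sum 1
              integral_mult_right_zero Bochner_Integration.integral_indicator 2)
    qed
    finally show ?thesis .
  qed
  moreover have "((\<lambda>t. \<Sum>y\<in>I. \<Sum>z\<in>J. y * z * prob (moves (A y) t (B z))) \<longlongrightarrow>
     (\<Sum>y\<in>I. \<Sum>z\<in>J. y * z * (prob (A y) * prob (B z)))) at_infinity"
    by (intro tendsto_intros mixing_corr) auto
  moreover have "(\<Sum>y\<in>I. \<Sum>z\<in>J. y * z * (prob (A y) * prob (B z))) = (\<integral>x. f x \<partial>M) * (\<integral>x. g x \<partial>M)"
  proof -
    have "(\<integral>x. f x \<partial>M) = (\<integral>x. (\<Sum>y\<in>I. y * indicator (A y) x) \<partial>M)"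
      by (rule Bochner_Integration.integral_cong[OF refl fx])
    also have "\<dots> = (\<Sum>y\<in>I. y * prob (A y))"
      using sp int by (subst Bochner_Integration.integral_sum) (auto simp: Int_absorb2 Int_absorb1)
    finally have 1: "(\<integral>x. f x \<partial>M) = (\<Sum>y\<in>I. y * prob (A y))" .
    have "(\<integral>x. g x \<partial>M) = (\<integral>x. (\<Sum>y\<in>J. y * indicator (B y) x) \<partial>M)"
      by (rule Bochner_Integration.integral_cong[OF refl gx])
    also have "\<dots> = (\<Sum>y\<in>J. y * prob (B y))"
      using sp int by (subst Bochner_Integration.integral_sum) (auto simp: Int_absorb2 Int_absorb1)
    finally have 2: "(\<integral>x. g x \<partial>M) = (\<Sum>y\<in>J. y * prob (B y))" .
    show ?thesis unfolding 1 2 sum_product by (intro sum.cong refl) simp_all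
  qed
  ultimately show ?thesis by simp
qed

end

context prob_space
begin

definition centered :: "'a set \<Rightarrow> 'a \<Rightarrow> real" where
  "centered B x = indicator B x - prob B"

lemma centered_measurable [measurable]:
  assumes [measurable]: "B \<in> sets M"
  shows "centered B \<in> borel_measurable M"
  unfolding centered_def by measurable

lemma centered_le_1: "\<bar>centered B x\<bar> \<le> 1"
  using prob_le_1[of B] measure_nonneg[of M B] by (auto simp: centered_def indicator_def)

lemma centered_prod_le_1: "\<bar>centered B x * centered B y\<bar> \<le> 1"
  using mult_mono[OF centered_le_1 centered_le_1, of B x B y] by (simp add: abs_mult mult.commute)

lemma simple_function_centered: "B \<in> sets M \<Longrightarrow> simple_function M (centered B)"
  unfolding centered_def by (intro simple_function_diff simple_function_indicator simple_function_const)

lemma integral_centered: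
  assumes B: "B \<in> sets M"
  shows "expectation (centered B) = 0"
proof -
  have "expectation (\<lambda>x. indicator B x - prob B) = prob B - prob B"
    using B sets.sets_into_space[OF B]
    by (subst Bochner_Integration.integral_diff) (auto simp: emeasure_eq_measure prob_space Int_absorb2)
  then show ?thesis unfolding centered_def by simp
qed

end

context mixing_measure_flow
begin

lemma centered_correlation:
  assumes B: "B \<in> sets M" and "0 < \<epsilon>"
  shows "\<exists>\<sigma>>0. \<forall>t. \<sigma> \<le> \<bar>t\<bar> \<longrightarrow> \<bar>\<integral>x. centered B x * centered B (T t x) \<partial>M\<bar> < \<epsilon>"
proof -
  have "((\<lambda>t. \<bar>\<integral>x. centered B x * centered B (T t x) \<partial>M\<bar>) \<longlongrightarrow> \<bar>0 * 0\<bar>) at_infinity"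
    using mixing_simple[OF simple_function_centered[OF B] simple_function_centered[OF B]]
    by (intro tendsto_rabs) (simp add: integral_centered[OF B])
  then have "eventually (\<lambda>t. \<bar>\<integral>x. centered B x * centered B (T t x) \<partial>M\<bar> < \<epsilon>) at_infinity"
    using \<open>0 < \<epsilon>\<close> by (intro order_tendstoD) auto
  then obtain b where b: "0 < b" "\<And>t. b \<le> \<bar>t\<bar> \<Longrightarrow> \<bar>\<integral>x. centered B x * centered B (T t x) \<partial>M\<bar> < \<epsilon>"
    by (auto simp: eventually_at_infinity_pos)
  then show ?thesis by blast
qed

end

context rank_one_mixing_flow
begin

text \<open>
  Mixing alone does not give this for a set that varies with \<open>j\<close>, such as the set \<open>V\<close> of points with heights
  between \<open>u\<close> and \<open>v\<close>. But \<open>V\<close> is almost invariant under \<open>T (\<sigma> * r)\<close> for bounded \<open>r\<close>, since \<open>H j\<close> is large, so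
  \<open>F \<cdot> F \<circ> T e\<close> may be replaced by the average of its translates. Two such translates are correlated
  like \<open>G\<close> and \<open>G \<circ> T e\<close>, where \<open>G = F \<cdot> F \<circ> T k\<close>; for large \<open>e\<close> this is nearly the square of the
  integral of \<open>G\<close>, which is small for large \<open>k\<close>.
\<close>

lemma interval_correlations_small:
  assumes B [measurable]: "B \<in> sets M" and \<epsilon>: "0 < \<epsilon>"
  shows "\<exists>\<rho>. \<forall>\<^sub>F j in sequentially. \<forall>e u v. \<rho> \<le> \<bar>e\<bar> \<longrightarrow>
    \<bar>\<integral>x. indicator {x \<in> tower j. u \<le> p j x \<and> p j x < v} x * (centered B x * centered B (T e x)) \<partial>M\<bar> \<le> \<epsilon>"
proof -
  define \<epsilon>1 where "\<epsilon>1 = min (1 / 2) (\<epsilon>\<^sup>2 / 8)"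
  have \<epsilon>1: "0 < \<epsilon>1" "\<epsilon>1 < 1" "2 * \<epsilon>1 \<le> (\<epsilon> / 2)\<^sup>2"
    using \<epsilon> by (auto simp: \<epsilon>1_def power2_eq_square)
  define F where "F = centered B"
  have F [measurable]: "F \<in> borel_measurable M" unfolding F_def by measurable
  have F1: "\<bar>F x\<bar> \<le> 1" "\<bar>F x * F y\<bar> \<le> 1" for x y unfolding F_def by (rule centered_le_1 centered_prod_le_1)+
  obtain \<sigma> where \<sigma>: "0 < \<sigma>" "\<And>t. \<sigma> \<le> \<bar>t\<bar> \<Longrightarrow> \<bar>\<integral>x. F x * F (T t x) \<partial>M\<bar> < \<epsilon>1"
    using centered_correlation[OF B \<epsilon>1(1)] by (auto simp: F_def)
  define n where "n = nat \<lceil>1 / \<epsilon>1\<rceil> + 1"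
  have n: "0 < n" "1 / n \<le> \<epsilon>1"
  proof -
    show "0 < n" by (simp add: n_def)
    have "1 / \<epsilon>1 \<le> n" unfolding n_def using real_nat_ceiling_ge[of "1 / \<epsilon>1"] by simp
    then show "1 / n \<le> \<epsilon>1" using \<epsilon>1(1) \<open>0 < n\<close> by (simp add: field_simps)
  qed
  \<comment> \<open>the time between the translates with the numbers \<open>r\<close> and \<open>s\<close>\<close>
  define k where "k r s = \<sigma> * (real s - real r)" for r s :: nat
  define G where "G t x = F x * F (T t x)" for t x
  have G [measurable]: "G t \<in> borel_measurable M" for t unfolding G_def by measurable
  have G_simple: "simple_function M (G t)" for t
  proof -
    have "simple_function M (indicat_real (pre t B))"
      by (intro simple_function_indicator) measurable
    also have "simple_function M (indicat_real (pre t B)) \<longleftrightarrow> simple_function M (\<lambda>x. indicat_real B (T t x))"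
      by (intro simple_function_cong) (auto simp: indicator_def)
    finally have "simple_function M (\<lambda>x. F (T t x))"
      unfolding F_def centered_def by (intro simple_function_diff simple_function_const)
    then show ?thesis unfolding G_def F_def
      by (intro simple_function_mult simple_function_centered[OF B])
  qed
  have "eventually (\<lambda>e. \<bar>\<integral>x. G (k r s) x * G (k r s) (T e x) \<partial>M\<bar> < \<epsilon>1) at_infinity" if "r \<noteq> s" for r s
  proof -
    have "\<sigma> * 1 \<le> \<sigma> * \<bar>real s - real r\<bar>" using \<sigma>(1) that by (intro mult_left_mono) auto
    then have "\<bar>\<integral>x. G (k r s) x \<partial>M\<bar> < \<epsilon>1"
      unfolding G_def using \<sigma>(1) by (intro \<sigma>(2)) (simp add: k_def abs_mult)
    then have "\<bar>(\<integral>x. G (k r s) x \<partial>M) * (\<integral>x. G (k r s) x \<partial>M)\<bar> < \<epsilon>1 * 1"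
      unfolding abs_mult using \<epsilon>1 by (intro mult_strict_mono') auto
    moreover have "((\<lambda>e. \<bar>\<integral>x. G (k r s) x * G (k r s) (T e x) \<partial>M\<bar>) \<longlongrightarrow> \<bar>(\<integral>x. G (k r s) x \<partial>M) * (\<integral>x. G (k r s) x \<partial>M)\<bar>) at_infinity"
      by (intro tendsto_rabs mixing_simple G_simple)
    ultimately show ?thesis by (intro order_tendstoD(2)) simp_all
  qed
  then have "eventually (\<lambda>e. \<forall>q\<in>{q\<in>{..<n} \<times> {..<n}. fst q \<noteq> snd q}.
      \<bar>\<integral>x. G (k (fst q) (snd q)) x * G (k (fst q) (snd q)) (T e x) \<partial>M\<bar> < \<epsilon>1) at_infinity"
    by (intro eventually_ball_finite) auto
  then obtain \<rho> where \<rho>: "\<And>e r s. \<rho> \<le> \<bar>e\<bar> \<Longrightarrow> r < n \<Longrightarrow> s < n \<Longrightarrow> r \<noteq> s \<Longrightarrow>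
      \<bar>\<integral>x. G (k r s) x * G (k r s) (T e x) \<partial>M\<bar> < \<epsilon>1"
    by (fastforce simp: eventually_at_infinity)
  have "eventually (\<lambda>j. 8 * \<sigma> * n / \<epsilon> \<le> H j) sequentially"
    using heights_tend_to_infinity by (auto simp: filterlim_at_top)
  then have "\<forall>\<^sub>F j in sequentially. \<forall>e u v. \<rho> \<le> \<bar>e\<bar> \<longrightarrow>
    \<bar>\<integral>x. indicator {x \<in> tower j. u \<le> p j x \<and> p j x < v} x * (centered B x * centered B (T e x)) \<partial>M\<bar> \<le> \<epsilon>"
  proof (eventually_elim, intro allI impI)
    fix j e u v assume Hj: "8 * \<sigma> * n / \<epsilon> \<le> H j" and e: "\<rho> \<le> \<bar>e\<bar>"
    define V where "V = {x \<in> tower j. u \<le> p j x \<and> p j x < v}"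
    have V [measurable]: "V \<in> sets M" unfolding V_def by measurable
    define X where "X x = F x * F (T e x)" for x
    have X [measurable]: "X \<in> borel_measurable M" unfolding X_def by measurable
    have X1: "\<bar>X x\<bar> \<le> 1" for x unfolding X_def by (rule F1)
    have shift: "prob (leaves V (\<sigma> * real r)) \<le> \<epsilon> / 4" if r: "r < n" for r
    proof -
      have "8 * \<sigma> * r \<le> 8 * \<sigma> * n" using r \<sigma>(1) by (intro mult_left_mono) auto
      also have "\<dots> \<le> \<epsilon> * H j" using Hj \<epsilon> by (simp add: field_simps)
      finally have "2 * (\<sigma> * r) / H j \<le> \<epsilon> / 4" using H_pos[of j] by (simp add: field_simps)
      then show ?thesis using interval_shift[OF V_def, of "\<sigma> * r"] \<sigma>(1) by simp
    qed
    have unc: "\<bar>\<integral>x. X (T (\<sigma> * real r) x) * X (T (\<sigma> * real s) x) \<partial>M\<bar> \<le> \<epsilon>1" if rs: "r < n" "s < n" "r \<noteq> s" for r s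
    proof -
      have "(\<integral>x. X (T (\<sigma> * real r) x) * X (T (\<sigma> * real s) x) \<partial>M) =
        (\<integral>x. G (k r s) (T (\<sigma> * r) x) * G (k r s) (T e (T (\<sigma> * r) x)) \<partial>M)"
      proof (rule integral_cong_space)
        fix x assume x: "x \<in> space M"
        have "\<sigma> * real s = k r s + \<sigma> * real r" by (simp add: k_def algebra_simps)
        then show "X (T (\<sigma> * real r) x) * X (T (\<sigma> * real s) x) = G (k r s) (T (\<sigma> * r) x) * G (k r s) (T e (T (\<sigma> * r) x))"
          using x by (simp add: X_def G_def T_add[symmetric] algebra_simps)
      qed
      also have "\<dots> = (\<integral>x. G (k r s) x * G (k r s) (T e x) \<partial>M)"
        by (rule integral_T) measurable
      finally show ?thesis using \<rho>[OF e rs] by simp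
    qed
    have "\<bar>\<integral>x. indicator V x * X x \<partial>M\<bar> \<le> 2 * (\<epsilon> / 4) + sqrt (1 / n + \<epsilon>1)"
      using n(1) \<epsilon>1(1) by (intro almost_invariant_average[OF T_measurable T_distr V X X1 shift unc]) auto
    also have "sqrt (1 / n + \<epsilon>1) \<le> sqrt ((\<epsilon> / 2)\<^sup>2)" using n(2) \<epsilon>1(3) by (intro real_sqrt_le_mono) linarith
    also have "\<dots> = \<epsilon> / 2" using \<epsilon> by simp
    finally have "\<bar>\<integral>x. indicator V x * X x \<partial>M\<bar> \<le> \<epsilon>" by simp
    then show "\<bar>\<integral>x. indicator {x \<in> tower j. u \<le> p j x \<and> p j x < v} x * (centered B x * centered B (T e x)) \<partial>M\<bar> \<le> \<epsilon>"
      by (simp add: X_def V_def F_def)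
  qed
  then show ?thesis by blast
qed

end

section \<open>Averaging along the lines of a square\<close>

lemma lborel_integral_affine:
  fixes h :: "real \<Rightarrow> real"
  assumes "c \<noteq> 0"
  shows "(\<integral>s. h (t + c * s) \<partial>lborel) = (\<integral>s. h s \<partial>lborel) / \<bar>c\<bar>"
  using lborel_integral_real_affine[OF assms, of h t] assms by simp

context prob_space
begin

lemma fubini_bounded:
  fixes h :: "'a \<Rightarrow> real \<Rightarrow> real"
  assumes [measurable]: "(\<lambda>(z, s). h z s) \<in> borel_measurable (M \<Otimes>\<^sub>M lborel)"
    and b: "\<And>z s. z \<in> space M \<Longrightarrow> \<bar>h z s\<bar> \<le> C" and supp: "\<And>z s. z \<in> space M \<Longrightarrow> L < \<bar>s\<bar> \<Longrightarrow> h z s = 0"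
  shows "(\<integral>z. (\<integral>s. h z s \<partial>lborel) \<partial>M) = (\<integral>s. (\<integral>z. h z s \<partial>M) \<partial>lborel)"
proof -
  interpret P: pair_sigma_finite M "lborel :: real measure" ..
  have "integrable (M \<Otimes>\<^sub>M lborel) (\<lambda>(z, s). h z s)"
  proof (rule Bochner_Integration.integrable_bound)
    have "emeasure (M \<Otimes>\<^sub>M lborel) (space M \<times> {-\<bar>L\<bar>..\<bar>L\<bar>}) = emeasure M (space M) * emeasure lborel {-\<bar>L\<bar>..\<bar>L\<bar>}"
      by (intro lborel.emeasure_pair_measure_Times) auto
    also have "\<dots> < \<infinity>" by (simp add: emeasure_space_1)
    finally show "integrable (M \<Otimes>\<^sub>M lborel) (\<lambda>x. indicator (space M \<times> {-\<bar>L\<bar>..\<bar>L\<bar>}) x * \<bar>C\<bar>)"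
      by (intro integrable_mult_left integrable_real_indicator) auto
    show "AE x in M \<Otimes>\<^sub>M lborel. norm (case x of (z, s) \<Rightarrow> h z s) \<le> norm (indicator (space M \<times> {-\<bar>L\<bar>..\<bar>L\<bar>}) x * \<bar>C\<bar>)"
    proof (rule AE_I2)
      fix x assume "x \<in> space (M \<Otimes>\<^sub>M (lborel :: real measure))"
      then obtain z s where x: "x = (z, s)" "z \<in> space M" by (auto simp: space_pair_measure)
      show "norm (case x of (z, s) \<Rightarrow> h z s) \<le> norm (indicator (space M \<times> {-\<bar>L\<bar>..\<bar>L\<bar>}) x * \<bar>C\<bar>)"
      proof (cases "s \<in> {-\<bar>L\<bar>..\<bar>L\<bar>}")
        case True
        then show ?thesis using b[OF x(2), of s] x by (auto simp: indicator_def)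
      next
        case False
        then have "L < \<bar>s\<bar>" by auto
        then show ?thesis using supp[OF x(2), of s] x by simp
      qed
    qed
  qed measurable
  from P.Fubini_integral[OF this] show ?thesis by simp
qed

text \<open>
  Here \<open>P\<close> and \<open>Q\<close> are the coordinates of a random point of the plane. Assumption \<open>inv\<close> says that its distribution
  is invariant in the direction \<open>(1, \<alpha>)\<close> inside the square, and \<open>\<Delta>\<close> is a set of offsets \<open>d\<close> of lines
  \<open>v = \<alpha> * u + d\<close>. The assumptions \<open>long\<close>, \<open>spread\<close> and \<open>corr\<close> say that these lines have long intersections
  with the square, that strips of width \<open>\<rho>\<close> carry little mass, and that the values of \<open>f\<close> on two lines whose offsets
  differ by more than \<open>\<rho>\<close> are almost uncorrelated.

  Replacing the integrand by its average along the line turns the integral into that of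
  \<open>a s * K s\<close>, where \<open>K s\<close> is a weighted average of \<open>f\<close> over the points at which the random line meets the vertical line
  at \<open>s\<close>. The integral of \<open>K\<^sup>2\<close> is an average of correlations over pairs of independent random lines.
\<close>

lemma line_average_bound:
  fixes P Q :: "'a \<Rightarrow> real" and a f :: "real \<Rightarrow> real" and bx :: "real \<Rightarrow> real" and \<Delta> :: "real set"
    and H \<alpha> \<delta> \<epsilon>1 \<epsilon>2 \<rho> :: real
  defines "bx \<equiv> indicator {0..<H}"
  assumes [measurable]: "P \<in> borel_measurable M" "Q \<in> borel_measurable M"
    "a \<in> borel_measurable borel" "f \<in> borel_measurable borel" "\<Delta> \<in> sets borel"
    and H: "0 < H" and \<alpha>: "0 < \<alpha>" and \<delta>: "0 < \<delta>" and \<epsilon>: "0 < \<epsilon>1" "0 \<le> \<epsilon>2"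
    and a: "\<And>s. \<bar>a s\<bar> \<le> 1" and f: "\<And>s. \<bar>f s\<bar> \<le> 1"
    and inv: "\<And>G \<tau>. G \<in> borel_measurable (borel \<Otimes>\<^sub>M borel) \<Longrightarrow>
      (\<integral>z. G (P z, Q z) * (bx (P z) * bx (Q z) * bx (P z - \<tau>) * bx (Q z - \<alpha> * \<tau>)) \<partial>M) =
      (\<integral>z. G (P z + \<tau>, Q z + \<alpha> * \<tau>) * (bx (P z) * bx (Q z) * bx (P z + \<tau>) * bx (Q z + \<alpha> * \<tau>)) \<partial>M)"
    and long: "\<And>d. d \<in> \<Delta> \<Longrightarrow> \<delta> * H \<le> (\<integral>s. bx s * bx (\<alpha> * s + d) \<partial>lborel)"
    and spread: "\<And>d. d \<in> \<Delta> \<Longrightarrow> prob {z \<in> space M. P z \<in> {0..<H} \<and> Q z \<in> {0..<H} \<and>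
       Q z - \<alpha> * P z \<in> \<Delta> \<and> \<bar>Q z - \<alpha> * P z - d\<bar> \<le> \<rho>} \<le> \<epsilon>1"
    and corr: "\<And>d d'. \<rho> < \<bar>d - d'\<bar> \<Longrightarrow>
      \<bar>\<integral>s. bx s * bx (\<alpha> * s + d) * bx (\<alpha> * s + d') * (f (\<alpha> * s + d) * f (\<alpha> * s + d')) \<partial>lborel\<bar> \<le> \<epsilon>2 * H"
  shows "\<bar>\<integral>z. bx (P z) * bx (Q z) * indicator \<Delta> (Q z - \<alpha> * P z) * (a (P z) * f (Q z)) \<partial>M\<bar> \<le> sqrt (\<epsilon>1 + \<epsilon>2) / \<delta>"
proof -
  have bx [measurable]: "bx \<in> borel_measurable borel" unfolding bx_def by measurable
  have bx01: "0 \<le> bx s" "bx s \<le> 1" "\<bar>bx s\<bar> \<le> 1" "bx s * bx s = bx s" for s by (auto simp: bx_def indicator_def)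
  have bx0: "bx s = 0" if "H < \<bar>s\<bar>" for s using that by (auto simp: bx_def indicator_def)
  define l where "l d = (\<integral>s. bx s * bx (\<alpha> * s + d) \<partial>lborel)" for d
  have l [measurable]: "l \<in> borel_measurable borel"
    unfolding l_def by (rule lborel.borel_measurable_lebesgue_integral) measurable
  have le1: "\<bar>x * y\<bar> \<le> 1" if "\<bar>x\<bar> \<le> 1" "\<bar>y\<bar> \<le> 1" for x y :: real
    using mult_mono[OF that] by (simp add: abs_mult)
  define d where "d z = Q z - \<alpha> * P z" for z
  have d [measurable]: "d \<in> borel_measurable M" unfolding d_def by measurable
  define C where "C = 1 / (\<delta> * H)"
  have C: "0 < C" using \<delta> H by (simp add: C_def)
  define g where "g e = indicator \<Delta> e / l e" for e
  have g [measurable]: "g \<in> borel_measurable borel" unfolding g_def by measurable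
  have gC: "0 \<le> g e" "g e \<le> C * indicator \<Delta> e" for e
  proof -
    have "0 \<le> l e" unfolding l_def using bx01 by (intro Bochner_Integration.integral_nonneg) auto
    then show "0 \<le> g e" by (simp add: g_def)
    show "g e \<le> C * indicator \<Delta> e"
      using long[of e] H \<delta> by (auto simp: g_def C_def l_def indicator_def intro!: divide_left_mono mult_pos_pos
        intro: less_le_trans[OF mult_pos_pos[OF \<delta> H]])
  qed
  have gC': "\<bar>g e\<bar> \<le> C" for e using gC[of e] C by (cases "e \<in> \<Delta>") simp_all
  have bnd: "\<bar>x * y\<bar> \<le> C" if "\<bar>x\<bar> \<le> C" "\<bar>y\<bar> \<le> 1" for x y :: real
    using mult_mono[OF that] C by (simp add: abs_mult)
  define w where "w z = bx (P z) * bx (Q z) * g (d z)" for z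
  have w [measurable]: "w \<in> borel_measurable M" unfolding w_def by measurable
  have wC: "\<bar>w z\<bar> \<le> C" for z
    unfolding w_def using bnd[OF gC'[of "d z"] le1[OF bx01(3) bx01(3)]] by (simp add: mult.commute)
  define good where "good z = indicat_real {z \<in> space M. P z \<in> {0..<H} \<and> Q z \<in> {0..<H} \<and> d z \<in> \<Delta>} z" for z :: 'a
  have good [measurable]: "good \<in> borel_measurable M" unfolding good_def by measurable
  have w_good: "0 \<le> w z" "w z \<le> C * good z" if "z \<in> space M" for z :: 'a
    using that gC[of "d z"] C by (auto simp: w_def good_def bx_def indicator_def split: if_splits)
  let ?A = "\<lambda>z \<tau>. w z * (a (P z) * f (Q z)) * (bx (P z - \<tau>) * bx (Q z - \<alpha> * \<tau>))"
  let ?B = "\<lambda>z \<tau>. w z * (bx (P z + \<tau>) * bx (Q z + \<alpha> * \<tau>) * (a (P z + \<tau>) * f (Q z + \<alpha> * \<tau>)))"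
  let ?C = "\<lambda>z s. w z * (bx s * bx (\<alpha> * s + d z) * (a s * f (\<alpha> * s + d z)))"
  let ?D = "\<lambda>z z' s. bx s * bx (\<alpha> * s + d z) * bx (\<alpha> * s + d z') * (f (\<alpha> * s + d z) * f (\<alpha> * s + d z'))"
  define E where "E = (\<integral>z. bx (P z) * bx (Q z) * indicator \<Delta> (d z) * (a (P z) * f (Q z)) \<partial>M)"
  \<comment> \<open>the integral over all \<open>\<tau>\<close> is the length of the line through the point, which cancels the denominator in \<open>w\<close>\<close>
  have "E = (\<integral>z. (\<integral>\<tau>. ?A z \<tau> \<partial>lborel) \<partial>M)"
    unfolding E_def
  proof (rule integral_cong_space)
    fix z
    have "(\<integral>\<tau>. bx (P z - \<tau>) * bx (Q z - \<alpha> * \<tau>) \<partial>lborel) = (\<integral>\<tau>. (\<lambda>s. bx s * bx (\<alpha> * s + d z)) (P z + (- 1) * \<tau>) \<partial>lborel)"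
      by (simp add: d_def algebra_simps)
    also have "\<dots> = l (d z)" by (subst lborel_integral_affine) (simp_all add: l_def)
    finally have l: "(\<integral>\<tau>. bx (P z - \<tau>) * bx (Q z - \<alpha> * \<tau>) \<partial>lborel) = l (d z)" .
    have "d z \<in> \<Delta> \<Longrightarrow> l (d z) \<noteq> 0" using long[of "d z"] mult_pos_pos[OF \<delta> H] by (simp add: l_def)
    then show "bx (P z) * bx (Q z) * indicator \<Delta> (d z) * (a (P z) * f (Q z)) =
      (\<integral>\<tau>. ?A z \<tau> \<partial>lborel)"
      by (auto simp: l w_def g_def indicator_def)
  qed
  also have "\<dots> = (\<integral>\<tau>. (\<integral>z. ?A z \<tau> \<partial>M) \<partial>lborel)"
  proof (rule fubini_bounded[where C = C and L = "2 * H"])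
    show "(\<lambda>(z, s). ?A z s) \<in> borel_measurable (M \<Otimes>\<^sub>M lborel)"
      by measurable
    show "\<bar>?A z s\<bar> \<le> C" for z s
      by (intro bnd le1 wC a f bx01)
    show "?A z s = 0" if "2 * H < \<bar>s\<bar>" for z s
      using that by (auto simp: w_def bx_def indicator_def)
  qed
  also have "\<dots> = (\<integral>\<tau>. (\<integral>z. ?B z \<tau> \<partial>M) \<partial>lborel)"
  proof (rule integral_cong_space)
    fix \<tau> :: real
    define G where "G = (\<lambda>(u, v). g (v - \<alpha> * u) * (a u * f v))"
    have [measurable]: "G \<in> borel_measurable (borel \<Otimes>\<^sub>M borel)" unfolding G_def by measurable
    have "(\<integral>z. ?A z \<tau> \<partial>M) =
      (\<integral>z. G (P z, Q z) * (bx (P z) * bx (Q z) * bx (P z - \<tau>) * bx (Q z - \<alpha> * \<tau>)) \<partial>M)"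
      by (simp add: w_def G_def d_def mult_ac)
    also have "\<dots> = (\<integral>z. G (P z + \<tau>, Q z + \<alpha> * \<tau>) * (bx (P z) * bx (Q z) * bx (P z + \<tau>) * bx (Q z + \<alpha> * \<tau>)) \<partial>M)"
      by (rule inv) measurable
    also have "\<dots> = (\<integral>z. ?B z \<tau> \<partial>M)"
      by (simp add: w_def G_def d_def algebra_simps)
    finally show "(\<integral>z. ?A z \<tau> \<partial>M) =
      (\<integral>z. ?B z \<tau> \<partial>M)" .
  qed
  also have "\<dots> = (\<integral>z. (\<integral>\<tau>. ?B z \<tau> \<partial>lborel) \<partial>M)"
  proof (rule fubini_bounded[symmetric, where C = C and L = "2 * H"])
    show "(\<lambda>(z, \<tau>). ?B z \<tau>) \<in> borel_measurable (M \<Otimes>\<^sub>M lborel)"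
      by measurable
    show "\<bar>?B z \<tau>\<bar> \<le> C" for z \<tau>
      by (intro bnd le1 wC a f bx01)
    show "?B z \<tau> = 0" if "2 * H < \<bar>\<tau>\<bar>" for z \<tau>
      using that by (auto simp: w_def bx_def indicator_def)
  qed
  also have "\<dots> = (\<integral>z. (\<integral>s. ?C z s \<partial>lborel) \<partial>M)"
  proof (rule integral_cong_space)
    fix z
    have "(\<integral>\<tau>. ?B z \<tau> \<partial>lborel) =
      (\<integral>\<tau>. (\<lambda>s. ?C z s) (P z + 1 * \<tau>) \<partial>lborel)"
      by (simp add: d_def algebra_simps)
    then show "(\<integral>\<tau>. ?B z \<tau> \<partial>lborel) =
      (\<integral>s. ?C z s \<partial>lborel)"
      by (subst (asm) lborel_integral_affine) simp_all
  qed
  also have "\<dots> = (\<integral>s. (\<integral>z. ?C z s \<partial>M) \<partial>lborel)"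
  proof (rule fubini_bounded[where C = C and L = H])
    show "(\<lambda>(z, s). ?C z s) \<in> borel_measurable (M \<Otimes>\<^sub>M lborel)"
      by measurable
    show "\<bar>?C z s\<bar> \<le> C" for z s
      by (intro bnd le1 wC a f bx01)
  qed (simp add: bx0)
  finally have E: "E = (\<integral>s. (\<integral>z. ?C z s \<partial>M) \<partial>lborel)" .
  define h where "h z s = w z * (bx s * (bx (\<alpha> * s + d z) * f (\<alpha> * s + d z)))" for z s
  have h [measurable]: "(\<lambda>(z, s). h z s) \<in> borel_measurable (M \<Otimes>\<^sub>M lborel)" unfolding h_def by measurable
  have hC: "\<bar>h z s\<bar> \<le> C" for z s unfolding h_def by (intro bnd le1 wC a f bx01)
  have h0: "h z s = 0" if "H < \<bar>s\<bar>" for z s using that by (simp add: h_def bx0)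
  have h_bx: "h z s = bx s * h z s" for z s using bx01(4)[of s] by (auto simp: h_def)
  define K where "K s = (\<integral>z. h z s \<partial>M)" for s
  have [measurable]: "(\<lambda>x. h (snd x) (fst x)) \<in> borel_measurable (borel \<Otimes>\<^sub>M M)"
    unfolding h_def by measurable
  have K [measurable]: "K \<in> borel_measurable borel"
    unfolding K_def by (rule borel_measurable_lebesgue_integral) (simp add: case_prod_beta)
  have hint: "integrable M (\<lambda>z. h z s)" for s
    using hC[of _ s] by (intro integrable_const_bound[of _ C]) auto
  have KC: "\<bar>K s\<bar> \<le> C" for s
  proof -
    have "\<bar>K s\<bar> \<le> (\<integral>z. \<bar>h z s\<bar> \<partial>M)" unfolding K_def by (rule integral_abs_bound)
    also have "\<dots> \<le> (\<integral>z. C \<partial>M)" using hint hC by (intro integral_mono) auto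
    finally show ?thesis by (simp add: prob_space)
  qed
  have K0: "K s = 0" if "H < \<bar>s\<bar>" for s using h0[OF that] by (simp add: K_def)
  have EK: "E = (\<integral>s. a s * K s \<partial>lborel)"
    unfolding E K_def by (simp add: h_def mult_ac flip: Bochner_Integration.integral_mult_right_zero)
  have bxint: "integrable lborel bx" unfolding bx_def using H by (intro integrable_real_indicator) auto
  have K2int: "integrable lborel (\<lambda>s. K s * K s)"
  proof (rule Bochner_Integration.integrable_bound)
    show "integrable lborel (\<lambda>s. C * C * indicator {-H..H} s)"
      using H by (intro integrable_mult_right integrable_real_indicator) auto
    show "AE s in lborel. norm (K s * K s) \<le> norm (C * C * indicator {-H..H} s)"
    proof (rule AE_I2)
      fix s
      have "\<bar>K s\<bar> * \<bar>K s\<bar> \<le> C * C" using KC C by (intro mult_mono) auto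
      then show "norm (K s * K s) \<le> norm (C * C * indicator {-H..H} s)"
        using K0[of s] C by (cases "H < \<bar>s\<bar>") (auto simp: abs_mult indicator_def)
    qed
  qed measurable
  have "(\<integral>s. K s * K s \<partial>lborel) = (\<integral>s. (\<integral>z. h z s * K s \<partial>M) \<partial>lborel)"
    unfolding K_def by simp
  also have "\<dots> = (\<integral>z. (\<integral>s. h z s * K s \<partial>lborel) \<partial>M)"
  proof (rule fubini_bounded[symmetric, where C = "C * C" and L = H])
    show "\<bar>h z s * K s\<bar> \<le> C * C" for z s unfolding abs_mult using hC KC C by (intro mult_mono) auto
  qed (simp_all add: h0)
  also have "\<dots> = (\<integral>z. (\<integral>s. (\<integral>z'. h z s * h z' s \<partial>M) \<partial>lborel) \<partial>M)"
    unfolding K_def by simp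
  also have "\<dots> = (\<integral>z. (\<integral>z'. (\<integral>s. h z s * h z' s \<partial>lborel) \<partial>M) \<partial>M)"
  proof (rule integral_cong_space)
    fix z assume z: "z \<in> space M"
    have [measurable]: "h z \<in> borel_measurable borel" unfolding h_def by measurable
    show "(\<integral>s. (\<integral>z'. h z s * h z' s \<partial>M) \<partial>lborel) = (\<integral>z'. (\<integral>s. h z s * h z' s \<partial>lborel) \<partial>M)"
    proof (rule fubini_bounded[symmetric, where C = "C * C" and L = H])
      show "\<bar>h z s * h z' s\<bar> \<le> C * C" for z' s unfolding abs_mult using hC C by (intro mult_mono) auto
    qed (simp_all add: h0)
  qed
  also have "\<dots> \<le> (\<integral>z. C * C * H * (\<epsilon>1 + \<epsilon>2) \<partial>M)"
  proof (rule integral_mono')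
    show "integrable M (\<lambda>z. C * C * H * (\<epsilon>1 + \<epsilon>2))" by simp
    fix z assume z: "z \<in> space M"
    show "0 \<le> C * C * H * (\<epsilon>1 + \<epsilon>2)" using C H \<epsilon> by simp
    define near where "near z' = indicat_real {z' \<in> space M. P z' \<in> {0..<H} \<and> Q z' \<in> {0..<H} \<and> d z' \<in> \<Delta> \<and> \<bar>d z' - d z\<bar> \<le> \<rho>} z'" for z' :: 'a
    have near_int: "integrable M near"
      unfolding near_def by (intro integrable_real_indicator) (auto simp: emeasure_eq_measure)
    have inner: "(\<integral>s. h z s * h z' s \<partial>lborel) \<le> C * C * H * (good z * near z' + \<epsilon>2)" if z': "z' \<in> space M" for z'
    proof -
      define I where "I = (\<integral>s. ?D z z' s \<partial>lborel)"
      have "(\<integral>s. h z s * h z' s \<partial>lborel) = (\<integral>s. (w z * w z') * (?D z z' s) \<partial>lborel)"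
      proof (rule integral_cong_space)
        fix s
        show "h z s * h z' s = (w z * w z') * (?D z z' s)"
        proof (cases "bx s = 0")
          case False
          then have "bx s = 1" using bx01(4)[of s] by simp
          then show ?thesis by (simp add: h_def mult_ac)
        qed (simp add: h_def)
      qed
      also have "\<dots> = w z * w z' * I" by (simp add: I_def)
      finally have eq: "(\<integral>s. h z s * h z' s \<partial>lborel) = w z * w z' * I" .
      have I_le: "\<bar>I\<bar> \<le> H"
      proof -
        have "\<bar>I\<bar> \<le> (\<integral>s. \<bar>?D z z' s\<bar> \<partial>lborel)"
          unfolding I_def by (rule integral_abs_bound)
        also have "\<dots> \<le> (\<integral>s. bx s \<partial>lborel)"
        proof (rule integral_mono'[OF bxint])
          fix s
          have "\<bar>bx s * (bx (\<alpha> * s + d z) * bx (\<alpha> * s + d z') * (f (\<alpha> * s + d z) * f (\<alpha> * s + d z')))\<bar> \<le> bx s * 1"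
            unfolding abs_mult[of "bx s"] using bx01 by (intro mult_mono le1 f) auto
          then show "\<bar>?D z z' s\<bar> \<le> bx s"
            by (simp add: mult.assoc)
        qed (rule bx01)
        also have "\<dots> = H" using H by (simp add: bx_def)
        finally show ?thesis .
      qed
      have "\<bar>I\<bar> \<le> \<epsilon>2 * H" if "\<rho> < \<bar>d z - d z'\<bar>" unfolding I_def using that by (rule corr)
      then have I': "\<bar>I\<bar> \<le> H * (indicator {z'. \<bar>d z' - d z\<bar> \<le> \<rho>} z' + \<epsilon>2)"
        using I_le H \<epsilon> by (cases "\<bar>d z' - d z\<bar> \<le> \<rho>") (auto simp: abs_minus_commute algebra_simps intro: order_trans)
      have "w z * w z' * I \<le> w z * w z' * \<bar>I\<bar>" using w_good z z' by (intro mult_left_mono) auto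
      also have "\<dots> \<le> (C * good z) * (C * good z') * (H * (indicator {z'. \<bar>d z' - d z\<bar> \<le> \<rho>} z' + \<epsilon>2))"
        using w_good[OF z] w_good[OF z'] I' C by (intro mult_mono) (auto simp: good_def)
      also have "\<dots> = C * C * H * (good z * near z' + good z * good z' * \<epsilon>2)"
        using z' by (auto simp: good_def near_def indicator_def algebra_simps)
      also have "\<dots> \<le> C * C * H * (good z * near z' + 1 * \<epsilon>2)"
        using C H \<epsilon> by (intro mult_left_mono add_left_mono mult_right_mono) (auto simp: good_def indicator_def)
      finally show ?thesis by (simp add: eq)
    qed
    have "(\<integral>z'. (\<integral>s. h z s * h z' s \<partial>lborel) \<partial>M) \<le> (\<integral>z'. C * C * H * (good z * near z' + \<epsilon>2) \<partial>M)"
    proof (rule integral_mono'[OF _ inner])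
      show "integrable M (\<lambda>z'. C * C * H * (good z * near z' + \<epsilon>2))" using near_int by simp
      have "0 \<le> good z * near z'" for z' by (simp add: good_def near_def)
      then show "0 \<le> C * C * H * (good z * near z' + \<epsilon>2)" for z' using C H \<epsilon> by (simp add: add_nonneg_nonneg)
    qed
    also have "\<dots> = C * C * H * (good z * (\<integral>z'. near z' \<partial>M) + \<epsilon>2)"
      using near_int by (simp add: prob_space)
    also have "\<dots> \<le> C * C * H * (\<epsilon>1 + \<epsilon>2)"
    proof (intro mult_left_mono add_right_mono)
      show "good z * (\<integral>z'. near z' \<partial>M) \<le> \<epsilon>1"
      proof (cases "d z \<in> \<Delta>")
        case True
        have "(\<integral>z'. near z' \<partial>M) = prob {z' \<in> space M. P z' \<in> {0..<H} \<and> Q z' \<in> {0..<H} \<and> d z' \<in> \<Delta> \<and> \<bar>d z' - d z\<bar> \<le> \<rho>}"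
          unfolding near_def by (simp add: Int_def conj_ac cong: conj_cong)
        also have "\<dots> \<le> \<epsilon>1" using spread[OF True] by (simp add: d_def)
        finally have "(\<integral>z'. near z' \<partial>M) \<le> \<epsilon>1" .
        then show ?thesis using \<epsilon> by (auto simp: good_def indicator_def)
      next
        case False
        then show ?thesis using \<epsilon> by (simp add: good_def)
      qed
    qed (use C H in simp)
    finally show "(\<integral>z'. (\<integral>s. h z s * h z' s \<partial>lborel) \<partial>M) \<le> C * C * H * (\<epsilon>1 + \<epsilon>2)" .
  qed
  also have "\<dots> = C * C * H * (\<epsilon>1 + \<epsilon>2)" by (simp add: prob_space)
  finally have K2: "(\<integral>s. K s * K s \<partial>lborel) \<le> C * C * H * (\<epsilon>1 + \<epsilon>2)" .
  define \<kappa> where "\<kappa> = sqrt (\<epsilon>1 + \<epsilon>2) / \<delta>"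
  have \<kappa>: "0 < \<kappa>" "\<kappa>\<^sup>2 = (\<epsilon>1 + \<epsilon>2) / \<delta>\<^sup>2"
    using \<epsilon> \<delta> by (simp_all add: \<kappa>_def power_divide)
  \<comment> \<open>Cauchy-Schwarz in the form \<open>2 x y \<le> x\<^sup>2 + y\<^sup>2\<close>, with the weights that balance both terms\<close>
  have "\<bar>E\<bar> \<le> (\<integral>s. \<bar>a s * K s\<bar> \<partial>lborel)" unfolding EK by (rule integral_abs_bound)
  also have "\<dots> \<le> (\<integral>s. \<kappa> / (2 * H) * bx s + H / (2 * \<kappa>) * (K s * K s) \<partial>lborel)"
  proof (rule integral_mono')
    show "integrable lborel (\<lambda>s. \<kappa> / (2 * H) * bx s + H / (2 * \<kappa>) * (K s * K s))"
      by (intro Bochner_Integration.integrable_add integrable_mult_right bxint K2int)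
    fix s
    show "0 \<le> \<kappa> / (2 * H) * bx s + H / (2 * \<kappa>) * (K s * K s)" using \<kappa> H bx01 by simp
    have Kbx: "K s = bx s * K s" unfolding K_def by (subst h_bx) simp
    have "\<bar>a s * K s\<bar> \<le> 1 * \<bar>K s\<bar>" unfolding abs_mult using a by (intro mult_right_mono) auto
    also have "\<dots> \<le> \<kappa> / (2 * H) * bx s + H / (2 * \<kappa>) * (K s * K s)"
    proof (cases "bx s = 1")
      case True
      have "2 * (\<kappa> / H) * \<bar>K s\<bar> \<le> (\<kappa> / H)\<^sup>2 + \<bar>K s\<bar>\<^sup>2" by (rule sum_squares_bound)
      also have "\<bar>K s\<bar>\<^sup>2 = K s * K s" by (simp add: power2_eq_square)
      finally have "2 * (\<kappa> / H) * \<bar>K s\<bar> \<le> (\<kappa> / H)\<^sup>2 + K s * K s" .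
      then have "H / (2 * \<kappa>) * (2 * (\<kappa> / H) * \<bar>K s\<bar>) \<le> H / (2 * \<kappa>) * ((\<kappa> / H)\<^sup>2 + K s * K s)"
        using \<kappa> H by (intro mult_left_mono) auto
      moreover have "H / (2 * \<kappa>) * (2 * (\<kappa> / H) * \<bar>K s\<bar>) = \<bar>K s\<bar>" using \<kappa>(1) H by simp
      moreover have "H / (2 * \<kappa>) * ((\<kappa> / H)\<^sup>2 + K s * K s) = \<kappa> / (2 * H) + H / (2 * \<kappa>) * (K s * K s)"
        using \<kappa>(1) H by (simp add: distrib_left power2_eq_square)
      ultimately show ?thesis using True by simp
    next
      case False
      then have "bx s = 0" by (auto simp: bx_def indicator_def split: if_splits)
      then show ?thesis using Kbx by simp
    qed
    finally show "\<bar>a s * K s\<bar> \<le> \<kappa> / (2 * H) * bx s + H / (2 * \<kappa>) * (K s * K s)" .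
  qed
  also have "\<dots> = \<kappa> / (2 * H) * (\<integral>s. bx s \<partial>lborel) + H / (2 * \<kappa>) * (\<integral>s. K s * K s \<partial>lborel)"
    using bxint K2int by simp
  also have "(\<integral>s. bx s \<partial>lborel) = H" using H by (simp add: bx_def)
  also have "\<kappa> / (2 * H) * H + H / (2 * \<kappa>) * (\<integral>s. K s * K s \<partial>lborel) \<le> \<kappa> / 2 + H / (2 * \<kappa>) * (C * C * H * (\<epsilon>1 + \<epsilon>2))"
    using K2 \<kappa> H by (intro add_mono mult_left_mono) auto
  also have "H / (2 * \<kappa>) * (C * C * H * (\<epsilon>1 + \<epsilon>2)) = \<kappa>\<^sup>2 / (2 * \<kappa>)"
  proof -
    have "H / (2 * \<kappa>) * (C * C * H * e) = e / \<delta>\<^sup>2 / (2 * \<kappa>)" for e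
      unfolding C_def using H \<delta> by (simp add: power2_eq_square)
    then show ?thesis unfolding \<kappa>(2) .
  qed
  also have "\<kappa> / 2 + \<kappa>\<^sup>2 / (2 * \<kappa>) = \<kappa>" using \<kappa>(1) by (simp add: power2_eq_square)
  finally show ?thesis by (simp add: E_def d_def \<kappa>_def)
qed

end

section \<open>Correlations along lines\<close>

context rank_one_mixing_flow
begin

lemma integral_height:
  fixes g :: "real \<Rightarrow> real"
  assumes [measurable]: "g \<in> borel_measurable borel"
  shows "(\<integral>x. indicator (tower j) x * g (p j x) \<partial>M) =
    prob (tower j) / H j * (\<integral>u. box j u * g u \<partial>lborel)"
proof -
  define c where "c = prob (tower j) / H j"
  have c: "0 \<le> c" using H_pos[of j] by (simp add: c_def less_imp_le)
  let ?M1 = "distr (density M (\<lambda>x. ennreal (indicator (tower j) x))) borel (p j)"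
  let ?M2 = "density lborel (\<lambda>u. ennreal (c * box j u))"
  have eq: "?M1 = ?M2"
  proof (rule measure_eqI)
    fix A assume "A \<in> sets ?M1"
    then have A [measurable]: "A \<in> sets borel" by simp
    have "emeasure ?M1 A = emeasure (density M (\<lambda>x. ennreal (indicator (tower j) x))) (p j -` A \<inter> space M)"
      by (subst emeasure_distr) auto
    also have "\<dots> = (\<integral>\<^sup>+x. ennreal (indicator (tower j) x) * indicator (p j -` A \<inter> space M) x \<partial>M)"
      by (intro emeasure_density) auto
    also have "\<dots> = (\<integral>\<^sup>+x. indicator (floors (p j) (A \<inter> {0..<H j})) x \<partial>M)"
      by (intro nn_integral_cong) (auto simp: indicator_def tower_def)
    also have "\<dots> = emeasure M (floors (p j) (A \<inter> {0..<H j}))"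
      by (intro nn_integral_indicator) measurable
    also have "\<dots> = ennreal (c * measure lborel (A \<inter> {0..<H j}))"
      using height_fun_prob[OF height[of j], of "A \<inter> {0..<H j}"] by (simp add: emeasure_eq_measure c_def tower_def)
    also have "\<dots> = ennreal c * emeasure lborel (A \<inter> {0..<H j})"
    proof -
      have "emeasure lborel (A \<inter> {0..<H j}) \<le> emeasure lborel {0..<H j}" by (intro emeasure_mono) auto
      also have "\<dots> < top" by (simp add: less_imp_le)
      finally show ?thesis using c by (simp add: emeasure_eq_ennreal_measure ennreal_mult)
    qed
    also have "\<dots> = (\<integral>\<^sup>+u. ennreal c * indicator (A \<inter> {0..<H j}) u \<partial>lborel)"
      by (simp add: nn_integral_cmult)
    also have "\<dots> = (\<integral>\<^sup>+u. ennreal (c * box j u) * indicator A u \<partial>lborel)"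
      by (intro nn_integral_cong) (auto simp: indicator_def)
    also have "\<dots> = emeasure ?M2 A" by (intro emeasure_density[symmetric]) auto
    finally show "emeasure ?M1 A = emeasure ?M2 A" .
  qed simp
  have "(\<integral>x. indicator (tower j) x * g (p j x) \<partial>M) = (\<integral>u. g u \<partial>?M1)"
    by (subst integral_distr, measurable, subst integral_density) auto
  also have "\<dots> = (\<integral>u. c * box j u * g u \<partial>lborel)"
    unfolding eq using c by (subst integral_density) auto
  also have "\<dots> = c * (\<integral>u. box j u * g u \<partial>lborel)" by (simp add: mult.assoc)
  finally show ?thesis by (simp add: c_def)
qed

text \<open>
  This transports \<open>interval_correlations_small\<close> from the space to heights. The substitution \<open>w = \<alpha> * s + d\<close> turns the two
  lines into the heights \<open>w\<close> and \<open>w + e\<close>, where \<open>e = d' - d\<close>, and the three indicators into an interval of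
  heights \<open>w\<close>, on which \<open>p j\<close> takes the value \<open>w + e\<close> after time \<open>e\<close>.
\<close>

lemma line_correlations_small:
  assumes B [measurable]: "B \<in> sets M" and \<epsilon>: "0 < \<epsilon>" and \<alpha>: "1 \<le> \<alpha>"
    and S [measurable]: "\<And>j. S j \<in> sets borel" and "\<And>j. S j \<subseteq> {0..<H j}"
    and lim: "(\<lambda>j. prob (sym_diff B (floors (p j) (S j)))) \<longlonglongrightarrow> 0"
  defines "f \<equiv> \<lambda>j s. indicator (S j) s - prob B"
  shows "\<exists>\<rho>. \<forall>\<^sub>F j in sequentially. \<forall>d d'. \<rho> < \<bar>d - d'\<bar> \<longrightarrow>
    \<bar>\<integral>s. box j s * box j (\<alpha> * s + d) * box j (\<alpha> * s + d') *
       (f j (\<alpha> * s + d) * f j (\<alpha> * s + d')) \<partial>lborel\<bar> \<le> \<epsilon> * H j"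
proof -
  have [measurable]: "f j \<in> borel_measurable borel" for j unfolding f_def by measurable
  have f1: "\<bar>f j s\<bar> \<le> 1" for j s
    using prob_le_1[of B] measure_nonneg[of M B] by (auto simp: f_def indicator_def)
  define D where "D j = sym_diff B (floors (p j) (S j))" for j
  have [measurable]: "D j \<in> sets M" for j unfolding D_def by measurable
  obtain \<rho> where \<rho>: "\<forall>\<^sub>F j in sequentially. \<forall>e u v. \<rho> \<le> \<bar>e\<bar> \<longrightarrow>
    \<bar>\<integral>x. indicator {x \<in> tower j. u \<le> p j x \<and> p j x < v} x * (centered B x * centered B (T e x)) \<partial>M\<bar> \<le> \<epsilon> / 4"
    using interval_correlations_small[OF B, of "\<epsilon> / 4"] \<epsilon> by auto
  have "eventually (\<lambda>j. prob (D j) < \<epsilon> / 8) sequentially"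
    using lim \<epsilon> unfolding D_def by (intro order_tendstoD(2)[OF lim]) auto
  moreover have "eventually (\<lambda>j. 1 / 2 < prob (tower j)) sequentially"
    by (intro order_tendstoD(1)[OF prob_tower]) auto
  ultimately have "\<forall>\<^sub>F j in sequentially. \<forall>d d'. \<rho> < \<bar>d - d'\<bar> \<longrightarrow>
    \<bar>\<integral>s. box j s * box j (\<alpha> * s + d) * box j (\<alpha> * s + d') *
       (f j (\<alpha> * s + d) * f j (\<alpha> * s + d')) \<partial>lborel\<bar> \<le> \<epsilon> * H j"
    using \<rho>
  proof (eventually_elim, intro allI impI)
    fix j d d' assume Dj: "prob (D j) < \<epsilon> / 8" and tj: "1 / 2 < prob (tower j)"
      and cor: "\<forall>e u v. \<rho> \<le> \<bar>e\<bar> \<longrightarrow>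
        \<bar>\<integral>x. indicator {x \<in> tower j. u \<le> p j x \<and> p j x < v} x * (centered B x * centered B (T e x)) \<partial>M\<bar> \<le> \<epsilon> / 4"
      and dd: "\<rho> < \<bar>d - d'\<bar>"
    define e where "e = d' - d"
    have e: "\<rho> \<le> \<bar>e\<bar>" using dd by (simp add: e_def)
    define u v where "u = max d (- e)" and "v = min (\<alpha> * H j + d) (H j - e)"
    define I where "I = (\<integral>s. box j s * box j (\<alpha> * s + d) * box j (\<alpha> * s + d') *
       (f j (\<alpha> * s + d) * f j (\<alpha> * s + d')) \<partial>lborel)"
    define V where "V = {x \<in> tower j. u \<le> p j x \<and> p j x < v}"
    have V [measurable]: "V \<in> sets M" unfolding V_def by measurable
    define g where "g w = indicator {u..<v} w * (f j w * f j (w + e))" for w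
    have g [measurable]: "g \<in> borel_measurable borel" unfolding g_def by measurable
    have "I = (\<integral>s. (\<lambda>w. box j w * g w) (d + \<alpha> * s) \<partial>lborel)"
      unfolding I_def
    proof (rule integral_cong_space)
      fix s
      have s: "s \<in> {0..<H j} \<longleftrightarrow> d \<le> \<alpha> * s + d \<and> \<alpha> * s + d < \<alpha> * H j + d" using \<alpha> by (auto simp: zero_le_mult_iff)
      have "\<alpha> * s + d' = (\<alpha> * s + d) + e" by (simp add: e_def)
      then show "box j s * box j (\<alpha> * s + d) * box j (\<alpha> * s + d') *
       (f j (\<alpha> * s + d) * f j (\<alpha> * s + d')) = (\<lambda>w. box j w * g w) (d + \<alpha> * s)"
        unfolding g_def using s by (auto simp: indicator_def u_def v_def add_ac)
    qed
    also have "\<dots> = (\<integral>w. box j w * g w \<partial>lborel) / \<bar>\<alpha>\<bar>"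
      by (rule lborel_integral_affine) (use \<alpha> in auto)
    finally have I: "\<alpha> * I = (\<integral>w. box j w * g w \<partial>lborel)" using \<alpha> by simp
    have "(\<integral>x. indicator (tower j) x * g (p j x) \<partial>M) = (\<integral>x. indicator V x * (f j (p j x) * f j (p j (T e x))) \<partial>M)"
    proof (rule integral_cong_space)
      fix x assume x: "x \<in> space M"
      have "p j (T e x) = p j x + e" if "x \<in> V"
        using that x by (intro p_shift) (auto simp: V_def tower_def u_def v_def)
      then show "indicator (tower j) x * g (p j x) = indicator V x * (f j (p j x) * f j (p j (T e x)))"
        by (auto simp: V_def g_def indicator_def)
    qed
    then have I': "\<alpha> * I * (prob (tower j) / H j) = (\<integral>x. indicator V x * (f j (p j x) * f j (p j (T e x))) \<partial>M)"
      unfolding I using integral_height[OF g, of j] by (simp add: mult.commute)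
    have diff: "\<bar>f j (p j x) - centered B x\<bar> \<le> indicator (D j) x" if "x \<in> space M" for x
      using that by (auto simp: f_def centered_def D_def indicator_def)
    have int: "integrable M (\<lambda>x. indicator V x * (f j (p j x) * f j (p j (T e x))))"
      "integrable M (\<lambda>x. indicator V x * (centered B x * centered B (T e x)))"
      using mult_mono[OF f1 f1, of j _ j] centered_prod_le_1[of B]
      by (auto intro!: integrable_const_bound[of _ 1] simp: abs_mult indicator_def)
    have intD: "integrable M (indicat_real (D j))" "integrable M (\<lambda>x. indicat_real (D j) (T e x))"
      by (auto intro!: integrable_const_bound[of _ 1] simp: indicator_def)
    have "\<bar>(\<integral>x. indicator V x * (f j (p j x) * f j (p j (T e x))) \<partial>M) - (\<integral>x. indicator V x * (centered B x * centered B (T e x)) \<partial>M)\<bar>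
      = \<bar>\<integral>x. indicator V x * (f j (p j x) * f j (p j (T e x))) - indicator V x * (centered B x * centered B (T e x)) \<partial>M\<bar>"
      using int by simp
    also have "\<dots> \<le> (\<integral>x. \<bar>indicator V x * (f j (p j x) * f j (p j (T e x))) - indicator V x * (centered B x * centered B (T e x))\<bar> \<partial>M)"
      by (rule integral_abs_bound)
    also have "\<dots> \<le> (\<integral>x. indicator (D j) x + indicator (D j) (T e x) \<partial>M)"
    proof (rule integral_mono)
      fix x assume x: "x \<in> space M"
      define a b a' b' where ab: "a = f j (p j x)" "b = f j (p j (T e x))" "a' = centered B x" "b' = centered B (T e x)"
      have "\<bar>a - a'\<bar> \<le> indicator (D j) x" "\<bar>b - b'\<bar> \<le> indicator (D j) (T e x)"
        unfolding ab using diff x by auto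
      moreover have "\<bar>a * b - a' * b'\<bar> \<le> \<bar>a - a'\<bar> + \<bar>b - b'\<bar>"
      proof -
        have "a * b - a' * b' = (a - a') * b + a' * (b - b')" by (simp add: algebra_simps)
        also have "\<bar>\<dots>\<bar> \<le> \<bar>a - a'\<bar> * \<bar>b\<bar> + \<bar>a'\<bar> * \<bar>b - b'\<bar>" unfolding abs_mult[symmetric] by (rule abs_triangle_ineq)
        also have "\<dots> \<le> \<bar>a - a'\<bar> * 1 + 1 * \<bar>b - b'\<bar>"
          unfolding ab using f1 centered_le_1 by (intro add_mono mult_left_mono mult_right_mono) auto
        finally show ?thesis by simp
      qed
      ultimately have "\<bar>a * b - a' * b'\<bar> \<le> indicator (D j) x + indicator (D j) (T e x)" by linarith
      then show "\<bar>indicator V x * (f j (p j x) * f j (p j (T e x))) - indicator V x * (centered B x * centered B (T e x))\<bar>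
          \<le> indicator (D j) x + indicator (D j) (T e x)"
        unfolding ab by (auto simp: indicator_def)
    qed (use int intD in auto)
    also have "\<dots> = prob (D j) + prob (D j)"
      using intD integral_T[OF borel_measurable_integrable[OF intD(1)], of e] sets.sets_into_space[of "D j" M] by (simp add: Int_absorb2)
    finally have "\<bar>\<alpha> * I * (prob (tower j) / H j)\<bar> \<le> \<epsilon> / 4 + 2 * prob (D j)"
      unfolding I' using cor[rule_format, OF e, of u v] by (simp add: V_def)
    then have 1: "\<alpha> * \<bar>I\<bar> * (prob (tower j) / H j) \<le> \<epsilon> / 2"
      using Dj \<alpha> H_pos[of j] by (simp add: abs_mult)
    have "\<bar>I\<bar> * ((1 / 2) / H j) \<le> (\<alpha> * \<bar>I\<bar>) * (prob (tower j) / H j)"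
      using \<alpha> tj H_pos[of j] by (intro mult_mono divide_right_mono) (auto simp: less_imp_le intro!: mult_right_mono[of 1 \<alpha> "\<bar>I\<bar>", simplified])
    with 1 have "\<bar>I\<bar> * ((1 / 2) / H j) \<le> \<epsilon> / 2" by linarith
    then show "\<bar>\<integral>s. box j s * box j (\<alpha> * s + d) * box j (\<alpha> * s + d') *
       (f j (\<alpha> * s + d) * f j (\<alpha> * s + d')) \<partial>lborel\<bar> \<le> \<epsilon> * H j"
      using H_pos[of j] unfolding I_def[symmetric] by (simp add: field_simps)
  qed
  then show ?thesis by blast
qed

end

section \<open>Joinings with the rescaled flow\<close>

locale scaled_joining = rank_one_mixing_flow +
  fixes \<alpha> :: real and \<nu>
  assumes \<alpha>: "1 < \<alpha>" and joining: "joining M T (\<lambda>t. T (\<alpha> * t)) \<nu>"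
begin

lemma sets_\<nu> [measurable_cong]: "sets \<nu> = sets (M \<Otimes>\<^sub>M M)"
  and distr_\<nu>: "distr \<nu> (M \<Otimes>\<^sub>M M) (map_prod (T t) (T (\<alpha> * t))) = \<nu>"
  and emeasure_\<nu>_fst: "A \<in> sets M \<Longrightarrow> emeasure \<nu> (A \<times> space M) = emeasure M A"
  and emeasure_\<nu>_snd: "A \<in> sets M \<Longrightarrow> emeasure \<nu> (space M \<times> A) = emeasure M A"
  using joining unfolding joining_def by auto

lemma space_\<nu>: "space \<nu> = space M \<times> space M"
  using sets_eq_imp_space_eq[OF sets_\<nu>] by (simp add: space_pair_measure)

sublocale N: prob_space \<nu>
  by standard (simp add: space_\<nu> emeasure_\<nu>_fst emeasure_space_1)

lemma fst_\<nu> [measurable]: "fst \<in> \<nu> \<rightarrow>\<^sub>M M" and snd_\<nu> [measurable]: "snd \<in> \<nu> \<rightarrow>\<^sub>M M"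
  by measurable

abbreviation on_fst :: "'a set \<Rightarrow> ('a \<times> 'a) set" where
  "on_fst A \<equiv> {z \<in> space \<nu>. fst z \<in> A}"

abbreviation on_snd :: "'a set \<Rightarrow> ('a \<times> 'a) set" where
  "on_snd A \<equiv> {z \<in> space \<nu>. snd z \<in> A}"

lemma measure_\<nu>_fst: "A \<in> sets M \<Longrightarrow> N.prob (on_fst A) = prob A"
  and measure_\<nu>_snd: "A \<in> sets M \<Longrightarrow> N.prob (on_snd A) = prob A"
proof -
  assume A: "A \<in> sets M"
  have "on_fst A = A \<times> space M" "on_snd A = space M \<times> A"
    using sets.sets_into_space[OF A] by (auto simp: space_\<nu>)
  then show "N.prob (on_fst A) = prob A" "N.prob (on_snd A) = prob A"
    using emeasure_\<nu>_fst[OF A] emeasure_\<nu>_snd[OF A] by (simp_all add: measure_def)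
qed

lemma distr_\<nu>_fst: "distr \<nu> M fst = M"
proof (rule measure_eqI)
  fix A assume "A \<in> sets (distr \<nu> M fst)"
  then have A: "A \<in> sets M" by simp
  then have "emeasure (distr \<nu> M fst) A = emeasure \<nu> (fst -` A \<inter> space \<nu>)" by (subst emeasure_distr) auto
  also have "fst -` A \<inter> space \<nu> = on_fst A" by auto
  also have "emeasure \<nu> (on_fst A) = emeasure M A"
    using measure_\<nu>_fst[OF A] by (simp add: N.emeasure_eq_measure emeasure_eq_measure)
  finally show "emeasure (distr \<nu> M fst) A = emeasure M A" .
qed simp

lemma integral_\<nu>_fst:
  fixes f :: "'a \<Rightarrow> real"
  assumes "f \<in> borel_measurable M"
  shows "(\<integral>z. f (fst z) \<partial>\<nu>) = (\<integral>x. f x \<partial>M)"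
  using integral_distr[OF fst_\<nu> assms] by (simp add: distr_\<nu>_fst)

definition TT :: "real \<Rightarrow> 'a \<times> 'a \<Rightarrow> 'a \<times> 'a" where
  "TT t = map_prod (T t) (T (\<alpha> * t))"

lemma TT_simps [simp]: "fst (TT t z) = T t (fst z)" "snd (TT t z) = T (\<alpha> * t) (snd z)"
  by (simp_all add: TT_def)

lemma TT_measurable [measurable]: "TT t \<in> \<nu> \<rightarrow>\<^sub>M \<nu>"
proof -
  have "(\<lambda>z. (T t (fst z), T (\<alpha> * t) (snd z))) \<in> \<nu> \<rightarrow>\<^sub>M M \<Otimes>\<^sub>M M" by measurable
  also have "(\<lambda>z. (T t (fst z), T (\<alpha> * t) (snd z))) = TT t" by (auto simp: TT_def map_prod_def)
  finally show ?thesis by (simp add: measurable_cong_sets[OF refl sets_\<nu>])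
qed

lemma TT_distr: "distr \<nu> \<nu> (TT t) = \<nu>"
  using distr_\<nu>[of t] distr_cong[OF refl sets_\<nu>, of \<nu> "TT t" "TT t"] by (simp add: TT_def)

lemma space_\<nu>_D: "z \<in> space \<nu> \<Longrightarrow> fst z \<in> space M" "z \<in> space \<nu> \<Longrightarrow> snd z \<in> space M"
  by (auto simp: space_\<nu>)

lemma prob_vimage_TT:
  assumes "V \<in> sets \<nu>"
  shows "N.prob {z \<in> space \<nu>. TT t z \<in> V} = N.prob V"
proof -
  have "N.prob V = measure (distr \<nu> \<nu> (TT t)) V" by (simp add: TT_distr)
  also have "\<dots> = N.prob (TT t -` V \<inter> space \<nu>)" using assms by (intro measure_distr) auto
  also have "TT t -` V \<inter> space \<nu> = {z \<in> space \<nu>. TT t z \<in> V}" by auto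
  finally show ?thesis by simp
qed

text \<open>
  A pair moves from one point of the square to another along the line of slope \<open>\<alpha>\<close> without leaving it
  if and only if it moves back in this way, so the invariance of \<open>\<nu>\<close> gives the invariance of the distribution of
  heights.
\<close>

lemma height_invariance:
  fixes bx :: "real \<Rightarrow> real" and j :: nat
  assumes [measurable]: "G \<in> borel_measurable (borel \<Otimes>\<^sub>M borel)"
  defines "bx \<equiv> indicator {0..<H j}"
  shows "(\<integral>z. G (p j (fst z), p j (snd z)) * (bx (p j (fst z)) * bx (p j (snd z)) * bx (p j (fst z) - \<tau>) * bx (p j (snd z) - \<alpha> * \<tau>)) \<partial>\<nu>) =
      (\<integral>z. G (p j (fst z) + \<tau>, p j (snd z) + \<alpha> * \<tau>) *
        (bx (p j (fst z)) * bx (p j (snd z)) * bx (p j (fst z) + \<tau>) * bx (p j (snd z) + \<alpha> * \<tau>)) \<partial>\<nu>)" (is "(\<integral>z. ?F z \<partial>\<nu>) = (\<integral>z. ?K z \<partial>\<nu>)")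
proof -
  have [measurable]: "bx \<in> borel_measurable borel" unfolding bx_def by measurable
  have "(\<integral>z. ?F z \<partial>\<nu>) = (\<integral>z. ?F z \<partial>distr \<nu> \<nu> (TT \<tau>))" by (simp add: TT_distr)
  also have "\<dots> = (\<integral>z. ?F (TT \<tau> z) \<partial>\<nu>)" by (rule integral_distr) measurable
  also have "\<dots> = (\<integral>z. ?K z \<partial>\<nu>)"
  proof (rule integral_cong_space)
    fix z assume z: "z \<in> space \<nu>"
    define x y where "x = fst z" and "y = snd z"
    have xy: "x \<in> space M" "y \<in> space M" using space_\<nu>_D[OF z] by (auto simp: x_def y_def)
    let ?I = "{0..<H j}"
    have val: "p j (T t w) = p j w + t" if "w \<in> space M" "p j w \<in> ?I" "p j w + t \<in> ?I" for w t
      using that by (intro p_shift) auto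
    have key: "p j w \<in> ?I \<and> p j w + t \<in> ?I \<longleftrightarrow> p j (T t w) \<in> ?I \<and> p j (T t w) - t \<in> ?I" if "w \<in> space M" for w t
    proof
      assume "p j w \<in> ?I \<and> p j w + t \<in> ?I"
      with val[OF that, of t] show "p j (T t w) \<in> ?I \<and> p j (T t w) - t \<in> ?I" by simp
    next
      assume A: "p j (T t w) \<in> ?I \<and> p j (T t w) - t \<in> ?I"
      have "p j (T (- t) (T t w)) = p j (T t w) - t" using A that val[of "T t w" "- t"] by simp
      then have "p j w = p j (T t w) - t" by (simp only: T_minus[OF that])
      with A show "p j w \<in> ?I \<and> p j w + t \<in> ?I" by simp
    qed
    show "?F (TT \<tau> z) = ?K z"
    proof (cases "p j x \<in> ?I \<and> p j x + \<tau> \<in> ?I \<and> p j y \<in> ?I \<and> p j y + \<alpha> * \<tau> \<in> ?I")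
      case True
      then show ?thesis using val[OF xy(1), of \<tau>] val[OF xy(2), of "\<alpha> * \<tau>"] by (simp add: x_def y_def)
    next
      case False
      then have "?K z = 0" by (auto simp: bx_def x_def y_def indicator_def)
      moreover have "\<not> (p j (T \<tau> x) \<in> ?I \<and> p j (T \<tau> x) - \<tau> \<in> ?I \<and> p j (T (\<alpha> * \<tau>) y) \<in> ?I \<and> p j (T (\<alpha> * \<tau>) y) - \<alpha> * \<tau> \<in> ?I)"
        using False key[OF xy(1), of \<tau>] key[OF xy(2), of "\<alpha> * \<tau>"] by blast
      then have "?F (TT \<tau> z) = 0" by (auto simp: bx_def x_def y_def indicator_def)
      ultimately show ?thesis by (simp only:)
    qed
  qed
  finally show ?thesis .
qed

definition offset :: "nat \<Rightarrow> 'a \<times> 'a \<Rightarrow> real" where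
  "offset j z = p j (snd z) - \<alpha> * p j (fst z)"

lemma offset_measurable [measurable]: "offset j \<in> borel_measurable \<nu>" unfolding offset_def by measurable

definition square :: "nat \<Rightarrow> ('a \<times> 'a) set" where
  "square j = {z \<in> space \<nu>. fst z \<in> tower j \<and> snd z \<in> tower j}"

lemma square_measurable [measurable]: "square j \<in> sets \<nu>" unfolding square_def by measurable

definition strip :: "nat \<Rightarrow> real \<Rightarrow> int \<Rightarrow> ('a \<times> 'a) set" where
  "strip j \<rho> k = {z \<in> square j. \<lfloor>offset j z / \<rho>\<rfloor> = k}"

lemma strip_measurable [measurable]: "strip j \<rho> k \<in> sets \<nu>" unfolding strip_def by measurable

text \<open>
  The offsets are cut into strips of width \<open>\<rho>\<close>; the heavy ones have mass at least \<open>\<epsilon>\<close>, so there are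
  boundedly many of them.
\<close>

definition heavy :: "nat \<Rightarrow> real \<Rightarrow> real \<Rightarrow> int set" where
  "heavy j \<rho> \<epsilon> = {k. \<epsilon> \<le> N.prob (strip j \<rho> k)}"

lemma card_heavy:
  assumes "0 < \<epsilon>"
  shows "finite (heavy j \<rho> \<epsilon>) \<and> card (heavy j \<rho> \<epsilon>) \<le> nat \<lceil>1 / \<epsilon>\<rceil>"
proof (rule finite_if_finite_subsets_card_bdd)
  fix F assume F: "F \<subseteq> heavy j \<rho> \<epsilon>" "finite F"
  have "card F * \<epsilon> = (\<Sum>k\<in>F. \<epsilon>)" by simp
  also have "\<dots> \<le> (\<Sum>k\<in>F. N.prob (strip j \<rho> k))" using F by (intro sum_mono) (auto simp: heavy_def)
  also have "\<dots> = N.prob (\<Union>k\<in>F. strip j \<rho> k)"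
    using F(2) by (intro N.finite_measure_finite_Union[symmetric]) (auto simp: disjoint_family_on_def strip_def)
  also have "\<dots> \<le> 1" by simp
  finally have "card F \<le> 1 / \<epsilon>" using assms by (simp add: field_simps)
  then show "card F \<le> nat \<lceil>1 / \<epsilon>\<rceil>" by linarith
qed

definition light :: "nat \<Rightarrow> real \<Rightarrow> real \<Rightarrow> ('a \<times> 'a) set" where
  "light j \<rho> \<epsilon> = {z \<in> square j. \<lfloor>offset j z / \<rho>\<rfloor> \<notin> heavy j \<rho> \<epsilon>}"

lemma light_measurable [measurable]: "light j \<rho> \<epsilon> \<in> sets \<nu>" unfolding light_def by measurable

text \<open>
  Let \<open>t = H j / \<alpha>\<close>. If a pair \<open>z\<close> and its image at time \<open>t\<close> are both in heavy strips, and the first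
  coordinate has not left the tower meanwhile, then the gain of height of the second coordinate \<open>y\<close> during the
  time \<open>\<alpha> * t = H j\<close> is determined by the two strips up to \<open>\<rho>\<close>. For each of the boundedly many pairs of heavy strips this has
  small probability by \<open>return_offsets_spread\<close>, unless the gain is close to \<open>H j\<close>, which is only possible for \<open>y\<close> near
  the bottom of the tower. So, up to small probability, \<open>z\<close> or its image is in a light strip whenever
  the first coordinate stays, which happens with probability about \<open>1 - 1 / \<alpha>\<close>.
\<close>

lemma light_mass:
  assumes \<rho>: "0 < \<rho>" and \<epsilon>: "0 < \<epsilon>" and \<eta>: "0 < \<eta>"
  shows "\<forall>\<^sub>F j in sequentially. (1 - 1 / \<alpha>) - \<eta> \<le> 2 * N.prob (light j \<rho> \<epsilon>)"
proof -
  define K where "K = nat \<lceil>1 / \<epsilon>\<rceil>"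
  define \<epsilon>' where "\<epsilon>' = \<eta> / (2 * ((real K)\<^sup>2 + 1))"
  have \<epsilon>': "0 < \<epsilon>'" unfolding \<epsilon>'_def using \<eta> by (intro divide_pos_pos mult_pos_pos add_nonneg_pos) auto
  have K\<epsilon>': "(real K)\<^sup>2 * \<epsilon>' \<le> \<eta> / 2"
  proof -
    have "(real K)\<^sup>2 * \<epsilon>' \<le> ((real K)\<^sup>2 + 1) * \<epsilon>'" using \<epsilon>' by (intro mult_right_mono) auto
    also have "\<dots> = \<eta> / 2"
    proof -
      have "(real K)\<^sup>2 + 1 \<noteq> 0" by (metis add_nonneg_pos less_irrefl zero_le_power2 zero_less_one)
      moreover have "X * (\<eta> / (2 * X)) = \<eta> / 2" if "X \<noteq> 0" for X :: real using that by simp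
      ultimately show ?thesis unfolding \<epsilon>'_def by blast
    qed
    finally show ?thesis .
  qed
  obtain \<rho>1 where \<rho>1: "\<forall>\<^sub>F j in sequentially. \<forall>e. \<rho>1 \<le> \<bar>e\<bar> \<longrightarrow> (\<exists>B. B \<in> sets M \<and> prob B \<le> \<epsilon>' \<and>
    return_set j \<rho> e \<subseteq> B)"
    using return_offsets_spread[OF \<rho> \<epsilon>'] by blast
  define C where "C = \<bar>\<rho>1\<bar> + \<rho>"
  have C: "0 < C" using \<rho> by (simp add: C_def)
  have "(\<lambda>j. C / H j) \<longlonglongrightarrow> 0"
    by (intro tendsto_divide_0[OF tendsto_const] filterlim_at_top_imp_at_infinity heights_tend_to_infinity)
  then have "(\<lambda>j. 3 * prob (space M - tower j) + C / H j) \<longlonglongrightarrow> 3 * 0 + 0"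
    by (intro tendsto_intros prob_not_tower)
  then have "eventually (\<lambda>j. 3 * prob (space M - tower j) + C / H j < \<eta> / 2) sequentially"
    using \<eta> by (intro order_tendstoD(2)) auto
  with \<rho>1 show ?thesis
  proof eventually_elim
    case (elim j)
    define U where "U = heavy j \<rho> \<epsilon>"
    have U: "finite U" "card U \<le> K" using card_heavy[OF \<epsilon>, of j \<rho>] by (auto simp: U_def K_def)
    have "\<forall>e. \<exists>B. B \<in> sets M \<and> (\<rho>1 \<le> \<bar>e\<bar> \<longrightarrow> prob B \<le> \<epsilon>' \<and>
      return_set j \<rho> e \<subseteq> B)"
      using elim(1) by (metis sets.empty_sets)
    then obtain B where "\<forall>e. B e \<in> sets M \<and> (\<rho>1 \<le> \<bar>e\<bar> \<longrightarrow> prob (B e) \<le> \<epsilon>' \<and>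
      return_set j \<rho> e \<subseteq> B e)"
      unfolding choice_iff by (elim exE)
    then have B [measurable]: "\<And>e. B e \<in> sets M" and pB: "\<And>e. \<rho>1 \<le> \<bar>e\<bar> \<Longrightarrow> prob (B e) \<le> \<epsilon>'"
      and BI: "\<And>e. \<rho>1 \<le> \<bar>e\<bar> \<Longrightarrow> return_set j \<rho> e \<subseteq> B e"
      by auto
    define e where "e q = - (of_int (snd q - fst q) * \<rho>)" for q :: "int \<times> int"
    define I where "I = {q \<in> U \<times> U. \<rho>1 \<le> \<bar>e q\<bar>}"
    have I: "finite I" "card I \<le> K * K"
    proof -
      show "finite I" using U by (auto simp: I_def)
      have "card I \<le> card (U \<times> U)" using U by (intro card_mono) (auto simp: I_def)
      also have "\<dots> \<le> K * K" using U by (simp add: card_cartesian_product mult_le_mono)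
      finally show "card I \<le> K * K" .
    qed
    define W where "W = (\<Union>q\<in>I. B (e q))"
    have W [measurable]: "W \<in> sets M" unfolding W_def using I by (intro sets.finite_UN) auto
    have "prob W \<le> (\<Sum>q\<in>I. prob (B (e q)))"
      unfolding W_def using I by (intro finite_measure_subadditive_finite) auto
    also have "\<dots> \<le> (\<Sum>q\<in>I. \<epsilon>')" by (intro sum_mono pB) (auto simp: I_def)
    also have "\<dots> \<le> (real K)\<^sup>2 * \<epsilon>'"
      using I(2) \<epsilon>' by (auto simp: power2_eq_square of_nat_mult[symmetric] simp del: of_nat_mult intro!: mult_right_mono)
    finally have pW: "prob W \<le> \<eta> / 2" using K\<epsilon>' by linarith
    define t where "t = H j / \<alpha>"
    have t: "0 < t" "t \<le> H j" "\<alpha> * t = H j" using \<alpha> H_pos[of j] by (auto simp: t_def field_simps)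
    define L where "L = light j \<rho> \<epsilon>"
    have L [measurable]: "L \<in> sets \<nu>" by (simp add: L_def)
    define X1 where "X1 = band j (H j - t) (H j)"
    define Y1 where "Y1 = band j 0 C"
    define Y2 where "Y2 = pre (H j) (space M - tower j)"
    have [measurable]: "X1 \<in> sets M" "Y1 \<in> sets M" "Y2 \<in> sets M" unfolding X1_def Y1_def Y2_def by measurable
    have cover: "space \<nu> \<subseteq> (((((L \<union> {z \<in> space \<nu>. TT t z \<in> L}) \<union> on_snd W) \<union>
       on_fst X1) \<union> on_fst (space M - tower j)) \<union>
       on_snd Y1) \<union> on_snd (space M - tower j) \<union> on_snd Y2"
    proof (rule subsetI, rule ccontr)
      fix z assume z: "z \<in> space \<nu>" and "\<not> z \<in> (((((L \<union> {z \<in> space \<nu>. TT t z \<in> L}) \<union> on_snd W) \<union>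
       on_fst X1) \<union> on_fst (space M - tower j)) \<union>
       on_snd Y1) \<union> on_snd (space M - tower j) \<union> on_snd Y2"
      then have n: "z \<notin> L" "TT t z \<notin> L" "snd z \<notin> W" "fst z \<notin> X1" "fst z \<in> tower j" "snd z \<notin> Y1" "snd z \<in> tower j" "snd z \<notin> Y2"
        using space_\<nu>_D[OF z] by auto
      define x y where "x = fst z" and "y = snd z"
      have xy: "x \<in> space M" "y \<in> space M" using space_\<nu>_D[OF z] by (auto simp: x_def y_def)
      have px: "0 \<le> p j x" "p j x + t < H j" using n(4,5) xy by (auto simp: X1_def x_def tower_def)
      have py: "C \<le> p j y" "p j y < H j" using n(6,7) xy by (auto simp: Y1_def y_def tower_def)
      have q': "T (H j) y \<in> tower j" using n(8) xy by (auto simp: Y2_def y_def)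
      then have q'': "0 \<le> p j (T (H j) y)" "p j (T (H j) y) < H j" by (auto simp: tower_def)
      have pxt: "p j (T t x) = p j x + t" using px t xy by (intro p_shift) auto
      have TTsp: "TT t z \<in> space \<nu>" using xy by (auto simp: space_\<nu> TT_def map_prod_def x_def y_def case_prod_beta)
      have sq: "z \<in> square j" "TT t z \<in> square j"
        using z n TTsp px t xy pxt q' by (auto simp: square_def x_def[symmetric] y_def[symmetric] tower_def)
      define k k' where "k = \<lfloor>offset j z / \<rho>\<rfloor>" and "k' = \<lfloor>offset j (TT t z) / \<rho>\<rfloor>"
      have kU: "k \<in> U" "k' \<in> U" using n(1,2) sq by (auto simp: L_def light_def k_def k'_def U_def)
      have "of_int k \<le> offset j z / \<rho>" "offset j z / \<rho> < of_int k + 1"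
        "of_int k' \<le> offset j (TT t z) / \<rho>" "offset j (TT t z) / \<rho> < of_int k' + 1"
        unfolding k_def k'_def by linarith+
      then have kk: "of_int k * \<rho> \<le> offset j z" "offset j z < of_int k * \<rho> + \<rho>"
        "of_int k' * \<rho> \<le> offset j (TT t z)" "offset j (TT t z) < of_int k' * \<rho> + \<rho>"
        using \<rho> by (simp_all add: field_simps)
      define dd where "dd = offset j (TT t z) - offset j z"
      have dd: "p j (T (H j) y) - p j y = dd + H j"
        using pxt t(3) by (simp add: dd_def offset_def x_def[symmetric] y_def[symmetric] algebra_simps)
      define r where "r = - dd - e (k, k')"
      have r: "\<bar>r\<bar> \<le> \<rho>" using kk by (simp add: r_def e_def dd_def algebra_simps)
      have "p j (T (p j y - p j (T (H j) y)) (T (H j) y)) = p j y"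
        using p_shift[of "T (H j) y" j "p j y - p j (T (H j) y)"] xy q'' py C by simp
      also have "T (p j y - p j (T (H j) y)) (T (H j) y) = T (e (k, k') + r) y"
        using T_add[OF xy(2), of "p j y - p j (T (H j) y)" "H j"] dd by (simp add: r_def algebra_simps)
      finally have eq: "p j (T (e (k, k') + r) y) = p j y" .
      show False
      proof (cases "\<rho>1 \<le> \<bar>e (k, k')\<bar>")
        case True
        then have "y \<in> B (e (k, k'))" using BI[OF True] r eq n(7) by (auto simp: y_def return_set_def)
        moreover have "(k, k') \<in> I" using True kU by (simp add: I_def)
        ultimately have "y \<in> W" by (auto simp: W_def)
        then show False using n(3) by (simp add: y_def)
      next
        case False
        then show False using r dd q'' py unfolding r_def C_def by linarith
      qed
    qed
    have "1 = N.prob (space \<nu>)" by (simp add: N.prob_space)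
    also have "\<dots> \<le> N.prob ((((((L \<union> {z \<in> space \<nu>. TT t z \<in> L}) \<union> on_snd W) \<union>
       on_fst X1) \<union> on_fst (space M - tower j)) \<union>
       on_snd Y1) \<union> on_snd (space M - tower j) \<union> on_snd Y2)"
      using cover by (rule N.finite_measure_mono) measurable
    also have "\<dots> \<le> N.prob L + N.prob {z \<in> space \<nu>. TT t z \<in> L} + N.prob (on_snd W) +
       N.prob (on_fst X1) + N.prob (on_fst (space M - tower j)) +
       N.prob (on_snd Y1) + N.prob (on_snd (space M - tower j)) + N.prob (on_snd Y2)"
      by (intro order_trans[OF measure_Un_le] add_right_mono order_refl) measurable
    also have "\<dots> = 2 * N.prob L + prob W + prob X1 + 2 * prob (space M - tower j) + prob Y1 + prob Y2"
      using prob_vimage_TT[OF L, of t] measure_\<nu>_fst[of "space M - tower j"] measure_\<nu>_snd[of "space M - tower j"]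
      by (simp add: measure_\<nu>_fst measure_\<nu>_snd)
    also have "prob Y2 = prob (space M - tower j)" unfolding Y2_def by (rule prob_vimage_T) measurable
    finally have 1: "1 \<le> 2 * N.prob L + prob W + prob X1 + 3 * prob (space M - tower j) + prob Y1" by simp
    have "prob X1 \<le> (H j - (H j - t)) / H j" unfolding X1_def using t by (intro p_slab_le) auto
    also have "\<dots> = 1 / \<alpha>" using less_imp_neq[OF H_pos[of j]] by (simp add: t_def)
    finally have 2: "prob X1 \<le> 1 / \<alpha>" .
    have "prob Y1 \<le> (C - 0) / H j" unfolding Y1_def using C by (intro p_slab_le) auto
    then have "prob Y1 \<le> C / H j" by simp
    with 1 2 pW elim(2) show ?case unfolding L_def by linarith
  qed
qed

end

context scaled_joining
begin

definition long_offsets :: "nat \<Rightarrow> real \<Rightarrow> real set" where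
  "long_offsets j \<delta> = {d. \<delta> * H j \<le> (\<integral>s. box j s * box j (\<alpha> * s + d) \<partial>lborel)}"

text \<open>
  Offsets of lines with long intersection with the square that are not in a heavy strip; these satisfy the
  assumptions \<open>long\<close> and \<open>spread\<close> of \<open>line_average_bound\<close>.
\<close>

definition good_offsets :: "nat \<Rightarrow> real \<Rightarrow> real \<Rightarrow> real \<Rightarrow> real set" where
  "good_offsets j \<delta> \<rho> \<epsilon> = {d \<in> long_offsets j \<delta>. \<lfloor>d / \<rho>\<rfloor> \<notin> heavy j \<rho> \<epsilon>}"

lemma long_offsets_borel [measurable]: "long_offsets j \<delta> \<in> sets borel"
proof -
  have "(\<lambda>d. \<integral>s. box j s * box j (\<alpha> * s + d) \<partial>lborel) \<in> borel_measurable borel"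
    by (rule lborel.borel_measurable_lebesgue_integral) measurable
  then show ?thesis unfolding long_offsets_def by measurable
qed

lemma good_offsets_borel [measurable]: "good_offsets j \<delta> \<rho> \<epsilon> \<in> sets borel"
  unfolding good_offsets_def by measurable

definition good :: "nat \<Rightarrow> real \<Rightarrow> real \<Rightarrow> real \<Rightarrow> ('a \<times> 'a) set" where
  "good j \<delta> \<rho> \<epsilon> = {z \<in> square j. offset j z \<in> good_offsets j \<delta> \<rho> \<epsilon>}"

lemma good_measurable [measurable]: "good j \<delta> \<rho> \<epsilon> \<in> sets \<nu>" unfolding good_def by measurable

lemma long_offset_of_interior:
  assumes z: "z \<in> square j" and "p j (fst z) < H j - \<delta> * H j" "p j (snd z) < H j - \<alpha> * \<delta> * H j" and \<delta>: "0 < \<delta>"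
  shows "offset j z \<in> long_offsets j \<delta>"
proof -
  define P Q where "P = p j (fst z)" and "Q = p j (snd z)"
  have PQ: "0 \<le> P" "P < H j - \<delta> * H j" "0 \<le> Q" "Q < H j - \<alpha> * \<delta> * H j" using assms by (auto simp: P_def Q_def square_def tower_def)
  have "\<delta> * H j = (\<integral>s. indicator {P..<P + \<delta> * H j} s \<partial>lborel)"
    using \<delta> by (simp add: less_imp_le)
  also have "\<dots> \<le> (\<integral>s. box j s * box j (\<alpha> * s + offset j z) \<partial>lborel)"
  proof (rule integral_mono')
    show "integrable lborel (\<lambda>s. box j s * box j (\<alpha> * s + offset j z))"
    proof (rule Bochner_Integration.integrable_bound)
      show "integrable lborel (indicat_real {0..<H j})"
        using H_pos[of j] by (intro integrable_real_indicator) (auto simp: less_imp_le)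
    qed (auto simp: indicator_def)
    fix s
    show "indicat_real {P..<P + \<delta> * H j} s \<le> box j s * box j (\<alpha> * s + offset j z)"
    proof (cases "s \<in> {P..<P + \<delta> * H j}")
      case True
      have "\<alpha> * (s - P) < \<alpha> * (\<delta> * H j)" "0 \<le> \<alpha> * (s - P)" using True \<alpha> by auto
      moreover have "\<alpha> * s + offset j z = \<alpha> * (s - P) + Q" by (simp add: offset_def P_def Q_def algebra_simps)
      ultimately show ?thesis using True PQ by (simp add: mult.assoc)
    qed simp
  qed auto
  finally show ?thesis by (simp add: long_offsets_def)
qed

text \<open>
  A line has a short intersection with the square only near two of its corners, and a fortiori near its right or upper
  side, where the marginals of \<open>\<nu>\<close> leave little mass.
\<close>

lemma good_mass:
  assumes \<delta>: "0 < \<delta>"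
  shows "N.prob (light j \<rho> \<epsilon>) - \<delta> * (1 + \<alpha>) \<le> N.prob (good j \<delta> \<rho> \<epsilon>)"
proof -
  define X where "X = band j (H j - \<delta> * H j) (H j)"
  define Y where "Y = band j (H j - \<alpha> * \<delta> * H j) (H j)"
  have XY [measurable]: "X \<in> sets M" "Y \<in> sets M" unfolding X_def Y_def by measurable
  have "prob X \<le> (H j - (H j - \<delta> * H j)) / H j" "prob Y \<le> (H j - (H j - \<alpha> * \<delta> * H j)) / H j"
    unfolding X_def Y_def using \<delta> \<alpha> less_imp_le[OF H_pos[of j]] by (intro p_slab_le; simp)+
  then have p: "prob X \<le> \<delta>" "prob Y \<le> \<alpha> * \<delta>" using less_imp_neq[OF H_pos[of j]] by simp_all
  have "light j \<rho> \<epsilon> \<subseteq> (good j \<delta> \<rho> \<epsilon> \<union> on_fst X) \<union> on_snd Y"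
  proof (rule subsetI, rule ccontr)
    fix z assume l: "z \<in> light j \<rho> \<epsilon>"
      and n: "z \<notin> (good j \<delta> \<rho> \<epsilon> \<union> on_fst X) \<union> on_snd Y"
    from l have z: "z \<in> space \<nu>" "z \<in> square j" by (auto simp: light_def square_def)
    have t: "fst z \<in> tower j" "snd z \<in> tower j" using z by (auto simp: square_def)
    have "p j (fst z) < H j - \<delta> * H j" "p j (snd z) < H j - \<alpha> * \<delta> * H j"
      using n z t space_\<nu>_D[OF z(1)] by (auto simp: X_def Y_def tower_def)
    from long_offset_of_interior[OF z(2) this \<delta>] l n show False by (auto simp: light_def good_def good_offsets_def)
  qed
  then have "N.prob (light j \<rho> \<epsilon>) \<le> N.prob ((good j \<delta> \<rho> \<epsilon> \<union> on_fst X) \<union> on_snd Y)"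
    by (rule N.finite_measure_mono) measurable
  also have "\<dots> \<le> N.prob (good j \<delta> \<rho> \<epsilon>) + N.prob (on_fst X) + N.prob (on_snd Y)"
    by (intro order_trans[OF measure_Un_le] add_right_mono order_refl) measurable
  also have "\<dots> \<le> N.prob (good j \<delta> \<rho> \<epsilon>) + \<delta> + \<alpha> * \<delta>"
    using p by (simp add: measure_\<nu>_fst measure_\<nu>_snd)
  finally show ?thesis by (simp add: algebra_simps)
qed

text \<open>
  An interval of length \<open>2 * \<rho>\<close> meets at most three strips.
\<close>

lemma good_spread:
  assumes \<rho>: "0 < \<rho>" and \<epsilon>: "0 < \<epsilon>"
  shows "N.prob {z \<in> space \<nu>. p j (fst z) \<in> {0..<H j} \<and> p j (snd z) \<in> {0..<H j} \<and>
    offset j z \<in> good_offsets j \<delta> \<rho> \<epsilon> \<and> \<bar>offset j z - d\<bar> \<le> \<rho>} \<le> 3 * \<epsilon>"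
proof -
  define k where "k = \<lfloor>d / \<rho>\<rfloor>"
  define G where "G l = (if l \<in> heavy j \<rho> \<epsilon> then {} else strip j \<rho> l)" for l
  have [measurable]: "G l \<in> sets \<nu>" for l by (simp add: G_def)
  have G: "N.prob (G l) \<le> \<epsilon>" for l using \<epsilon> by (auto simp: G_def heavy_def)
  have "{z \<in> space \<nu>. p j (fst z) \<in> {0..<H j} \<and> p j (snd z) \<in> {0..<H j} \<and>
    offset j z \<in> good_offsets j \<delta> \<rho> \<epsilon> \<and> \<bar>offset j z - d\<bar> \<le> \<rho>} \<subseteq> G (k - 1) \<union> G k \<union> G (k + 1)"
  proof
    fix z assume z: "z \<in> {z \<in> space \<nu>. p j (fst z) \<in> {0..<H j} \<and> p j (snd z) \<in> {0..<H j} \<and>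
      offset j z \<in> good_offsets j \<delta> \<rho> \<epsilon> \<and> \<bar>offset j z - d\<bar> \<le> \<rho>}"
    then have sq: "z \<in> square j" and nh: "\<lfloor>offset j z / \<rho>\<rfloor> \<notin> heavy j \<rho> \<epsilon>" and near: "\<bar>offset j z - d\<bar> \<le> \<rho>"
      using space_\<nu>_D[of z] by (auto simp: square_def tower_def good_offsets_def)
    have "\<bar>offset j z / \<rho> - d / \<rho>\<bar> \<le> 1"
      using near \<rho> by (simp add: diff_divide_distrib[symmetric] abs_divide)
    then have "\<lfloor>offset j z / \<rho>\<rfloor> = k - 1 \<or> \<lfloor>offset j z / \<rho>\<rfloor> = k \<or> \<lfloor>offset j z / \<rho>\<rfloor> = k + 1"
      unfolding k_def by linarith
    moreover have "z \<in> G \<lfloor>offset j z / \<rho>\<rfloor>" using sq nh by (simp add: G_def strip_def)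
    ultimately show "z \<in> G (k - 1) \<union> G k \<union> G (k + 1)" by auto
  qed
  then have "N.prob {z \<in> space \<nu>. p j (fst z) \<in> {0..<H j} \<and> p j (snd z) \<in> {0..<H j} \<and>
    offset j z \<in> good_offsets j \<delta> \<rho> \<epsilon> \<and> \<bar>offset j z - d\<bar> \<le> \<rho>} \<le> N.prob (G (k - 1) \<union> G k \<union> G (k + 1))"
    by (rule N.finite_measure_mono) measurable
  also have "\<dots> \<le> N.prob (G (k - 1)) + N.prob (G k) + N.prob (G (k + 1))"
    by (intro order_trans[OF measure_Un_le] add_right_mono order_refl) measurable
  also have "\<dots> \<le> 3 * \<epsilon>" using G[of "k - 1"] G[of k] G[of "k + 1"] by linarith
  finally show ?thesis .
qed

lemma good_shift:
  assumes s: "0 \<le> s"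
  shows "N.prob {z \<in> space \<nu>. z \<in> good j \<delta> \<rho> \<epsilon> \<and> TT s z \<notin> good j \<delta> \<rho> \<epsilon>} \<le> (1 + \<alpha>) * s / H j"
proof -
  define X where "X = band j (H j - s) (H j)"
  define Y where "Y = band j (H j - \<alpha> * s) (H j)"
  have XY [measurable]: "X \<in> sets M" "Y \<in> sets M" unfolding X_def Y_def by measurable
  have "prob X \<le> (H j - (H j - s)) / H j" "prob Y \<le> (H j - (H j - \<alpha> * s)) / H j"
    unfolding X_def Y_def using s \<alpha> by (intro p_slab_le; simp)+
  then have pXY: "prob X + prob Y \<le> (1 + \<alpha>) * s / H j" by (simp add: algebra_simps add_divide_distrib)
  have "{z \<in> space \<nu>. z \<in> good j \<delta> \<rho> \<epsilon> \<and> TT s z \<notin> good j \<delta> \<rho> \<epsilon>} \<subseteq> on_fst X \<union> on_snd Y"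
  proof (rule subsetI, rule ccontr)
    fix z assume z: "z \<in> {z \<in> space \<nu>. z \<in> good j \<delta> \<rho> \<epsilon> \<and> TT s z \<notin> good j \<delta> \<rho> \<epsilon>}"
      and n: "z \<notin> on_fst X \<union> on_snd Y"
    from z have zs: "z \<in> space \<nu>" and g: "z \<in> square j" "offset j z \<in> good_offsets j \<delta> \<rho> \<epsilon>" by (auto simp: good_def)
    have sp: "fst z \<in> space M" "snd z \<in> space M" using space_\<nu>_D[OF zs] .
    have h: "0 \<le> p j (fst z)" "0 \<le> p j (snd z)" "p j (fst z) + s < H j" "p j (snd z) + \<alpha> * s < H j" "0 \<le> \<alpha> * s"
      using n zs g(1) sp s \<alpha> by (auto simp: X_def Y_def square_def tower_def)
    have 1: "p j (T s (fst z)) = p j (fst z) + s" using h s sp by (intro p_shift) auto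
    have 2: "p j (T (\<alpha> * s) (snd z)) = p j (snd z) + \<alpha> * s" using h s sp by (intro p_shift) auto
    have "TT s z \<in> space \<nu>" using sp by (auto simp: space_\<nu> TT_def map_prod_def case_prod_beta)
    then have "TT s z \<in> square j" using 1 2 h s sp by (auto simp: square_def tower_def)
    moreover have "offset j (TT s z) = offset j z" by (simp add: offset_def 1 2 algebra_simps)
    ultimately have "TT s z \<in> good j \<delta> \<rho> \<epsilon>" using g(2) by (simp add: good_def)
    then show False using z by simp
  qed
  then have "N.prob {z \<in> space \<nu>. z \<in> good j \<delta> \<rho> \<epsilon> \<and> TT s z \<notin> good j \<delta> \<rho> \<epsilon>} \<le> N.prob (on_fst X \<union> on_snd Y)"
    by (rule N.finite_measure_mono) measurable
  also have "\<dots> \<le> N.prob (on_fst X) + N.prob (on_snd Y)"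
    by (intro measure_Un_le) measurable
  also have "\<dots> \<le> (1 + \<alpha>) * s / H j" using pXY by (simp add: measure_\<nu>_fst measure_\<nu>_snd)
  finally show ?thesis .
qed

text \<open>
  Conditioned on the good pairs, the first coordinate is asymptotically distributed like \<open>M\<close>: the set of good pairs is
  a union of lines and therefore almost invariant under bounded times, while the translates of \<open>A\<close> are almost
  uncorrelated.
\<close>

lemma good_first_marginal:
  assumes A [measurable]: "A \<in> sets M" and \<eta>: "0 < \<eta>"
  shows "\<forall>\<^sub>F j in sequentially. \<forall>\<delta> \<rho> \<epsilon>. \<bar>\<integral>z. indicator (good j \<delta> \<rho> \<epsilon>) z * centered A (fst z) \<partial>\<nu>\<bar> \<le> 2 * \<eta>"
proof -
  define F where "F = centered A"
  have F [measurable]: "F \<in> borel_measurable M" unfolding F_def by measurable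
  obtain \<sigma> where \<sigma>: "0 < \<sigma>" "\<And>t. \<sigma> \<le> \<bar>t\<bar> \<Longrightarrow> \<bar>\<integral>x. F x * F (T t x) \<partial>M\<bar> < \<eta>\<^sup>2 / 2"
    using centered_correlation[OF A, of "\<eta>\<^sup>2 / 2"] \<eta> by (auto simp: F_def)
  define n where "n = nat \<lceil>2 / \<eta>\<^sup>2\<rceil> + 1"
  have n: "0 < n" "1 / n \<le> \<eta>\<^sup>2 / 2"
  proof -
    show "0 < n" by (simp add: n_def)
    have "2 / \<eta>\<^sup>2 \<le> n" unfolding n_def of_nat_add using real_nat_ceiling_ge[of "2 / \<eta>\<^sup>2"] by linarith
    then show "1 / n \<le> \<eta>\<^sup>2 / 2" using \<eta> \<open>0 < n\<close> by (simp add: field_simps)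
  qed
  define X where "X z = F (fst z)" for z :: "'a \<times> 'a"
  have X [measurable]: "X \<in> borel_measurable \<nu>" unfolding X_def by measurable
  have X1: "\<bar>X z\<bar> \<le> 1" for z unfolding X_def F_def by (rule centered_le_1)
  have unc: "\<bar>\<integral>z. X (TT (\<sigma> * real r) z) * X (TT (\<sigma> * real s) z) \<partial>\<nu>\<bar> \<le> \<eta>\<^sup>2 / 2" if "r < n" "s < n" "r \<noteq> s" for r s
  proof -
    have "(\<integral>z. X (TT (\<sigma> * real r) z) * X (TT (\<sigma> * real s) z) \<partial>\<nu>) = (\<integral>x. F (T (\<sigma> * r) x) * F (T (\<sigma> * s) x) \<partial>M)"
      unfolding X_def TT_simps by (rule integral_\<nu>_fst) measurable
    also have "\<dots> = (\<integral>x. F (T (\<sigma> * r) x) * F (T (\<sigma> * (real s - real r)) (T (\<sigma> * r) x)) \<partial>M)"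
      by (rule integral_cong_space) (simp add: T_add[symmetric] algebra_simps)
    also have "\<dots> = (\<integral>x. F x * F (T (\<sigma> * (real s - real r)) x) \<partial>M)"
      by (rule integral_T) measurable
    finally have eq: "(\<integral>z. X (TT (\<sigma> * real r) z) * X (TT (\<sigma> * real s) z) \<partial>\<nu>) = (\<integral>x. F x * F (T (\<sigma> * (real s - real r)) x) \<partial>M)" .
    have "\<sigma> * 1 \<le> \<sigma> * \<bar>real s - real r\<bar>" using \<sigma>(1) that by (intro mult_left_mono) auto
    then show ?thesis unfolding eq using \<sigma>(1) by (intro less_imp_le[OF \<sigma>(2)]) (simp add: abs_mult)
  qed
  have "eventually (\<lambda>j. 2 * (1 + \<alpha>) * \<sigma> * n / \<eta> \<le> H j) sequentially"
    using heights_tend_to_infinity by (auto simp: filterlim_at_top)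
  then show ?thesis
  proof (eventually_elim, intro allI)
    fix j \<delta> \<rho> \<epsilon> assume Hj: "2 * (1 + \<alpha>) * \<sigma> * n / \<eta> \<le> H j"
    define V where "V = good j \<delta> \<rho> \<epsilon>"
    have V [measurable]: "V \<in> sets \<nu>" by (simp add: V_def)
    have shift: "N.prob {z \<in> space \<nu>. z \<in> V \<and> TT (\<sigma> * real r) z \<notin> V} \<le> \<eta> / 2" if r: "r < n" for r
    proof -
      have "2 * (1 + \<alpha>) * \<sigma> * r \<le> 2 * (1 + \<alpha>) * \<sigma> * n" using r \<sigma>(1) \<alpha> by (intro mult_left_mono) auto
      also have "\<dots> \<le> \<eta> * H j" using Hj \<eta> by (simp add: field_simps)
      finally have "(1 + \<alpha>) * (\<sigma> * r) \<le> \<eta> / 2 * H j" by (simp add: algebra_simps)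
      then have "(1 + \<alpha>) * (\<sigma> * r) / H j \<le> \<eta> / 2" using H_pos[of j] by (simp only: pos_divide_le_eq)
      moreover have "0 \<le> \<sigma> * real r" using \<sigma>(1) by simp
      ultimately show ?thesis unfolding V_def by (intro order_trans[OF good_shift])
    qed
    have "\<bar>\<integral>z. indicator V z * X z \<partial>\<nu>\<bar> \<le> 2 * (\<eta> / 2) + sqrt (1 / n + \<eta>\<^sup>2 / 2)"
      using n(1) by (intro N.almost_invariant_average[OF TT_measurable TT_distr V X X1 shift unc]) auto
    also have "sqrt (1 / n + \<eta>\<^sup>2 / 2) \<le> sqrt (\<eta>\<^sup>2)" using n(2) by (intro real_sqrt_le_mono) linarith
    also have "\<dots> = \<eta>" using \<eta> by simp
    finally have "\<bar>\<integral>z. indicator V z * X z \<partial>\<nu>\<bar> \<le> 2 * \<eta>" by simp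
    then show "\<bar>\<integral>z. indicator (good j \<delta> \<rho> \<epsilon>) z * centered A (fst z) \<partial>\<nu>\<bar> \<le> 2 * \<eta>"
      by (simp add: V_def X_def F_def)
  qed
qed

text \<open>
  On the good pairs, \<open>line_average_bound\<close> with \<open>a = 1\<^sub>A\<close> and \<open>f = 1\<^sub>B - \<mu>(B)\<close>, read as functions of the
  heights, separates the second factor, and \<open>good_first_marginal\<close> the first one. The good pairs have measure at least
  \<open>c / 4\<close> with \<open>c = 1 - 1 / \<alpha>\<close>: the light strips have at least \<open>3 * c / 8\<close>, and \<open>\<delta>\<close> is chosen so that
  short lines carry at most \<open>c / 8\<close>.
\<close>

theorem joining_ge_product:
  assumes A [measurable]: "A \<in> sets M" and B [measurable]: "B \<in> sets M"
  shows "(1 - 1 / \<alpha>) / 4 * (prob A * prob B) \<le> N.prob (A \<times> B)"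
proof (rule field_le_epsilon)
  fix \<eta>' :: real assume "0 < \<eta>'"
  define \<eta> where "\<eta> = \<eta>' / 6"
  have \<eta>: "0 < \<eta>" using \<open>0 < \<eta>'\<close> by (simp add: \<eta>_def)
  define c where "c = 1 - 1 / \<alpha>"
  have c: "0 < c" using \<alpha> by (simp add: c_def)
  define \<delta> where "\<delta> = c / (8 * (1 + \<alpha>))"
  have "c / (8 * X) * X = c / 8" if "X \<noteq> 0" for X using that by simp
  from this[of "1 + \<alpha>"] have \<delta>: "0 < \<delta>" "\<delta> * (1 + \<alpha>) = c / 8" using c \<alpha> by (simp_all add: \<delta>_def)
  define \<epsilon> where "\<epsilon> = (\<delta> * \<eta>)\<^sup>2 / 2"
  have \<epsilon>: "0 < \<epsilon>" using \<delta> \<eta> by (simp add: \<epsilon>_def)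
  obtain SA where SA [measurable]: "\<And>j. SA j \<in> sets borel" and SAsub: "\<And>j. SA j \<subseteq> {0..<H j}"
    and limA: "(\<lambda>j. prob (sym_diff A (floors (p j) (SA j)))) \<longlonglongrightarrow> 0"
    using approx[OF A] by blast
  obtain SB where SB [measurable]: "\<And>j. SB j \<in> sets borel" and SBsub: "\<And>j. SB j \<subseteq> {0..<H j}"
    and limB: "(\<lambda>j. prob (sym_diff B (floors (p j) (SB j)))) \<longlonglongrightarrow> 0"
    using approx[OF B] by blast
  define f where "f j s = indicator (SB j) s - prob B" for j s
  have f [measurable]: "f j \<in> borel_measurable borel" for j unfolding f_def by measurable
  obtain \<rho>0 where \<rho>0: "\<forall>\<^sub>F j in sequentially. \<forall>d d'. \<rho>0 < \<bar>d - d'\<bar> \<longrightarrow>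
    \<bar>\<integral>s. box j s * box j (\<alpha> * s + d) * box j (\<alpha> * s + d') *
       (f j (\<alpha> * s + d) * f j (\<alpha> * s + d')) \<partial>lborel\<bar> \<le> \<epsilon> * H j"
    using line_correlations_small[OF B \<epsilon> _ SB SBsub limB, of \<alpha>] \<alpha> by (auto simp: f_def)
  define \<rho> where "\<rho> = max \<rho>0 1"
  have \<rho>: "0 < \<rho>" "\<rho>0 \<le> \<rho>" by (auto simp: \<rho>_def)
  have light: "\<forall>\<^sub>F j in sequentially. c - c / 4 \<le> 2 * N.prob (light j \<rho> (\<epsilon> / 3))"
    unfolding c_def by (rule light_mass) (use \<rho> \<epsilon> c in \<open>auto simp: c_def\<close>)
  have "eventually (\<lambda>j. prob (sym_diff A (floors (p j) (SA j))) < \<eta>) sequentially"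
    "eventually (\<lambda>j. prob (sym_diff B (floors (p j) (SB j))) < \<eta>) sequentially"
    using \<eta> by (auto intro!: order_tendstoD(2)[OF limA] order_tendstoD(2)[OF limB])
  then have "eventually (\<lambda>j. c / 4 * (prob A * prob B) \<le> N.prob (A \<times> B) + \<eta>') sequentially"
    using light \<rho>0 good_first_marginal[OF A \<eta>]
  proof eventually_elim
    case (elim j)
    define DA where "DA = sym_diff A (floors (p j) (SA j))"
    define DB where "DB = sym_diff B (floors (p j) (SB j))"
    have [measurable]: "DA \<in> sets M" "DB \<in> sets M" unfolding DA_def DB_def by measurable
    have D: "prob DA < \<eta>" "prob DB < \<eta>" using elim(1,2) by (auto simp: DA_def DB_def)
    define V where "V = good j \<delta> \<rho> (\<epsilon> / 3)"
    have V [measurable]: "V \<in> sets \<nu>" by (simp add: V_def)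
    have V_mass: "c / 4 \<le> N.prob V"
      using good_mass[OF \<delta>(1), of j \<rho> "\<epsilon> / 3"] elim(3) \<delta>(2) by (simp add: V_def)
    define PA where "PA = {z \<in> space \<nu>. p j (fst z) \<in> SA j}"
    define QB where "QB = {z \<in> space \<nu>. p j (snd z) \<in> SB j}"
    have [measurable]: "PA \<in> sets \<nu>" "QB \<in> sets \<nu>" unfolding PA_def QB_def by measurable
    have line: "\<bar>\<integral>z. box j (p j (fst z)) * box j (p j (snd z)) *
        indicator (good_offsets j \<delta> \<rho> (\<epsilon> / 3)) (p j (snd z) - \<alpha> * p j (fst z)) *
        (indicator (SA j) (p j (fst z)) * f j (p j (snd z))) \<partial>\<nu>\<bar> \<le> sqrt (\<epsilon> + \<epsilon>) / \<delta>"
    proof (rule N.line_average_bound[where H = "H j" and \<rho> = \<rho>])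
      show "(\<lambda>z. p j (fst z)) \<in> borel_measurable \<nu>" "(\<lambda>z. p j (snd z)) \<in> borel_measurable \<nu>" by measurable
      show "\<bar>f j s\<bar> \<le> 1" for s
        using prob_le_1[of B] measure_nonneg[of M B] by (auto simp: f_def indicator_def)
      show "\<delta> * H j \<le> (\<integral>s. box j s * box j (\<alpha> * s + d) \<partial>lborel)"
        if "d \<in> good_offsets j \<delta> \<rho> (\<epsilon> / 3)" for d
        using that by (simp add: good_offsets_def long_offsets_def)
      show "N.prob {z \<in> space \<nu>. p j (fst z) \<in> {0..<H j} \<and> p j (snd z) \<in> {0..<H j} \<and>
          p j (snd z) - \<alpha> * p j (fst z) \<in> good_offsets j \<delta> \<rho> (\<epsilon> / 3) \<and>
          \<bar>p j (snd z) - \<alpha> * p j (fst z) - d\<bar> \<le> \<rho>} \<le> \<epsilon>" for d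
        using good_spread[OF \<rho>(1), of "\<epsilon> / 3" j \<delta> d] \<epsilon> by (simp add: offset_def)
      show "\<bar>\<integral>s. box j s * box j (\<alpha> * s + d) * box j (\<alpha> * s + d') *
         (f j (\<alpha> * s + d) * f j (\<alpha> * s + d')) \<partial>lborel\<bar> \<le> \<epsilon> * H j" if "\<rho> < \<bar>d - d'\<bar>" for d d'
        using elim(4) that \<rho>(2) by auto
    qed ((rule height_invariance; assumption) | (use \<alpha> \<delta> \<epsilon> in \<open>(auto simp: indicator_def; fail)\<close>))+
    also have "sqrt (\<epsilon> + \<epsilon>) / \<delta> = \<eta>"
    proof -
      have "\<epsilon> + \<epsilon> = (\<delta> * \<eta>)\<^sup>2" by (simp add: \<epsilon>_def)
      then show ?thesis using \<delta> \<eta> by simp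
    qed
    also have "(\<integral>z. box j (p j (fst z)) * box j (p j (snd z)) *
        indicator (good_offsets j \<delta> \<rho> (\<epsilon> / 3)) (p j (snd z) - \<alpha> * p j (fst z)) *
        (indicator (SA j) (p j (fst z)) * f j (p j (snd z))) \<partial>\<nu>) =
      (\<integral>z. indicator (V \<inter> PA \<inter> QB) z - prob B * indicator (V \<inter> PA) z \<partial>\<nu>)"
    proof (rule integral_cong_space)
      fix z assume z: "z \<in> space \<nu>"
      have "z \<in> V \<longleftrightarrow> p j (fst z) \<in> {0..<H j} \<and> p j (snd z) \<in> {0..<H j} \<and> p j (snd z) - \<alpha> * p j (fst z) \<in> good_offsets j \<delta> \<rho> (\<epsilon> / 3)"
        using z space_\<nu>_D[OF z] by (auto simp: V_def good_def square_def tower_def offset_def)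
      then show "box j (p j (fst z)) * box j (p j (snd z)) *
        indicator (good_offsets j \<delta> \<rho> (\<epsilon> / 3)) (p j (snd z) - \<alpha> * p j (fst z)) *
        (indicator (SA j) (p j (fst z)) * f j (p j (snd z))) = indicator (V \<inter> PA \<inter> QB) z - prob B * indicator (V \<inter> PA) z"
        using z by (auto simp: f_def PA_def QB_def indicator_def)
    qed
    also have "\<dots> = N.prob (V \<inter> PA \<inter> QB) - prob B * N.prob (V \<inter> PA)"
    proof -
      have 1: "integrable \<nu> (indicat_real W)" if "W \<in> sets \<nu>" for W
        using that by (intro integrable_real_indicator) (auto simp: N.emeasure_eq_measure)
      have 2: "W \<inter> space \<nu> = W" if "W \<in> sets \<nu>" for W using sets.sets_into_space[OF that] by auto
      show ?thesis by (subst Bochner_Integration.integral_diff) (auto simp: 1 2)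
    qed
    finally have E0: "\<bar>N.prob (V \<inter> PA \<inter> QB) - prob B * N.prob (V \<inter> PA)\<bar> \<le> \<eta>" .
    have [measurable]: "A \<times> B \<in> sets \<nu>" by (simp add: sets_\<nu>)
    have "N.prob (V \<inter> PA \<inter> QB) \<le> N.prob ((A \<times> B) \<union> on_fst DA \<union> on_snd DB)"
      by (intro N.finite_measure_mono subsetI) (auto simp: PA_def QB_def DA_def DB_def mem_Times_iff dest: space_\<nu>_D)
    also have "\<dots> \<le> N.prob (A \<times> B) + N.prob (on_fst DA) + N.prob (on_snd DB)"
      by (intro order_trans[OF measure_Un_le] add_right_mono order_refl) measurable
    finally have E1: "N.prob (V \<inter> PA \<inter> QB) \<le> N.prob (A \<times> B) + 2 * \<eta>"
      using D by (simp add: measure_\<nu>_fst measure_\<nu>_snd)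
    define VA where "VA = V \<inter> on_fst A"
    have [measurable]: "VA \<in> sets \<nu>" unfolding VA_def by measurable
    have "N.prob VA \<le> N.prob ((V \<inter> PA) \<union> on_fst DA)"
      by (intro N.finite_measure_mono subsetI) (auto simp: VA_def PA_def DA_def dest: space_\<nu>_D)
    also have "\<dots> \<le> N.prob (V \<inter> PA) + N.prob (on_fst DA)"
      by (intro measure_Un_le) measurable
    finally have E2: "N.prob VA \<le> N.prob (V \<inter> PA) + \<eta>" using D by (simp add: measure_\<nu>_fst)
    have "(\<integral>z. indicator V z * centered A (fst z) \<partial>\<nu>) = (\<integral>z. indicator VA z - prob A * indicator V z \<partial>\<nu>)"
      by (rule integral_cong_space) (auto simp: VA_def centered_def indicator_def)
    also have "\<dots> = N.prob VA - prob A * N.prob V"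
    proof -
      have 1: "integrable \<nu> (indicat_real W)" if "W \<in> sets \<nu>" for W
        using that by (intro integrable_real_indicator) (auto simp: N.emeasure_eq_measure)
      have 2: "W \<inter> space \<nu> = W" if "W \<in> sets \<nu>" for W using sets.sets_into_space[OF that] by auto
      show ?thesis by (subst Bochner_Integration.integral_diff) (auto simp: 1 2)
    qed
    finally have E3: "prob A * N.prob V - 2 * \<eta> \<le> N.prob VA" using elim(5)[rule_format, of \<delta> \<rho> "\<epsilon> / 3"] by (simp add: V_def abs_le_iff)
    have "c / 4 * prob A \<le> N.prob V * prob A" using V_mass by (intro mult_right_mono) auto
    then have "c / 4 * prob A - 3 * \<eta> \<le> N.prob (V \<inter> PA)" using E2 E3 by (simp add: mult.commute)
    then have "prob B * (c / 4 * prob A - 3 * \<eta>) \<le> prob B * N.prob (V \<inter> PA)" by (intro mult_left_mono) auto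
    moreover have "prob B * (3 * \<eta>) \<le> 1 * (3 * \<eta>)" using \<eta> by (intro mult_right_mono) auto
    ultimately have "c / 4 * (prob A * prob B) - 3 * \<eta> \<le> prob B * N.prob (V \<inter> PA)" by (simp add: algebra_simps)
    moreover have "\<eta>' = 6 * \<eta>" by (simp add: \<eta>_def)
    ultimately show ?case using E0[unfolded abs_le_iff] E1 by linarith
  qed
  then show "(1 - 1 / \<alpha>) / 4 * (prob A * prob B) \<le> N.prob (A \<times> B) + \<eta>'"
    unfolding c_def by simp
qed

end

section \<open>Splitting off a multiple of the product measure\<close>

text \<open>
  The difference of the measures is nonnegative and additive on the ring generated by the semiring and
  dominated by \<open>N\<close>, hence continuous at the empty set. By Caratheodory's theorem it extends to a measure \<open>Q\<close>,
  and \<open>Q + P = N\<close> by uniqueness.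
\<close>

lemma measure_le_of_semiring:
  assumes R: "semiring_of_sets \<Omega> R" "\<Omega> \<in> R" and N: "finite_measure N" and P: "finite_measure P"
    and sN: "sets N = sigma_sets \<Omega> R" and sP: "sets P = sigma_sets \<Omega> R"
    and \<Omega>: "space N = \<Omega>" "space P = \<Omega>"
    and le: "\<And>a. a \<in> R \<Longrightarrow> measure P a \<le> measure N a" and E: "E \<in> sets N"
  shows "measure P E \<le> measure N E"
proof -
  interpret R: semiring_of_sets \<Omega> R by (rule R(1))
  interpret G: ring_of_sets \<Omega> R.generated_ring by (rule R.generating_ring)
  interpret N: finite_measure N by fact
  interpret P: finite_measure P by fact
  have GR: "sigma_sets \<Omega> R.generated_ring = sigma_sets \<Omega> R" by (rule R.sigma_sets_generated_ring_eq)
  have inN: "a \<in> sets N" "a \<in> sets P" if "a \<in> R.generated_ring" for a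
    using that sN sP GR by (metis sigma_sets.Basic)+
  have R_sets: "a \<in> sets N" "a \<in> sets P" if "a \<in> R" for a using that sN sP by auto
  have le_ring: "measure P a \<le> measure N a" if "a \<in> R.generated_ring" for a
  proof -
    from R.generated_ringE[OF that] obtain C where C: "finite C" "disjoint C" "C \<subseteq> R" "a = \<Union>C" by metis
    have dis: "disjoint_family_on (\<lambda>c. c) C" using C(2) by (auto simp: disjoint_def disjoint_family_on_def)
    have a: "a = (\<Union>c\<in>C. c)" using C(4) by simp
    have "measure P a = (\<Sum>c\<in>C. measure P c)"
      unfolding a using C R_sets dis by (intro P.finite_measure_finite_Union) auto
    also have "\<dots> \<le> (\<Sum>c\<in>C. measure N c)" using C le by (intro sum_mono) auto
    also have "\<dots> = measure N a"
      unfolding a using C R_sets dis by (intro N.finite_measure_finite_Union[symmetric]) auto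
    finally show ?thesis .
  qed
  define f where "f a = ennreal (measure N a - measure P a)" for a
  have "\<exists>\<mu> :: 'a set \<Rightarrow> ennreal. (\<forall>s \<in> R.generated_ring. \<mu> s = f s) \<and> measure_space \<Omega> (sigma_sets \<Omega> R.generated_ring) \<mu>"
  proof (rule G.caratheodory_empty_continuous)
    show "positive R.generated_ring f" by (simp add: positive_def f_def)
    show "additive R.generated_ring f"
      unfolding additive_def
    proof (intro ballI impI)
      fix a b assume ab: "a \<in> R.generated_ring" "b \<in> R.generated_ring" "a \<inter> b = {}"
      have "measure N (a \<union> b) = measure N a + measure N b" "measure P (a \<union> b) = measure P a + measure P b"
        using ab inN by (auto intro!: N.finite_measure_Union P.finite_measure_Union)
      then show "f (a \<union> b) = f a + f b"
        using le_ring[OF ab(1)] le_ring[OF ab(2)] by (simp add: f_def ennreal_plus[symmetric] del: ennreal_plus)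
    qed
    show "f a \<noteq> \<infinity>" for a by (simp add: f_def)
    fix A :: "nat \<Rightarrow> 'a set" assume A: "range A \<subseteq> R.generated_ring" "decseq A" "(\<Inter>i. A i) = {}"
    have "(\<lambda>i. measure N (A i)) \<longlonglongrightarrow> measure N (\<Inter>i. A i)"
      using A inN by (intro N.finite_Lim_measure_decseq) auto
    then have lim: "(\<lambda>i. ennreal (measure N (A i))) \<longlonglongrightarrow> ennreal 0" using A(3) by (intro tendsto_ennrealI) simp
    show "(\<lambda>i. f (A i)) \<longlonglongrightarrow> 0"
      by (rule tendsto_sandwich[OF _ _ tendsto_const lim[unfolded ennreal_0]]) (auto simp: f_def intro!: always_eventually ennreal_leI)
  qed
  then obtain \<mu> where \<mu>: "\<And>s. s \<in> R.generated_ring \<Longrightarrow> \<mu> s = f s" and ms: "measure_space \<Omega> (sigma_sets \<Omega> R) \<mu>"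
    unfolding GR by blast
  define Q where "Q = measure_of \<Omega> (sigma_sets \<Omega> R) \<mu>"
  have sub: "sigma_sets \<Omega> R \<subseteq> Pow \<Omega>"
    using sigma_sets_into_sp[OF R.space_closed] by auto
  interpret S: sigma_algebra \<Omega> "sigma_sets \<Omega> R" using R.space_closed by (rule sigma_algebra_sigma_sets)
  have sQ: "sets Q = sigma_sets \<Omega> R" "space Q = \<Omega>"
    unfolding Q_def using sub S.sigma_sets_eq by (simp_all add: sets_measure_of space_measure_of)
  have Q\<mu>: "emeasure Q a = \<mu> a" if "a \<in> sigma_sets \<Omega> R" for a
    unfolding Q_def using ms that by (intro emeasure_measure_of_sigma) (auto simp: measure_space_def)
  have Q: "measure Q a = measure N a - measure P a" if "a \<in> R.generated_ring" for a
  proof (rule measure_eq_emeasure_eq_ennreal)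
    have "a \<in> sigma_sets \<Omega> R" using inN(1)[OF that] sN by simp
    then show "emeasure Q a = ennreal (measure N a - measure P a)" using Q\<mu> \<mu>[OF that] by (simp add: f_def)
  qed (use le_ring[OF that] in simp)
  have R_ring: "\<Omega> \<in> R.generated_ring" using R(2) by (rule R.generated_ringI_Basic)
  interpret Q: finite_measure Q
  proof
    have "emeasure Q \<Omega> = f \<Omega>" using Q\<mu>[of \<Omega>] \<mu>[OF R_ring] sigma_sets_top[of \<Omega> R] by simp
    then show "emeasure Q (space Q) \<noteq> \<infinity>" by (simp add: sQ f_def)
  qed
  have Int: "Int_stable R.generated_ring" by (intro Int_stableI G.Int)
  have E': "E \<in> sigma_sets \<Omega> R.generated_ring" using E sN GR by simp
  have "measure Q E = measure N E - measure P E"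
    using Int G.space_closed E'
  proof (induction rule: sigma_sets_induct_disjoint)
    case (basic A)
    then show ?case by (rule Q)
  next
    case (compl A)
    then have A: "A \<in> sets Q" "A \<in> sets N" "A \<in> sets P" by (simp_all add: sQ sN sP GR)
    have "measure Q (\<Omega> - A) = measure Q \<Omega> - measure Q A" "measure N (\<Omega> - A) = measure N \<Omega> - measure N A"
      "measure P (\<Omega> - A) = measure P \<Omega> - measure P A"
      using Q.finite_measure_compl[OF A(1)] N.finite_measure_compl[OF A(2)] P.finite_measure_compl[OF A(3)]
      by (simp_all add: sQ \<Omega>)
    then show ?case using compl(2) Q[OF R_ring] by simp
  next
    case (union A)
    then have A: "range A \<subseteq> sets Q" "range A \<subseteq> sets N" "range A \<subseteq> sets P" by (simp_all add: sQ sN sP GR)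
    have "(\<lambda>i. measure Q (A i)) sums measure Q (\<Union>i. A i)" using A union(1) by (intro Q.finite_measure_UNION)
    moreover have "(\<lambda>i. measure N (A i) - measure P (A i)) sums (measure N (\<Union>i. A i) - measure P (\<Union>i. A i))"
      using A union(1) by (intro sums_diff N.finite_measure_UNION P.finite_measure_UNION)
    ultimately show ?case unfolding union(3) by (rule sums_unique2)
  qed simp
  then show ?thesis using measure_nonneg[of Q E] by linarith
qed

lemma semiring_of_rectangles:
  fixes M :: "'a measure" and N :: "'b measure"
  shows
  "semiring_of_sets (space M \<times> space N) {a \<times> b |a b. a \<in> sets M \<and> b \<in> sets N}"
proof
  let ?R = "{a \<times> b |a b. a \<in> sets M \<and> b \<in> sets N}"
  show "?R \<subseteq> Pow (space M \<times> space N)" by (rule pair_measure_closed)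
  have "{} = {} \<times> ({} :: 'b set)" "{} \<in> sets M" "{} \<in> sets N" by auto
  then show "{} \<in> ?R" by blast
  fix x y assume "x \<in> ?R" "y \<in> ?R"
  then obtain a b c d where x: "x = a \<times> b" "a \<in> sets M" "b \<in> sets N" and y: "y = c \<times> d" "c \<in> sets M" "d \<in> sets N"
    by blast
  have "x \<inter> y = (a \<inter> c) \<times> (b \<inter> d)" using x y by auto
  moreover have "a \<inter> c \<in> sets M" "b \<inter> d \<in> sets N" using x y by auto
  ultimately show "x \<inter> y \<in> ?R" by blast
  let ?C = "{(a - c) \<times> b, (a \<inter> c) \<times> (b - d)}"
  have "a - c \<in> sets M" "a \<inter> c \<in> sets M" "b - d \<in> sets N" using x y by auto
  with x(3) have "?C \<subseteq> ?R" by auto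
  moreover have "disjoint ?C" unfolding disjoint_def by auto
  moreover have "x - y = \<Union>?C" using x y by auto
  ultimately show "\<exists>C\<subseteq>?R. finite C \<and> disjoint C \<and> x - y = \<Union>C" by (intro exI[of _ ?C]) auto
qed

context measure_flow
begin

lemma sigma_finite_M: "sigma_finite_measure M" ..

lemma prob_space_product: "prob_space (M \<Otimes>\<^sub>M M)"
proof -
  interpret pair_prob_space M M ..
  show ?thesis by (rule P.prob_space_axioms)
qed

lemma emeasure_product: "A \<in> sets M \<Longrightarrow> B \<in> sets M \<Longrightarrow> emeasure (M \<Otimes>\<^sub>M M) (A \<times> B) = ennreal (prob A * prob B)"
  by (simp add: emeasure_pair_measure_Times emeasure_eq_measure ennreal_mult)

lemma measure_product: "A \<in> sets M \<Longrightarrow> B \<in> sets M \<Longrightarrow> measure (M \<Otimes>\<^sub>M M) (A \<times> B) = prob A * prob B"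
  by (simp add: measure_def[of "M \<Otimes>\<^sub>M M"] emeasure_product)

lemma distr_product: "distr (M \<Otimes>\<^sub>M M) (M \<Otimes>\<^sub>M M) (map_prod (T s) (T t)) = M \<Otimes>\<^sub>M M"
proof -
  have "distr M M (T s) \<Otimes>\<^sub>M distr M M (T t) = distr (M \<Otimes>\<^sub>M M) (M \<Otimes>\<^sub>M M) (\<lambda>(x, y). (T s x, T t y))"
    by (intro pair_measure_distr) (simp_all add: T_distr sigma_finite_M)
  then show ?thesis by (simp add: T_distr map_prod_def)
qed

lemma product_joining: "joining M T (\<lambda>t. T (\<alpha> * t)) (M \<Otimes>\<^sub>M M)"
  unfolding joining_def using emeasure_space_1
  by (auto simp: distr_product emeasure_product emeasure_eq_measure prob_space)

text \<open>
  The normalised difference \<open>\<nu>' = (\<nu> - b (\<mu> \<times> \<mu>)) / (1 - b)\<close> is a measure by \<open>measure_le_of_semiring\<close>, and inherits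
  invariance and marginals from \<open>\<nu>\<close> and \<open>\<mu> \<times> \<mu>\<close>.
\<close>

lemma joining_remove_product:
  assumes J: "joining M T (\<lambda>t. T (\<alpha> * t)) \<nu>" and b: "0 \<le> b" "b < 1"
    and le: "\<And>A B. A \<in> sets M \<Longrightarrow> B \<in> sets M \<Longrightarrow> b * (prob A * prob B) \<le> measure \<nu> (A \<times> B)"
  obtains \<nu>' where "joining M T (\<lambda>t. T (\<alpha> * t)) \<nu>'"
    "\<And>E. E \<in> sets (M \<Otimes>\<^sub>M M) \<Longrightarrow> measure \<nu> E = b * measure (M \<Otimes>\<^sub>M M) E + (1 - b) * measure \<nu>' E"
proof -
  let ?\<pi> = "M \<Otimes>\<^sub>M M"
  interpret \<pi>: prob_space ?\<pi> by (rule prob_space_product)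
  have sets_\<nu> [measurable_cong]: "sets \<nu> = sets ?\<pi>" and distr_\<nu>: "\<And>t. distr \<nu> ?\<pi> (map_prod (T t) (T (\<alpha> * t))) = \<nu>"
    and m1: "\<And>A. A \<in> sets M \<Longrightarrow> emeasure \<nu> (A \<times> space M) = emeasure M A"
    and m2: "\<And>A. A \<in> sets M \<Longrightarrow> emeasure \<nu> (space M \<times> A) = emeasure M A"
    using J by (auto simp: joining_def)
  have space_\<nu>: "space \<nu> = space M \<times> space M"
    using sets_eq_imp_space_eq[OF sets_\<nu>] by (simp add: space_pair_measure)
  interpret \<nu>: prob_space \<nu> by standard (simp add: space_\<nu> m1 emeasure_space_1)
  define P where "P = scale_measure (ennreal b) ?\<pi>"
  have mP: "measure P E = b * measure ?\<pi> E" for E unfolding P_def using b by simp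
  have finP: "finite_measure P"
    by standard (simp add: P_def space_scale_measure \<pi>.emeasure_eq_measure ennreal_mult_eq_top_iff)
  have sP: "sets P = sets ?\<pi>" by (simp add: P_def)
  let ?R = "{a \<times> b |a b. a \<in> sets M \<and> b \<in> sets M}"
  have P_le: "measure P E \<le> measure \<nu> E" if "E \<in> sets ?\<pi>" for E
  proof (rule measure_le_of_semiring[OF semiring_of_rectangles _ \<nu>.finite_measure_axioms finP])
    show "space M \<times> space M \<in> ?R" by blast
    show "sets \<nu> = sigma_sets (space M \<times> space M) ?R" "sets P = sigma_sets (space M \<times> space M) ?R"
      by (simp_all add: sets_\<nu> sP sets_pair_measure)
    show "space \<nu> = space M \<times> space M" "space P = space M \<times> space M"
      by (simp_all add: space_\<nu> P_def space_scale_measure space_pair_measure)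
    show "E \<in> sets \<nu>" using that by (simp add: sets_\<nu>)
    fix a assume "a \<in> ?R"
    then show "measure P a \<le> measure \<nu> a" using le by (auto simp: mP measure_product)
  qed
  interpret P: finite_measure P by (rule finP)
  define \<nu>0 where "\<nu>0 = diff_measure \<nu> P"
  have e0: "emeasure \<nu>0 E = ennreal (measure \<nu> E - b * measure ?\<pi> E)" if "E \<in> sets ?\<pi>" for E
  proof -
    have "emeasure \<nu>0 E = emeasure \<nu> E - emeasure P E"
      unfolding \<nu>0_def
    proof (rule emeasure_diff_measure)
      show "finite_measure \<nu>" "finite_measure P" by (rule \<nu>.finite_measure_axioms finP)+
      show "sets \<nu> = sets P" by (simp add: sets_\<nu> sP)
      show "emeasure P A \<le> emeasure \<nu> A" if "A \<in> sets \<nu>" for A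
        using P_le[of A] that by (simp add: sets_\<nu> P.emeasure_eq_measure \<nu>.emeasure_eq_measure ennreal_leI)
      show "E \<in> sets \<nu>" using that by (simp add: sets_\<nu>)
    qed
    then show ?thesis using b by (simp add: P.emeasure_eq_measure \<nu>.emeasure_eq_measure mP ennreal_minus)
  qed
  define \<nu>' where "\<nu>' = scale_measure (ennreal (1 / (1 - b))) \<nu>0"
  define w where "w E = (measure \<nu> E - b * measure ?\<pi> E) / (1 - b)" for E
  have e': "emeasure \<nu>' E = ennreal (w E)" if "E \<in> sets ?\<pi>" for E
    using e0[OF that] b P_le[OF that] by (simp add: \<nu>'_def w_def ennreal_mult'[symmetric] mP)
  have s': "sets \<nu>' = sets ?\<pi>" by (simp add: \<nu>'_def \<nu>0_def sets_\<nu>)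
  have "joining M T (\<lambda>t. T (\<alpha> * t)) \<nu>'"
    unfolding joining_def
  proof (intro conjI allI ballI)
    show "sets \<nu>' = sets ?\<pi>" by (rule s')
    fix t
    let ?f = "map_prod (T t) (T (\<alpha> * t))"
    have f: "?f \<in> ?\<pi> \<rightarrow>\<^sub>M ?\<pi>" by (simp add: map_prod_def case_prod_beta)
    have f': "?f \<in> \<nu>' \<rightarrow>\<^sub>M ?\<pi>" "?f \<in> \<nu> \<rightarrow>\<^sub>M ?\<pi>"
      using f by (simp_all add: measurable_cong_sets[OF s' refl] measurable_cong_sets[OF sets_\<nu> refl])
    have sp: "space \<nu>' = space ?\<pi>" "space \<nu> = space ?\<pi>" by (rule sets_eq_imp_space_eq, rule s' sets_\<nu>)+
    show "distr \<nu>' ?\<pi> ?f = \<nu>'"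
    proof (rule measure_eqI)
      show "sets (distr \<nu>' ?\<pi> ?f) = sets \<nu>'" by (simp add: s')
      fix E assume "E \<in> sets (distr \<nu>' ?\<pi> ?f)"
      then have E: "E \<in> sets ?\<pi>" by simp
      have E': "?f -` E \<inter> space ?\<pi> \<in> sets ?\<pi>" using f E by (rule measurable_sets)
      have "measure ?\<pi> (?f -` E \<inter> space ?\<pi>) = measure ?\<pi> E"
        using measure_distr[OF f E] by (simp add: distr_product)
      moreover have "measure \<nu> (?f -` E \<inter> space ?\<pi>) = measure \<nu> E"
        using measure_distr[OF f'(2) E] by (simp add: distr_\<nu> sp)
      ultimately have "w (?f -` E \<inter> space ?\<pi>) = w E" by (simp add: w_def)
      then show "emeasure (distr \<nu>' ?\<pi> ?f) E = emeasure \<nu>' E"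
        using emeasure_distr[OF f'(1) E] e'[OF E] e'[OF E'] by (simp add: sp)
    qed
  next
    fix A assume A: "A \<in> sets M"
    have "measure \<nu> (A \<times> space M) = prob A" "measure \<nu> (space M \<times> A) = prob A"
      using m1[OF A] m2[OF A] by (simp_all add: measure_def)
    then have "w (A \<times> space M) = prob A" "w (space M \<times> A) = prob A"
      using b A by (simp_all add: w_def measure_product prob_space field_simps)
    then show "emeasure \<nu>' (A \<times> space M) = emeasure M A" "emeasure \<nu>' (space M \<times> A) = emeasure M A"
      using A by (simp_all add: e' emeasure_eq_measure)
  qed
  moreover have "measure \<nu> E = b * measure ?\<pi> E + (1 - b) * measure \<nu>' E" if E: "E \<in> sets ?\<pi>" for E
  proof -
    have "measure \<nu>' E = w E"
    proof (rule measure_eq_emeasure_eq_ennreal[OF _ e'[OF E]])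
      show "0 \<le> w E" using P_le[OF E] b by (simp add: w_def mP)
    qed
    then show ?thesis using b by (simp add: w_def)
  qed
  ultimately show ?thesis by (rule that)
qed

end

text \<open>
  Since the constant \<open>c\<close> of \<open>joining_ge_product\<close> is the same for all joinings, it also applies to the
  remainder after splitting off a multiple of the product measure. Each step thus multiplies the defect
  \<open>1 - b\<close> by \<open>1 - c\<close>.
\<close>

theorem (in rank_one_mixing_flow) disjoint_from_rescaling:
  fixes \<alpha> :: real
  assumes \<alpha>: "1 < \<alpha>" and J: "joining M T (\<lambda>t. T (\<alpha> * t)) \<nu>"
  shows "\<nu> = M \<Otimes>\<^sub>M M"
proof -
  define c where "c = (1 - 1 / \<alpha>) / 4"
  have \<alpha>': "0 < 1 / \<alpha>" "1 / \<alpha> < 1" using \<alpha> by simp_all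
  have c: "0 < c" using \<alpha>' unfolding c_def by (simp del: less_divide_eq_1_pos)
  have c1: "c < 1" using \<alpha>' unfolding c_def by (simp add: field_simps)
  have base: "c * (prob A * prob B) \<le> measure \<nu>' (A \<times> B)"
    if "joining M T (\<lambda>t. T (\<alpha> * t)) \<nu>'" "A \<in> sets M" "B \<in> sets M" for \<nu>' A B
  proof -
    interpret scaled_joining M T H p \<alpha> \<nu>' by standard (use \<alpha> that in auto)
    show ?thesis unfolding c_def using that(2,3) by (rule joining_ge_product)
  qed
  have iter: "(1 - (1 - c) ^ n) * (prob A * prob B) \<le> measure \<nu> (A \<times> B)" if "A \<in> sets M" "B \<in> sets M" for n A B
    using that
  proof (induction n arbitrary: A B)
    case 0
    then show ?case by simp
  next
    case (Suc n)
    define b where "b = 1 - (1 - c) ^ n"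
    have b: "0 \<le> b" "b < 1" using c c1 by (auto simp: b_def power_le_one)
    obtain \<nu>' where J': "joining M T (\<lambda>t. T (\<alpha> * t)) \<nu>'" and
      split: "\<And>E. E \<in> sets (M \<Otimes>\<^sub>M M) \<Longrightarrow> measure \<nu> E = b * measure (M \<Otimes>\<^sub>M M) E + (1 - b) * measure \<nu>' E"
      using joining_remove_product[OF J b] Suc.IH unfolding b_def by metis
    have "(1 - (1 - c) ^ Suc n) * (prob A * prob B) = b * (prob A * prob B) + (1 - b) * (c * (prob A * prob B))"
      by (simp add: b_def algebra_simps)
    also have "\<dots> \<le> b * (prob A * prob B) + (1 - b) * measure \<nu>' (A \<times> B)"
      using base[OF J' Suc.prems] b by (intro add_left_mono mult_left_mono) auto
    also have "\<dots> = measure \<nu> (A \<times> B)" using split[of "A \<times> B"] Suc.prems by (simp add: measure_product)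
    finally show ?case .
  qed
  have ge: "prob A * prob B \<le> measure \<nu> (A \<times> B)" if AB: "A \<in> sets M" "B \<in> sets M" for A B
  proof (rule LIMSEQ_le_const2)
    have "norm (1 - c) < 1" using c c1 by simp
    then have "(\<lambda>n. (1 - c) ^ n) \<longlonglongrightarrow> 0" by (rule LIMSEQ_power_zero)
    then have "(\<lambda>n. (1 - (1 - c) ^ n) * (prob A * prob B)) \<longlonglongrightarrow> (1 - 0) * (prob A * prob B)"
      by (intro tendsto_mult tendsto_diff tendsto_const)
    then show "(\<lambda>n. (1 - (1 - c) ^ n) * (prob A * prob B)) \<longlonglongrightarrow> prob A * prob B" by simp
    show "\<exists>N. \<forall>n\<ge>N. (1 - (1 - c) ^ n) * (prob A * prob B) \<le> measure \<nu> (A \<times> B)" using iter[OF AB] by blast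
  qed
  interpret scaled_joining M T H p \<alpha> \<nu> by standard (use \<alpha> J in auto)
  have eq: "measure \<nu> (A \<times> B) = prob A * prob B" if A: "A \<in> sets M" and B: "B \<in> sets M" for A B
  proof -
    have "measure \<nu> (A \<times> B) + measure \<nu> (A \<times> (space M - B)) = measure \<nu> (A \<times> B \<union> A \<times> (space M - B))"
      using A B by (intro N.finite_measure_Union[symmetric]) (auto simp: sets_\<nu>)
    also have "A \<times> B \<union> A \<times> (space M - B) = A \<times> space M" using sets.sets_into_space[OF B] by auto
    also have "measure \<nu> (A \<times> space M) = prob A" using emeasure_\<nu>_fst[OF A] by (simp add: measure_def)
    also have "prob A = prob A * prob B + prob A * prob (space M - B)"
      using B by (simp add: prob_compl algebra_simps)
    finally show ?thesis using ge[OF A B] ge[of A "space M - B"] A B by auto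
  qed
  have "M \<Otimes>\<^sub>M M = \<nu>"
    using sigma_finite_M sigma_finite_M
  proof (rule pair_measure_eqI)
    show "sets (M \<Otimes>\<^sub>M M) = sets \<nu>" by (simp add: sets_\<nu>)
    fix A B assume "A \<in> sets M" "B \<in> sets M"
    then show "emeasure M A * emeasure M B = emeasure \<nu> (A \<times> B)"
      by (simp add: N.emeasure_eq_measure emeasure_eq_measure eq ennreal_mult)
  qed
  then show ?thesis by simp
qed

theorem theorem2:
  fixes M :: "'a measure" and T :: "real \<Rightarrow> 'a \<Rightarrow> 'a"
  assumes "lebesgue_prob_space M"
    and "mp_flow M T"
    and "mixing_flow M T"
    and "rank_one_flow M T"
  shows "\<forall>\<alpha>>1. disjoint_flows M T (\<lambda>t. T (\<alpha> * t))"
proof -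
  interpret prob_space M using assms(1) by (simp add: lebesgue_prob_space_def)
  interpret mixing_measure_flow M T by standard (fact assms(2,3))+
  show ?thesis
  proof (rule rank_one_height_funs[OF assms(4)])
    fix H :: "nat \<Rightarrow> real" and p
    assume Hp: "\<And>j::nat. height_fun (H j) (p j)"
      "\<And>A. A \<in> sets M \<Longrightarrow> \<exists>S. (\<forall>j. S j \<in> sets borel \<and> S j \<subseteq> {0..<H j}) \<and>
         (\<lambda>j. prob (sym_diff A (floors (p j) (S j)))) \<longlonglongrightarrow> 0"
    interpret rank_one_mixing_flow M T H p by standard (fact Hp)+
    show ?thesis
      unfolding disjoint_flows_def using disjoint_from_rescaling product_joining by blast
  qed
qed

end
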